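(* Let $n\geq 2$ be an integer. Then the inequality $$\delta(u)\;\geq\;\frac{1}{384(n+2)}\,\inf\Big\{\frac{\int_{\mathbb{R}^n}|\nabla u-\nabla\varphi|^2\,dx}{\int_{\mathbb{R}^n}|\nabla u|^2\,dx}\;:\;\varphi\in E,\ \int_{\mathbb{R}^n}|\nabla u|^2\,dx=\int_{\mathbb{R}^n}|\nabla\varphi|^2\,dx\Big\}$$ holds for every $u\in H^2_{0,-2}(\mathbb{R}^n)\setminus\{0\}$.
   Context: Functions are real-valued. $H^2_{0,-2}(\mathbb{R}^n)$ denotes the completion of $C_0^\infty(\mathbb{R}^n)$ under the norm $$\|u\|=\Big(\int_{\mathbb{R}^n}|\Delta u|^2\,dx+\int_{\mathbb{R}^n}|\nabla u|^2|x|^2\,dx\Big)^{1/2}.$$ For $u\in H^2_{0,-2}(\mathbb{R}^n)\setminus\{0\}$, $$\delta(u)=\frac{\Big(\int_{\mathbb{R}^n}|\Delta u|^2\,dx\Big)^{1/2}\Big(\int_{\mathbb{R}^n}|x|^2|\nabla u|^2\,dx\Big)^{1/2}}{\frac{n+2}{2}\int_{\mathbb{R}^n}|\nabla u|^2\,dx}-1.$$ The set $E$ is $$E=\big\{c\,e^{-a|x|^2}\;:\;c\in\mathbb{R},\ a>0\big\}.$$ *)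

theory Defs
  imports "HOL-Analysis.Analysis"
begin

definition partial :: "'n::finite \<Rightarrow> (real^'n \<Rightarrow> real) \<Rightarrow> real^'n \<Rightarrow> real" where
  "partial i f x = frechet_derivative f (at x) (axis i 1)"

definition grad :: "(real^'n::finite \<Rightarrow> real) \<Rightarrow> real^'n \<Rightarrow> real^'n" where
  "grad f x = (\<chi> i. partial i f x)"

definition laplacian :: "(real^'n::finite \<Rightarrow> real) \<Rightarrow> real^'n \<Rightarrow> real" where
  "laplacian f x = (\<Sum>i\<in>UNIV. partial i (partial i f) x)"

primrec C_k :: "nat \<Rightarrow> (real^'n::finite \<Rightarrow> real) \<Rightarrow> bool" where
  "C_k 0 f \<longleftrightarrow> continuous_on UNIV f"
| "C_k (Suc k) f \<longleftrightarrow> f differentiable_on UNIV \<and> (\<forall>i. C_k k (partial i f))"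

definition test_functions :: "(real^'n::finite \<Rightarrow> real) set" where
  "test_functions = {f. (\<forall>k. C_k k f) \<and> compact (closure {x. f x \<noteq> 0})}"

definition loc_integrable :: "(real^'n::finite \<Rightarrow> real) \<Rightarrow> bool" where
  "loc_integrable f \<longleftrightarrow> (\<forall>K. compact K \<longrightarrow> set_integrable lebesgue K f)"

definition has_weak_grad ::
    "(real^'n::finite \<Rightarrow> real) \<Rightarrow> (real^'n \<Rightarrow> real^'n) \<Rightarrow> bool" where
  "has_weak_grad u G \<longleftrightarrow>
     loc_integrable u \<and> (\<forall>i. loc_integrable (\<lambda>x. G x $ i)) \<and>
     (\<forall>\<psi>\<in>test_functions. \<forall>i.
        (LINT x|lebesgue. u x * partial i \<psi> x) = - (LINT x|lebesgue. G x $ i * \<psi> x))"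

definition has_weak_laplacian ::
    "(real^'n::finite \<Rightarrow> real) \<Rightarrow> (real^'n \<Rightarrow> real) \<Rightarrow> bool" where
  "has_weak_laplacian u L \<longleftrightarrow>
     loc_integrable u \<and> loc_integrable L \<and>
     (\<forall>\<psi>\<in>test_functions.
        (LINT x|lebesgue. u x * laplacian \<psi> x) = (LINT x|lebesgue. L x * \<psi> x))"

text \<open>Weak derivatives are unique only up to null sets; a representative is chosen, on which none
  of the integrals below depends.\<close>

definition weak_grad :: "(real^'n::finite \<Rightarrow> real) \<Rightarrow> real^'n \<Rightarrow> real^'n" where
  "weak_grad u = (SOME G. has_weak_grad u G)"

definition weak_laplacian :: "(real^'n::finite \<Rightarrow> real) \<Rightarrow> real^'n \<Rightarrow> real" where
  "weak_laplacian u = (SOME L. has_weak_laplacian u L)"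

definition H_norm :: "(real^'n::finite \<Rightarrow> real) \<Rightarrow> real" where
  "H_norm f = sqrt ((LINT x|lebesgue. (laplacian f x)\<^sup>2) +
                    (LINT x|lebesgue. (norm (grad f x))\<^sup>2 * (norm x)\<^sup>2))"

text \<open>By the Hardy inequality
  \<open>(n/2)\<^sup>2 \<integral> \<bar>\<phi>\<bar>\<^sup>2 \<le> \<integral> \<bar>x\<bar>\<^sup>2 \<bar>\<nabla>\<phi>\<bar>\<^sup>2\<close> for test functions, a sequence of test functions that is
  Cauchy for \<open>H_norm\<close> converges in \<open>L\<^sup>2\<close>, and by integration by parts its
  \<open>L\<^sup>2\<close> limit is \<open>0\<close> only if its \<open>H_norm\<close> tends to \<open>0\<close>. So the completion \<open>H\<^sup>2\<^sub>0\<^sub>,\<^sub>-\<^sub>2\<close> of the test functions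
  under \<open>H_norm\<close> is the space of these \<open>L\<^sup>2\<close> limits. Its elements are represented by functions,
  with two functions that agree almost everywhere standing for the same element.\<close>

definition H2_0m2 :: "(real^'n::finite \<Rightarrow> real) set" where
  "H2_0m2 = {u. u \<in> borel_measurable lebesgue \<and>
     (\<exists>\<phi>. (\<forall>k. \<phi> k \<in> test_functions) \<and>
       (\<forall>e>0. \<exists>N. \<forall>j\<ge>N. \<forall>k\<ge>N. H_norm (\<lambda>x. \<phi> j x - \<phi> k x) < e) \<and>
       (\<forall>k. integrable lebesgue (\<lambda>x. (\<phi> k x - u x)\<^sup>2)) \<and>
       (\<lambda>k::nat. LINT x|lebesgue. (\<phi> k x - u x)\<^sup>2) \<longlonglongrightarrow> 0)}"

definition deficit :: "(real^'n::finite \<Rightarrow> real) \<Rightarrow> real" where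
  "deficit u =
     sqrt (LINT x|lebesgue. (weak_laplacian u x)\<^sup>2) *
     sqrt (LINT x|lebesgue. (norm x)\<^sup>2 * (norm (weak_grad u x))\<^sup>2) /
     ((real CARD('n) + 2) / 2 * (LINT x|lebesgue. (norm (weak_grad u x))\<^sup>2)) - 1"

definition Gaussians :: "(real^'n::finite \<Rightarrow> real) set" where
  "Gaussians = {(\<lambda>x. c * exp (- a * (norm x)\<^sup>2)) | c a. a > 0}"

end

theory Submission
  imports Defs "HOL-Probability.Distributions"
begin

text \<open>For \<open>b > 0\<close> put \<open>E\<^sub>b = \<integral>\<bar>\<Delta>u\<bar>\<^sup>2 + b\<^sup>2 \<integral>\<bar>x\<bar>\<^sup>2\<bar>\<nabla>u\<bar>\<^sup>2 - (n + 2) b \<integral>\<bar>\<nabla>u\<bar>\<^sup>2\<close>. Integration by parts gives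
  \<open>E\<^sub>b = \<Sum>\<^sub>j \<integral>\<bar>\<nabla>(\<partial>\<^sub>j u + b x\<^sub>j u)\<bar>\<^sup>2\<close>, and for \<open>b\<close> minimising \<open>E\<^sub>b / b\<close> the deficit is
  \<open>E\<^sub>b / (b (n + 2) \<integral>\<bar>\<nabla>u\<bar>\<^sup>2)\<close>. So it suffices that \<open>9 E\<^sub>b / b\<close> bounds the squared distance of \<open>\<nabla>u\<close> from the line
  spanned by the gradient of the Gaussian \<open>\<gamma> = exp (- b \<bar>x\<bar>\<^sup>2 / 2)\<close>.

  Since \<open>E\<^sub>b + 2 b \<integral>\<bar>\<nabla>u\<bar>\<^sup>2\<close> is the energy of the components of \<open>\<nabla>u\<close> for the number operator
  \<open>\<Sum>\<^sub>k (\<partial>\<^sub>k + b x\<^sub>k)\<^sup>*(\<partial>\<^sub>k + b x\<^sub>k)\<close> of the harmonic oscillator, this follows from a spectral gap: the operator is at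
  least \<open>3 b\<close> off its two lowest eigenspaces. The gap is obtained by rotating \<open>f(x) \<gamma>(y)\<close> in the
  \<open>(x, y)\<close>-plane: the speed of this curve is the energy of \<open>f\<close>, while parity makes points at angle
  \<open>\<pi>/4\<close> orthogonal. The components of \<open>\<nabla>u\<close> along the two lowest eigenspaces are moments of \<open>u\<close> against
  polynomial multiples of \<open>\<gamma>\<close>; apart from the one that spans the Gaussian direction, they are also moments
  of the derivatives of \<open>\<partial>\<^sub>j u + b x\<^sub>j u\<close>, hence bounded by \<open>E\<^sub>b\<close>.\<close>

text \<open>The number operator has the eigenvalues 0, 2b, 4b, ..., and the components x_j gamma of
  the Gaussian's gradient belong to 2b; this is the origin of the term 2b added to E_b. Hence only a
  gap strictly above 2b is of use. The curves give 3b in place of 4b without an expansion in Hermite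
  functions, and the surplus 3b - 2b = b is the factor in front of the distance to the Gaussians.
  Parity is split because an even function need only lose its Gaussian component, whereas an odd one
  meets the whole eigenspace x_k gamma at 2b, which enters as an explicit moment term. The moments
  cost 6 E_b for the means of the gradient and 2 E_b for the trace-free first moments; with E_b
  itself this makes 9. What remains, the trace of the first moments, is the Gaussian direction.
  Competitors must have the gradient norm of u, so a distance to a line has to be turned into one to
  a point of a sphere, which at most doubles its square. The estimates for test functions keep b
  free, because the optimal b belongs to u and not to its approximants.\<close>

section \<open>Gaussian integrals\<close>

text \<open>Integrate \<open>h' (x + s *\<^sub>R e)\<close> over all x and over s in [0, 1]. For
  fixed s translation invariance gives the integral of \<open>h'\<close>; for fixed x the
  fundamental theorem gives \<open>h (x + e) - h x\<close>, whose integral vanishes by translation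
  invariance again. Integrability thus takes the place of decay at infinity, so Gaussians and
  compactly supported functions are covered alike.\<close>

lemma integral_directional_derivative_eq_0:
  fixes h h' :: "'a::euclidean_space \<Rightarrow> real"
  assumes deriv: "\<And>x. ((\<lambda>t. h (x + t *\<^sub>R e)) has_real_derivative h' x) (at 0)"
    and cont: "continuous_on UNIV h'"
    and h: "integrable lborel h" and h': "integrable lborel h'"
  shows "integral\<^sup>L lborel h' = 0"
proof -
  have deriv': "((\<lambda>t. h (x + t *\<^sub>R e)) has_real_derivative h' (x + s *\<^sub>R e)) (at s)" for x s
    using DERIV_shift[of "\<lambda>t. h (x + t *\<^sub>R e)" "h' (x + s *\<^sub>R e)" 0 s] deriv[of "x + s *\<^sub>R e"]
    by (simp add: algebra_simps)
  have ftc: "(LBINT s. indicator {0..1} s * h' (x + s *\<^sub>R e)) = h (x + e) - h x" for x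
  proof -
    have "(LBINT s. indicator {0..1} s *\<^sub>R h' (x + s *\<^sub>R e)) = h (x + 1 *\<^sub>R e) - h (x + 0 *\<^sub>R e)"
      by (rule integral_FTC_atLeastAtMost)
        (auto intro!: continuous_on_compose2[OF cont] continuous_intros has_field_derivative_at_within
          deriv' simp flip: has_real_derivative_iff_has_vector_derivative)
    then show ?thesis by simp
  qed
  have shift: "distr lborel borel ((+) v) = (lborel :: 'a measure)" for v
    by (rule lborel_distr_plus)
  have int_shift: "integrable lborel (\<lambda>x. g (x + v))"
    "(LBINT x. g (x + v)) = (LBINT x. g x)"
    if "integrable lborel g" for g :: "'a \<Rightarrow> real" and v
  proof -
    have m: "g \<in> borel_measurable borel" using that by simp
    have "integrable (distr lborel borel ((+) v)) g" by (simp add: shift that)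
    then show "integrable lborel (\<lambda>x. g (x + v))"
      using m by (subst (asm) integrable_distr_eq) (auto simp: add.commute)
    have "(LBINT x. g (v + x)) = integral\<^sup>L (distr lborel borel ((+) v)) g"
      using m by (subst integral_distr) auto
    then show "(LBINT x. g (x + v)) = (LBINT x. g x)"
      by (simp add: shift add.commute)
  qed
  have meas: "(\<lambda>(s, x). indicator {0..1} s * h' (x + s *\<^sub>R e)) \<in> borel_measurable (lborel \<Otimes>\<^sub>M lborel)"
  proof -
    have "continuous_on UNIV (\<lambda>p::real \<times> 'a. h' (snd p + fst p *\<^sub>R e))"
      by (auto intro!: continuous_on_compose2[OF cont] continuous_intros)
    then have "(\<lambda>p::real \<times> 'a. h' (snd p + fst p *\<^sub>R e)) \<in> borel_measurable borel"
      by (rule borel_measurable_continuous_onI)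
    then have "(\<lambda>p::real \<times> 'a. h' (snd p + fst p *\<^sub>R e)) \<in> borel_measurable (lborel \<Otimes>\<^sub>M lborel)"
      by (simp add: lborel_prod)
    then show ?thesis by (simp add: case_prod_beta)
  qed
  have int: "integrable (lborel \<Otimes>\<^sub>M lborel) (\<lambda>(s, x). indicator {0..1} s * h' (x + s *\<^sub>R e))"
  proof (rule lborel_pair.Fubini_integrable[OF meas])
    have "(LBINT x. norm (indicator {0..1} s * h' (x + s *\<^sub>R e)))
        = indicator {0..1} s * (LBINT x. \<bar>h' x\<bar>)" for s :: real
      using int_shift(2)[OF integrable_abs[OF h']] by (simp add: abs_mult)
    then show "integrable lborel (\<lambda>s::real. LBINT x. norm (case (s, x) of (s, x) \<Rightarrow> indicator {0..1} s * h' (x + s *\<^sub>R e)))"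
      by simp
    show "AE s in lborel. integrable lborel (\<lambda>x. case (s, x) of (s, x) \<Rightarrow> indicator {0..1} s * h' (x + s *\<^sub>R e))"
      using int_shift(1)[OF h'] by simp
  qed
  have "(\<integral>x. (LBINT s. indicator {0..1} s * h' (x + s *\<^sub>R e)) \<partial>lborel)
      = (\<integral>s. (LBINT x. indicator {0..1} s * h' (x + s *\<^sub>R e)) \<partial>lborel)"
    using lborel_pair.Fubini_integral[OF int] by simp
  also have "\<dots> = (LBINT s. indicator {0..1::real} s * integral\<^sup>L lborel h')"
    using int_shift(2)[OF h'] by simp
  also have "\<dots> = integral\<^sup>L lborel h'" by simp
  finally have "integral\<^sup>L lborel h' = (LBINT x. h (x + e) - h x)"
    by (simp add: ftc)
  also have "\<dots> = 0"
    using int_shift[OF h, of e] h by simp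
  finally show ?thesis .
qed

text \<open>With the factor 1/2 this is the common kernel of all d_k + b x_k, the ground state of
  the oscillator.\<close>

definition gauss :: "real \<Rightarrow> 'a::euclidean_space \<Rightarrow> real" where
  "gauss b x = exp (- b * (norm x)\<^sup>2 / 2)"

lemma gauss_pos: "gauss b x > 0"
  by (simp add: gauss_def)

lemma gauss_minus [simp]: "gauss b (- x) = gauss b x"
  by (simp add: gauss_def)

lemma gauss_power2: "(gauss b x)\<^sup>2 = gauss (2 * b) x"
  by (simp add: gauss_def flip: exp_double)

lemma continuous_on_gauss [continuous_intros]:
  "continuous_on S g \<Longrightarrow> continuous_on S (\<lambda>x. gauss b (g x))"
  unfolding gauss_def by (intro continuous_intros) auto

lemma integrable_gauss:
  assumes "b > 0"
  shows "integrable lborel (gauss b :: 'a::euclidean_space \<Rightarrow> real)"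
proof -
  define N where "N = normal_density 0 (1 / sqrt b)"
  have N: "exp (- b * t\<^sup>2 / 2) = sqrt (2 * pi / b) * N t" for t
    using assms by (simp add: N_def normal_density_def real_sqrt_divide real_sqrt_mult power_divide)
  have int1: "integrable lborel (\<lambda>t. exp (- b * t\<^sup>2 / 2))"
    unfolding N N_def using assms by (intro integrable_mult_right integrable_normal_density) auto
  have eq: "ennreal (gauss b x) = (\<Prod>i\<in>Basis. ennreal (exp (- b * (x \<bullet> i)\<^sup>2 / 2)))" for x :: 'a
  proof -
    have "(norm x)\<^sup>2 = (\<Sum>i\<in>Basis. (x \<bullet> i)\<^sup>2)"
      unfolding power2_norm_eq_inner by (subst euclidean_inner) (simp add: power2_eq_square)
    then have "gauss b x = (\<Prod>i\<in>Basis. exp (- b * (x \<bullet> i)\<^sup>2 / 2))"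
      by (simp add: gauss_def sum_distrib_left sum_negf sum_divide_distrib flip: exp_sum)
    then show ?thesis by (simp add: prod_ennreal)
  qed
  have "(\<integral>\<^sup>+x. ennreal (gauss b x) \<partial>(lborel :: 'a measure))
      = (\<Prod>i\<in>(Basis :: 'a set). (\<integral>\<^sup>+t. ennreal (exp (- b * t\<^sup>2 / 2)) \<partial>lborel))"
    unfolding eq by (rule nn_integral_lborel_prod) auto
  also have "\<dots> < \<infinity>"
    using int1 by (simp add: nn_integral_eq_integral ennreal_power)
  finally show ?thesis
    by (intro integrableI_nonneg)
      (auto intro!: borel_measurable_continuous_onI continuous_intros simp: gauss_pos less_imp_le)
qed

lemma integrable_gauss_bound:
  fixes g :: "'a::euclidean_space \<Rightarrow> real"
  assumes b: "b > 0" and g: "continuous_on UNIV g"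
    and bound: "\<And>x. \<bar>g x\<bar> \<le> C * (1 + (norm x)\<^sup>2) * gauss b x"
  shows "integrable lborel g"
proof (rule Bochner_Integration.integrable_bound)
  show "integrable lborel (\<lambda>x::'a. \<bar>C\<bar> * (1 + 4 / b) * gauss (b / 2) x)"
    using b by (intro integrable_mult_right integrable_gauss) auto
  show "g \<in> borel_measurable lborel"
    using g by (auto intro: borel_measurable_continuous_onI)
  have "norm (g x) \<le> norm (\<bar>C\<bar> * (1 + 4 / b) * gauss (b / 2) x)" for x
  proof -
    \<comment> \<open>Half of the exponent absorbs the quadratic growth, because t <= exp t at t = b
      |x|^2 / 4, which also explains 4 / b; the other half remains as integrable majorant.\<close>
    have sq: "gauss b x = gauss (b / 2) x * gauss (b / 2) x"
      using gauss_power2[of "b / 2" x] by (simp add: power2_eq_square)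
    have le1: "gauss (b / 2) x \<le> 1" using b by (simp add: gauss_def)
    have "b * (norm x)\<^sup>2 / 4 * gauss (b / 2) x \<le> exp (b * (norm x)\<^sup>2 / 4) * gauss (b / 2) x"
    proof (intro mult_right_mono)
      show "b * (norm x)\<^sup>2 / 4 \<le> exp (b * (norm x)\<^sup>2 / 4)"
        using exp_ge_add_one_self[of "b * (norm x)\<^sup>2 / 4"] by linarith
    qed (simp add: gauss_pos less_imp_le)
    also have "\<dots> = 1" by (simp add: gauss_def flip: exp_add)
    finally have "(norm x)\<^sup>2 * gauss (b / 2) x \<le> 4 / b" using b by (simp add: field_simps)
    with le1 have *: "(1 + (norm x)\<^sup>2) * gauss (b / 2) x \<le> 1 + 4 / b" by (simp add: algebra_simps)
    have "\<bar>g x\<bar> \<le> \<bar>C\<bar> * (1 + (norm x)\<^sup>2) * gauss b x"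
      using bound[of x] by (rule order_trans) (intro mult_right_mono, auto simp: gauss_pos less_imp_le)
    also have "\<dots> = \<bar>C\<bar> * (((1 + (norm x)\<^sup>2) * gauss (b / 2) x) * gauss (b / 2) x)"
      by (simp add: sq algebra_simps)
    also have "\<dots> \<le> \<bar>C\<bar> * ((1 + 4 / b) * gauss (b / 2) x)"
      by (intro mult_left_mono mult_right_mono *) (auto simp: gauss_pos less_imp_le)
    finally show ?thesis using b by (simp add: abs_mult gauss_pos less_imp_le abs_of_pos)
  qed
  then show "AE x in lborel. norm (g x) \<le> norm (\<bar>C\<bar> * (1 + 4 / b) * gauss (b / 2) x)" by simp
qed

lemma gauss_has_real_derivative:
  "((\<lambda>t. gauss b (x + t *\<^sub>R e)) has_real_derivative - b * (x \<bullet> e) * gauss b x) (at 0)"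
  unfolding gauss_def power2_norm_eq_inner
  by (auto intro!: derivative_eq_intros simp: inner_add_left inner_add_right inner_commute)

abbreviation gauss_mass :: "'a::euclidean_space itself \<Rightarrow> real \<Rightarrow> real" where
  "gauss_mass T b \<equiv> integral\<^sup>L lborel (\<lambda>x::'a. (gauss b x)\<^sup>2)"

lemma norm_add_one_sq_bound: "norm x \<le> 1 + (norm x)\<^sup>2"
  by (metis add.commute add_increasing2 le_add_same_cancel1 linear mult_left_mono norm_ge_zero
      order_trans power2_eq_square mult.right_neutral zero_le_one zero_le_power2)

lemma integrable_gauss_moments:
  fixes u v :: "'a::euclidean_space"
  assumes "b > 0"
  shows "integrable lborel (\<lambda>x::'a. (gauss b x)\<^sup>2)"
    and "integrable lborel (\<lambda>x. (x \<bullet> u) * (gauss b x)\<^sup>2)"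
    and "integrable lborel (\<lambda>x. (x \<bullet> u) * (x \<bullet> v) * (gauss b x)\<^sup>2)"
proof -
  show "integrable lborel (\<lambda>x::'a. (gauss b x)\<^sup>2)"
    unfolding gauss_power2 using assms by (intro integrable_gauss) auto
  have "\<bar>x \<bullet> u\<bar> \<le> norm u * (1 + (norm x)\<^sup>2)" for x
    using Cauchy_Schwarz_ineq2[of x u] mult_right_mono[OF norm_add_one_sq_bound[of x], of "norm u"]
    by (auto simp: algebra_simps)
  then show "integrable lborel (\<lambda>x. (x \<bullet> u) * (gauss b x)\<^sup>2)"
    unfolding gauss_power2 using assms
    by (intro integrable_gauss_bound[where b="2*b" and C="norm u"])
      (auto intro!: continuous_intros mult_right_mono simp: abs_mult gauss_pos less_imp_le abs_of_pos)
  have "\<bar>(x \<bullet> u) * (x \<bullet> v)\<bar> \<le> norm u * norm v * (1 + (norm x)\<^sup>2)" for x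
  proof -
    have "\<bar>(x \<bullet> u) * (x \<bullet> v)\<bar> \<le> (norm x * norm u) * (norm x * norm v)"
      unfolding abs_mult by (intro mult_mono Cauchy_Schwarz_ineq2) auto
    also have "\<dots> \<le> norm u * norm v * (1 + (norm x)\<^sup>2)"
      by (simp add: power2_eq_square algebra_simps)
    finally show ?thesis .
  qed
  then show "integrable lborel (\<lambda>x. (x \<bullet> u) * (x \<bullet> v) * (gauss b x)\<^sup>2)"
    unfolding gauss_power2 using assms
    by (intro integrable_gauss_bound[where b="2*b" and C="norm u * norm v"])
      (auto intro!: continuous_intros mult_right_mono simp: abs_mult gauss_pos less_imp_le abs_of_pos mult.assoc)
qed

text \<open>The derivative of (x . u) gauss^2 in the direction v has integral 0 and consists of the
  two terms compared here. Consequently the functions x_i gauss are orthogonal with the common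
  squared norm Z / (2 b), where Z is the mass.\<close>

lemma gauss_second_moment:
  fixes u v :: "'a::euclidean_space"
  assumes b: "b > 0"
  shows "(LBINT x. (x \<bullet> u) * (x \<bullet> v) * (gauss b x)\<^sup>2)
    = (u \<bullet> v) / (2 * b) * gauss_mass TYPE('a) b"
proof -
  have "(LBINT x. (u \<bullet> v) * (gauss b x)\<^sup>2 - 2 * b * ((x \<bullet> u) * (x \<bullet> v) * (gauss b x)\<^sup>2)) = 0"
  proof (rule integral_directional_derivative_eq_0[where e = v and h = "\<lambda>x. (x \<bullet> u) * (gauss b x)\<^sup>2"])
    show "((\<lambda>t. ((x + t *\<^sub>R v) \<bullet> u) * (gauss b (x + t *\<^sub>R v))\<^sup>2) has_real_derivative
        (u \<bullet> v) * (gauss b x)\<^sup>2 - 2 * b * ((x \<bullet> u) * (x \<bullet> v) * (gauss b x)\<^sup>2)) (at 0)" for x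
      by (auto intro!: derivative_eq_intros gauss_has_real_derivative
          simp: inner_add_left inner_commute power2_eq_square algebra_simps)
  qed (auto intro!: continuous_intros integrable_gauss_moments[OF b])
  then have "(u \<bullet> v) * gauss_mass TYPE('a) b
      - 2 * b * (LBINT x. (x \<bullet> u) * (x \<bullet> v) * (gauss b x)\<^sup>2) = 0"
    using integrable_gauss_moments[OF b] by (subst (asm) Bochner_Integration.integral_diff) auto
  then show ?thesis using b by (simp add: field_simps)
qed

lemma gauss_mass_pos: "b > 0 \<Longrightarrow> gauss_mass TYPE('a::euclidean_space) b > 0"
proof -
  assume b: "b > 0"
  have "gauss_mass TYPE('a) b \<noteq> 0"
  proof
    assume "gauss_mass TYPE('a) b = 0"
    then have "AE x in (lborel :: 'a measure). (gauss b x)\<^sup>2 = 0"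
      using integral_nonneg_eq_0_iff_AE[OF integrable_gauss_moments(1)[OF b, where 'a='a]] by simp
    then have "AE x in (lborel :: 'a measure). False"
      by eventually_elim (metis gauss_pos less_irrefl power_eq_0_iff)
    then show False by (simp add: AE_iff_measurable[OF _ refl] flip: )
  qed
  moreover have "gauss_mass TYPE('a) b \<ge> 0" by simp
  ultimately show "gauss_mass TYPE('a) b > 0" by linarith
qed

section \<open>Square-integrable functions and rotations\<close>

text \<open>A predicate on functions, not on classes, since rotations and derivatives act pointwise;
  the measure is a parameter because continuous functions are integrated over \<open>lborel\<close>
  and limits of test functions over its completion.\<close>

definition square_integrable :: "'a measure \<Rightarrow> ('a \<Rightarrow> real) \<Rightarrow> bool" where
  "square_integrable M f \<longleftrightarrow> f \<in> borel_measurable M \<and> integrable M (\<lambda>x. (f x)\<^sup>2)"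

lemma square_integrable_measurable: "square_integrable M f \<Longrightarrow> f \<in> borel_measurable M"
  by (simp add: square_integrable_def)

lemma square_integrable_integrable: "square_integrable M f \<Longrightarrow> integrable M (\<lambda>x. (f x)\<^sup>2)"
  by (simp add: square_integrable_def)

lemma square_integrable_bound:
  assumes "square_integrable M g" "f \<in> borel_measurable M" "\<And>x. \<bar>f x\<bar> \<le> \<bar>g x\<bar>"
  shows "square_integrable M f"
  unfolding square_integrable_def
proof
  show "integrable M (\<lambda>x. (f x)\<^sup>2)"
    using assms by (intro Bochner_Integration.integrable_bound[OF square_integrable_integrable[OF assms(1)]])
      (auto simp: power2_abs abs_le_square_iff[symmetric])
qed (rule assms)

lemma integrable_mult_square_integrable:
  assumes "square_integrable M f" "square_integrable M g"
  shows "integrable M (\<lambda>x. f x * g x)"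
proof (rule Bochner_Integration.integrable_bound)
  show "integrable M (\<lambda>x. (f x)\<^sup>2 + (g x)\<^sup>2)"
    using assms by (auto simp: square_integrable_def)
  show "(\<lambda>x. f x * g x) \<in> borel_measurable M"
    using assms by (auto simp: square_integrable_def)
  have "\<bar>f x * g x\<bar> \<le> (f x)\<^sup>2 + (g x)\<^sup>2" for x
  proof -
    have "2 * \<bar>f x\<bar> * \<bar>g x\<bar> \<le> \<bar>f x\<bar>\<^sup>2 + \<bar>g x\<bar>\<^sup>2" by (rule sum_squares_bound)
    moreover have "0 \<le> \<bar>f x\<bar> * \<bar>g x\<bar>" by simp
    ultimately show ?thesis unfolding abs_mult power2_abs by linarith
  qed
  then show "AE x in M. norm (f x * g x) \<le> norm ((f x)\<^sup>2 + (g x)\<^sup>2)" by simp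
qed

lemma square_integrable_mult_left:
  "square_integrable M f \<Longrightarrow> square_integrable M (\<lambda>x. c * f x)"
  by (auto simp: square_integrable_def power_mult_distrib)

lemma square_integrable_minus:
  "square_integrable M f \<Longrightarrow> square_integrable M (\<lambda>x. - f x)"
  using square_integrable_mult_left[of M f "-1"] by simp

lemma square_integrable_add:
  assumes "square_integrable M f" "square_integrable M g"
  shows "square_integrable M (\<lambda>x. f x + g x)"
proof -
  have "integrable M (\<lambda>x. (f x)\<^sup>2 + 2 * (f x * g x) + (g x)\<^sup>2)"
    using assms integrable_mult_square_integrable[OF assms]
    by (intro Bochner_Integration.integrable_add integrable_mult_right) (auto simp: square_integrable_def)
  moreover have "(\<lambda>x. (f x)\<^sup>2 + 2 * (f x * g x) + (g x)\<^sup>2) = (\<lambda>x. (f x + g x)\<^sup>2)"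
    by (auto simp: power2_eq_square algebra_simps)
  ultimately show ?thesis using assms by (auto simp: square_integrable_def)
qed

lemma square_integrable_diff:
  assumes "square_integrable M f" "square_integrable M g"
  shows "square_integrable M (\<lambda>x. f x - g x)"
  using square_integrable_add[OF assms(1) square_integrable_minus[OF assms(2)]] by simp

lemma square_integrable_sum:
  "(\<And>i. i \<in> I \<Longrightarrow> square_integrable M (f i)) \<Longrightarrow> square_integrable M (\<lambda>x. \<Sum>i\<in>I. f i x)"
proof (induction I rule: infinite_finite_induct)
  case (insert i I)
  then show ?case using square_integrable_add[of M "f i" "\<lambda>x. \<Sum>i\<in>I. f i x"] by simp
qed (simp_all add: square_integrable_def)

lemma integral_add_power2:
  assumes "square_integrable M f" "square_integrable M g"
  shows "(\<integral>x. (f x + g x)\<^sup>2 \<partial>M) = (\<integral>x. (f x)\<^sup>2 \<partial>M) + 2 * (\<integral>x. f x * g x \<partial>M) + (\<integral>x. (g x)\<^sup>2 \<partial>M)"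
proof -
  have "(\<integral>x. (f x + g x)\<^sup>2 \<partial>M) = (\<integral>x. ((f x)\<^sup>2 + 2 * (f x * g x)) + (g x)\<^sup>2 \<partial>M)"
    by (rule Bochner_Integration.integral_cong) (auto simp: power2_eq_square algebra_simps)
  also have "\<dots> = (\<integral>x. (f x)\<^sup>2 \<partial>M) + 2 * (\<integral>x. f x * g x \<partial>M) + (\<integral>x. (g x)\<^sup>2 \<partial>M)"
    using assms integrable_mult_square_integrable[OF assms]
    by (subst Bochner_Integration.integral_add | simp add: square_integrable_def)+
  finally show ?thesis .
qed

lemma integral_diff_power2:
  assumes "square_integrable M f" "square_integrable M g"
  shows "(\<integral>x. (f x - g x)\<^sup>2 \<partial>M) = (\<integral>x. (f x)\<^sup>2 \<partial>M) - 2 * (\<integral>x. f x * g x \<partial>M) + (\<integral>x. (g x)\<^sup>2 \<partial>M)"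
  using integral_add_power2[OF assms(1) square_integrable_minus[OF assms(2)]] by simp

lemma integral_Cauchy_Schwarz:
  assumes f: "square_integrable M f" and g: "square_integrable M g"
  shows "(\<integral>x. f x * g x \<partial>M)\<^sup>2 \<le> (\<integral>x. (f x)\<^sup>2 \<partial>M) * (\<integral>x. (g x)\<^sup>2 \<partial>M)"
proof -
  let ?A = "\<integral>x. (f x)\<^sup>2 \<partial>M" and ?B = "\<integral>x. (g x)\<^sup>2 \<partial>M" and ?C = "\<integral>x. f x * g x \<partial>M"
  have q: "0 \<le> ?A + 2 * t * ?C + t\<^sup>2 * ?B" for t
  proof -
    have "(\<integral>x. (f x + t * g x)\<^sup>2 \<partial>M) = ?A + 2 * (\<integral>x. t * (f x * g x) \<partial>M) + (\<integral>x. t\<^sup>2 * (g x)\<^sup>2 \<partial>M)"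
      using integral_add_power2[OF f square_integrable_mult_left[OF g, of t]]
      by (simp add: power_mult_distrib mult.left_commute)
    then have "(\<integral>x. (f x + t * g x)\<^sup>2 \<partial>M) = ?A + 2 * t * ?C + t\<^sup>2 * ?B"
      by simp
    moreover have "0 \<le> (\<integral>x. (f x + t * g x)\<^sup>2 \<partial>M)" by simp
    ultimately show ?thesis by simp
  qed
  have B: "0 \<le> ?B" by simp
  show ?thesis
  proof (cases "?B = 0")
    case True
    have "?C = 0"
    proof (rule ccontr)
      assume "?C \<noteq> 0"
      \<comment> \<open>For \<open>?B = 0\<close> the quadratic is affine in t, and at this t its
        value is -1.\<close>
      then show False using q[of "- (?A + 1) / (2 * ?C)"] True by (simp add: field_simps)
    qed
    then show ?thesis by simp
  next
    case False
    then have "?B > 0" using B by linarith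
    then show ?thesis using q[of "- ?C / ?B"] by (simp add: field_simps power2_eq_square)
  qed
qed

section \<open>Tensor products, rotations of pairs, and curves in L^2\<close>

lemma
  fixes u :: "'a::euclidean_space \<Rightarrow> real" and v :: "'b::euclidean_space \<Rightarrow> real"
  assumes u: "integrable lborel u" and v: "integrable lborel v"
  shows integrable_lborel_mult: "integrable lborel (\<lambda>z. u (fst z) * v (snd z))"
    and integral_lborel_mult: "(LBINT z. u (fst z) * v (snd z)) = integral\<^sup>L lborel u * integral\<^sup>L lborel v"
proof -
  have [measurable]: "u \<in> borel_measurable borel" "v \<in> borel_measurable borel" using u v by auto
  have int: "integrable (lborel \<Otimes>\<^sub>M lborel) (\<lambda>(x, y). u x * v y)"
  proof (rule lborel_pair.Fubini_integrable)
    show "integrable lborel (\<lambda>x. LBINT y. norm (case (x, y) of (x, y) \<Rightarrow> u x * v y))"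
      using u by (simp add: abs_mult)
  qed (use u v in simp_all)
  then show "integrable lborel (\<lambda>z. u (fst z) * v (snd z))" by (simp add: lborel_prod case_prod_unfold)
  show "(LBINT z. u (fst z) * v (snd z)) = integral\<^sup>L lborel u * integral\<^sup>L lborel v"
    using lborel_pair.integral_fst'[OF int] u v by (simp add: lborel_prod case_prod_unfold)
qed

text \<open>For c^2 + s^2 = 1 this turns all coordinate planes (x_i, y_i) by one angle and leaves
  gauss(x) gauss(y) invariant. Cosine and sine are separate arguments so that compositions and the
  factorisation into shears are pure algebra.\<close>

definition rot :: "real \<Rightarrow> real \<Rightarrow> 'a::real_vector \<times> 'a \<Rightarrow> 'a \<times> 'a" where
  "rot c s z = (c *\<^sub>R fst z + s *\<^sub>R snd z, c *\<^sub>R snd z - s *\<^sub>R fst z)"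

lemma continuous_on_rot [continuous_intros]:
  fixes h :: "'b::topological_space \<Rightarrow> 'a::real_normed_vector \<times> 'a"
  assumes "continuous_on S f" "continuous_on S g" "continuous_on S h"
  shows "continuous_on S (\<lambda>x. rot (f x) (g x) (h x))"
  unfolding rot_def using assms by (intro continuous_intros)

lemma rot_compose: "rot c s (rot c' s' z) = rot (c * c' - s * s') (s * c' + c * s') z"
  by (simp add: rot_def algebra_simps)

lemma measurable_rot [measurable]: "rot c s \<in> borel_measurable (borel :: ('a::euclidean_space \<times> 'a) measure)"
  by (intro borel_measurable_continuous_onI continuous_intros)

lemma measurable_swap: "prod.swap \<in> borel_measurable (borel :: ('a::euclidean_space \<times> 'a) measure)"
  unfolding prod.swap_def by (intro borel_measurable_continuous_onI continuous_intros)

lemma distr_swap: "distr lborel borel prod.swap = (lborel :: ('a::euclidean_space \<times> 'a) measure)"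
proof -
  have "(lborel :: ('a \<times> 'a) measure) = lborel \<Otimes>\<^sub>M lborel" by (simp add: lborel_prod)
  also have "\<dots> = distr (lborel \<Otimes>\<^sub>M lborel) (lborel \<Otimes>\<^sub>M lborel) (\<lambda>(x, y). (y, x))"
    by (rule lborel_pair.distr_pair_swap)
  also have "\<dots> = distr lborel borel prod.swap"
    unfolding lborel_prod prod.swap_def by (rule distr_cong) (auto simp: case_prod_beta)
  finally show ?thesis by simp
qed

text \<open>For a fixed second component the shear translates the first, so Tonelli reduces the
  claim to translation invariance.\<close>

lemma distr_shear:
  "distr lborel borel (\<lambda>z. (fst z + t *\<^sub>R snd z, snd z)) = (lborel :: ('a::euclidean_space \<times> 'a) measure)"
    (is "distr lborel borel ?T = _")
proof (rule measure_eqI)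
  show "sets (distr lborel borel ?T) = sets (lborel :: ('a \<times> 'a) measure)" by simp
  fix A assume "A \<in> sets (distr lborel borel ?T)"
  then have A [measurable]: "A \<in> sets (borel :: ('a \<times> 'a) measure)" by simp
  have T [measurable]: "?T \<in> borel_measurable borel"
    by (intro borel_measurable_continuous_onI continuous_intros)
  have inner: "(\<integral>\<^sup>+x. indicator A (x + v, y) \<partial>lborel) = (\<integral>\<^sup>+x. indicator A (x, y) \<partial>lborel)" for v y :: 'a
  proof -
    have m [measurable]: "(\<lambda>x. indicator A (x, y) :: ennreal) \<in> borel_measurable borel"
    proof -
      have "(\<lambda>x. (x, y)) \<in> borel_measurable borel"
        by (intro borel_measurable_continuous_onI continuous_intros)
      from measurable_compose[OF this borel_measurable_indicator[OF A]] show ?thesis .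
    qed
    have "(\<integral>\<^sup>+x. indicator A (x, y) \<partial>lborel) = (\<integral>\<^sup>+x. indicator A (x, y) \<partial>distr lborel borel ((+) v))"
      by (simp add: lborel_distr_plus)
    also have "\<dots> = (\<integral>\<^sup>+x. indicator A (v + x, y) \<partial>lborel)"
      by (subst nn_integral_distr) auto
    finally show ?thesis by (simp add: add.commute)
  qed
  have m1: "(\<lambda>z. indicator A (?T z) :: ennreal) \<in> borel_measurable (lborel \<Otimes>\<^sub>M lborel)"
    using measurable_compose[OF T borel_measurable_indicator[OF A]] by (simp add: lborel_prod)
  have m2: "(indicator A :: _ \<Rightarrow> ennreal) \<in> borel_measurable (lborel \<Otimes>\<^sub>M lborel)"
    using A by (simp add: lborel_prod)
  have "emeasure (distr lborel borel ?T) A = (\<integral>\<^sup>+z. indicator A z \<partial>distr lborel borel ?T)"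
    by simp
  also have "\<dots> = (\<integral>\<^sup>+z. indicator A (?T z) \<partial>lborel)"
    by (subst nn_integral_distr) auto
  also have "\<dots> = (\<integral>\<^sup>+z. indicator A (?T z) \<partial>(lborel \<Otimes>\<^sub>M lborel))"
    by (simp add: lborel_prod)
  also have "\<dots> = (\<integral>\<^sup>+y. (\<integral>\<^sup>+x. indicator A (?T (x, y)) \<partial>lborel) \<partial>lborel)"
    using lborel_pair.nn_integral_snd[OF m1] by simp
  also have "\<dots> = (\<integral>\<^sup>+y. (\<integral>\<^sup>+x. indicator A (x, y) \<partial>lborel) \<partial>lborel)"
    by (simp add: inner)
  also have "\<dots> = (\<integral>\<^sup>+z. indicator A z \<partial>(lborel \<Otimes>\<^sub>M lborel))"
    using lborel_pair.nn_integral_snd[OF m2] by simp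
  also have "\<dots> = emeasure lborel A" by (simp add: lborel_prod)
  finally show "emeasure (distr lborel borel ?T) A = emeasure lborel A" .
qed

lemma distr_compose_lborel:
  assumes "distr lborel borel f = (lborel :: 'b::euclidean_space measure)" "distr lborel borel g = (lborel :: 'b measure)"
    and "f \<in> borel_measurable borel" "g \<in> borel_measurable borel"
  shows "distr lborel borel (f \<circ> g) = (lborel :: 'b measure)"
proof -
  have "distr lborel borel (f \<circ> g) = distr (distr lborel borel g) borel f"
    using assms by (subst distr_distr) auto
  then show ?thesis using assms by simp
qed

text \<open>A plane rotation other than by \<open>\<pi>\<close> is a product of three shears.\<close>

lemma distr_rot_aux:
  assumes cs: "c\<^sup>2 + s\<^sup>2 = 1" and c: "c \<noteq> -1"
  shows "distr lborel borel (rot c s) = (lborel :: ('a::euclidean_space \<times> 'a) measure)"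
proof -
  \<comment> \<open>The tangent of half the angle: the shears t, -s, t compose to the rotation. The
    middle one acts on the other component, hence the swaps around it.\<close>
  define t where "t = s / (1 + c)"
  define T where "T r z = (fst z + r *\<^sub>R snd z, snd z)" for r and z :: "'a \<times> 'a"
  have [measurable]: "T r \<in> borel_measurable borel" for r
    unfolding T_def by (intro borel_measurable_continuous_onI continuous_intros)
  note [measurable] = measurable_swap
  have dT: "distr lborel borel (T r) = lborel" for r
    unfolding T_def by (rule distr_shear)
  have c1: "1 + c \<noteq> 0" using c by linarith
  have t1: "1 - t * s = c"
  proof -
    have "s * s = (1 - c) * (1 + c)" using cs by (simp add: power2_eq_square algebra_simps)
    then show ?thesis using c1 by (simp add: t_def field_simps)
  qed
  have "t * (1 + c) = s" using c1 by (simp add: t_def)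
  then have t2: "t * c + t = s" by (simp add: algebra_simps)
  have eq: "rot c s = T t \<circ> prod.swap \<circ> T (- s) \<circ> prod.swap \<circ> T t"
  proof
    fix z :: "'a \<times> 'a"
    obtain x y where z: "z = (x, y)" by force
    have "(T t \<circ> prod.swap \<circ> T (- s) \<circ> prod.swap \<circ> T t) z
        = ((1 - t * s) *\<^sub>R x + (t + t * (1 - s * t)) *\<^sub>R y, (1 - s * t) *\<^sub>R y - s *\<^sub>R x)"
      by (simp add: z T_def algebra_simps flip: scaleR_2)
    also have "\<dots> = rot c s z"
      using t1 t2 by (simp add: rot_def z mult.commute[of s t] add.commute)
    finally show "rot c s z = (T t \<circ> prod.swap \<circ> T (- s) \<circ> prod.swap \<circ> T t) z" by simp
  qed
  show ?thesis unfolding eq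
    by (intro distr_compose_lborel dT distr_swap measurable_comp[where N=borel]) simp_all
qed

text \<open>The half turn, where the tangent of half the angle is infinite, is made of two quarter
  turns.\<close>

lemma distr_rot:
  assumes cs: "c\<^sup>2 + s\<^sup>2 = 1"
  shows "distr lborel borel (rot c s) = (lborel :: ('a::euclidean_space \<times> 'a) measure)"
proof (cases "c = -1")
  case True
  then have "s = 0" using cs by simp
  then have "rot c s = rot 0 1 \<circ> (rot 0 1 :: 'a \<times> 'a \<Rightarrow> 'a \<times> 'a)"
    using True by (auto simp: rot_compose)
  then show ?thesis
    using distr_rot_aux[of 0 1] by (auto intro!: distr_compose_lborel)
qed (rule distr_rot_aux[OF cs])

lemma measure_preserving_integral:
  fixes F :: "'b::euclidean_space \<Rightarrow> real"
  assumes T: "distr lborel borel T = lborel" "T \<in> borel_measurable borel" and F: "F \<in> borel_measurable borel"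
  shows "(LBINT z. F (T z)) = (LBINT z. F z)"
    and "integrable lborel (\<lambda>z. F (T z)) \<longleftrightarrow> integrable lborel F"
proof -
  have "(\<integral>z. F z \<partial>distr lborel borel T) = (LBINT z. F (T z))"
    using T F by (intro integral_distr) auto
  then show "(LBINT z. F (T z)) = (LBINT z. F z)" using T by simp
  have "integrable (distr lborel borel T) F \<longleftrightarrow> integrable lborel (\<lambda>z. F (T z))"
    using T F by (intro integrable_distr_eq) auto
  then show "integrable lborel (\<lambda>z. F (T z)) \<longleftrightarrow> integrable lborel F" using T by simp
qed

text \<open>A chord in L^2 is no longer than the curve: Cauchy-Schwarz in time bounds the squared
  increment at each point by h times the time integral of the squared velocity, and Tonelli turns
  the integral of this over space into at most h * (h * K).\<close>

lemma integral_path_increment_le: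
  fixes G D :: "real \<Rightarrow> 'b::euclidean_space \<Rightarrow> real"
  assumes h: "h > 0"
    and deriv: "\<And>t z. ((\<lambda>t. G t z) has_real_derivative D t z) (at t)"
    and cont: "continuous_on UNIV (\<lambda>p. D (fst p) (snd p))"
    and G: "continuous_on UNIV (G h)" "continuous_on UNIV (G 0)"
    and int: "\<And>t. integrable lborel (\<lambda>z. (D t z)\<^sup>2)" and le: "\<And>t. (LBINT z. (D t z)\<^sup>2) \<le> K"
  shows "(LBINT z. (G h z - G 0 z)\<^sup>2) \<le> h\<^sup>2 * K"
proof -
  have contD: "continuous_on UNIV (\<lambda>t. D t z)" for z
    using continuous_on_compose2[OF cont, of UNIV "\<lambda>t. (t, z)"] by (simp add: continuous_on_Pair)
  have K: "K \<ge> 0" using le[of 0] by (rule order_trans[rotated]) simp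
  let ?I = "\<lambda>t. indicator {0..h} t :: real"
  have pt: "(G h z - G 0 z)\<^sup>2 \<le> h * (LBINT t. ?I t * (D t z)\<^sup>2)" for z
  proof -
    have "(LBINT t. ?I t *\<^sub>R D t z) = G h z - G 0 z"
      using h by (intro integral_FTC_atLeastAtMost)
       (auto intro!: continuous_on_subset[OF contD] has_field_derivative_at_within
          deriv simp flip: has_real_derivative_iff_has_vector_derivative)
    moreover have "(\<lambda>t. ?I t * (?I t * D t z)) = (\<lambda>t. ?I t *\<^sub>R D t z)"
      by (auto simp: indicator_def)
    ultimately have e: "(LBINT t. ?I t * (?I t * D t z)) = G h z - G 0 z"
      by (simp only:)
    have "set_integrable lborel {0..h} (\<lambda>t. (D t z)\<^sup>2)"
      by (rule borel_integrable_atLeastAtMost') (auto intro!: continuous_intros continuous_on_subset[OF contD])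
    moreover have "(\<lambda>t. (?I t * D t z)\<^sup>2) = (\<lambda>t. ?I t *\<^sub>R (D t z)\<^sup>2)"
      by (auto simp: indicator_def)
    ultimately have i: "integrable lborel (\<lambda>t. (?I t * D t z)\<^sup>2)"
      by (simp only: set_integrable_def)
    have "(\<lambda>t. D t z) \<in> borel_measurable borel"
      by (rule borel_measurable_continuous_onI[OF contD])
    then have "square_integrable lborel (\<lambda>t. ?I t * D t z)"
      using i by (simp add: square_integrable_def)
    moreover have "integrable lborel ?I"
      using h by (intro integrable_real_indicator) auto
    then have "square_integrable lborel ?I"
      by (auto simp: square_integrable_def power2_eq_square simp flip: indicator_inter_arith)
    ultimately have "(G h z - G 0 z)\<^sup>2 \<le> (LBINT t. (?I t)\<^sup>2) * (LBINT t. (?I t * D t z)\<^sup>2)"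
      using integral_Cauchy_Schwarz[of lborel ?I "\<lambda>t. ?I t * D t z"] e by simp
    moreover have "(?I t)\<^sup>2 = ?I t" "(?I t * D t z)\<^sup>2 = ?I t * (D t z)\<^sup>2" for t
      by (auto simp: indicator_def)
    ultimately show ?thesis using h by simp
  qed
  have m: "(\<lambda>(z, t). ennreal (?I t * (D t z)\<^sup>2)) \<in> borel_measurable (lborel \<Otimes>\<^sub>M lborel)"
  proof -
    have "continuous_on UNIV (\<lambda>p::'b \<times> real. (snd p, fst p))"
      by (intro continuous_intros)
    from continuous_on_compose2[OF cont this]
    have "continuous_on UNIV (\<lambda>p. (D (snd p) (fst p))\<^sup>2)"
      by (auto intro: continuous_intros)
    then have "(\<lambda>p. (D (snd p) (fst p))\<^sup>2) \<in> borel_measurable (lborel \<Otimes>\<^sub>M lborel)"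
      by (auto simp: lborel_prod intro: borel_measurable_continuous_onI)
    then show ?thesis by (simp add: case_prod_beta)
  qed
  have i2: "integrable lborel (\<lambda>t. ?I t * (D t z)\<^sup>2)" for z
  proof -
    have "set_integrable lborel {0..h} (\<lambda>t. (D t z)\<^sup>2)"
      by (rule borel_integrable_atLeastAtMost') (auto intro!: continuous_intros continuous_on_subset[OF contD])
    then show ?thesis by (simp add: set_integrable_def)
  qed
  \<comment> \<open>Nonnegative extended integrals are taken because the square integrability of the
    increment is itself a consequence of this estimate.\<close>
  have "(\<integral>\<^sup>+z. ennreal ((G h z - G 0 z)\<^sup>2) \<partial>lborel)
      \<le> (\<integral>\<^sup>+z. ennreal h * (\<integral>\<^sup>+t. ennreal (?I t * (D t z)\<^sup>2) \<partial>lborel) \<partial>lborel)"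
  proof (intro nn_integral_mono)
    fix z
    have "ennreal ((G h z - G 0 z)\<^sup>2) \<le> ennreal (h * (LBINT t. ?I t * (D t z)\<^sup>2))"
      by (intro ennreal_leI pt)
    also have "\<dots> = ennreal h * (\<integral>\<^sup>+t. ennreal (?I t * (D t z)\<^sup>2) \<partial>lborel)"
      using h by (subst nn_integral_eq_integral[OF i2]) (auto simp: ennreal_mult)
    finally show "ennreal ((G h z - G 0 z)\<^sup>2) \<le> ennreal h * (\<integral>\<^sup>+t. ennreal (?I t * (D t z)\<^sup>2) \<partial>lborel)" .
  qed
  also have "\<dots> = ennreal h * (\<integral>\<^sup>+z. (\<integral>\<^sup>+t. ennreal (?I t * (D t z)\<^sup>2) \<partial>lborel) \<partial>lborel)"
    using lborel.borel_measurable_nn_integral[OF m] by (intro nn_integral_cmult) simp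
  also have "(\<integral>\<^sup>+z. (\<integral>\<^sup>+t. ennreal (?I t * (D t z)\<^sup>2) \<partial>lborel) \<partial>lborel)
      = (\<integral>\<^sup>+t. (\<integral>\<^sup>+z. ennreal (?I t * (D t z)\<^sup>2) \<partial>lborel) \<partial>lborel)"
    using lborel_pair.Fubini'[OF m] by simp
  also have "\<dots> \<le> (\<integral>\<^sup>+t. ennreal K * indicator {0..h} t \<partial>lborel)"
  proof (intro nn_integral_mono)
    fix t
    have "(\<integral>\<^sup>+z. ennreal (?I t * (D t z)\<^sup>2) \<partial>lborel) = ennreal (?I t * (LBINT z. (D t z)\<^sup>2))"
      using int[of t] by (subst nn_integral_eq_integral) auto
    also have "\<dots> \<le> ennreal K * indicator {0..h} t"
      using le[of t] by (auto simp: indicator_def intro: ennreal_leI)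
    finally show "(\<integral>\<^sup>+z. ennreal (?I t * (D t z)\<^sup>2) \<partial>lborel) \<le> ennreal K * indicator {0..h} t" .
  qed
  also have "\<dots> = ennreal (K * h)"
    using h K by (simp add: nn_integral_cmult ennreal_mult)
  finally have "(\<integral>\<^sup>+z. ennreal ((G h z - G 0 z)\<^sup>2) \<partial>lborel) \<le> ennreal h * ennreal (K * h)"
    by this (rule mult_left_mono, auto)
  also have "\<dots> = ennreal (h\<^sup>2 * K)"
    using h K by (simp add: power2_eq_square mult_ac flip: ennreal_mult)
  finally have le: "(\<integral>\<^sup>+z. ennreal ((G h z - G 0 z)\<^sup>2) \<partial>lborel) \<le> ennreal (h\<^sup>2 * K)" .
  have "(\<lambda>z. (G h z - G 0 z)\<^sup>2) \<in> borel_measurable lborel"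
    using G by (auto intro!: borel_measurable_continuous_onI continuous_intros)
  then have "integrable lborel (\<lambda>z. (G h z - G 0 z)\<^sup>2)"
    using le by (intro integrableI_nonneg) (auto intro: le_less_trans)
  then show ?thesis
    using le h K by (simp add: nn_integral_eq_integral)
qed

section \<open>The spectral gap of the harmonic oscillator\<close>

lemma square_integrable_tensor:
  fixes u v :: "'a::euclidean_space \<Rightarrow> real"
  assumes "square_integrable lborel u" "square_integrable lborel v"
  shows "square_integrable lborel (\<lambda>z. u (fst z) * v (snd z))"
proof -
  have [measurable]: "u \<in> borel_measurable borel" "v \<in> borel_measurable borel"
    using assms by (auto simp: square_integrable_def)
  have "(\<lambda>z. u (fst z) * v (snd z)) \<in> borel_measurable (borel \<Otimes>\<^sub>M borel)" by measurable
  then show ?thesis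
    using integrable_lborel_mult[OF assms[THEN square_integrable_integrable]]
    by (simp add: square_integrable_def power_mult_distrib borel_prod)
qed

lemma integral_tensor_mult:
  fixes u v u' v' :: "'a::euclidean_space \<Rightarrow> real"
  assumes "square_integrable lborel u" "square_integrable lborel v"
    "square_integrable lborel u'" "square_integrable lborel v'"
  shows "(LBINT z. (u (fst z) * v (snd z)) * (u' (fst z) * v' (snd z)))
    = (LBINT x. u x * u' x) * (LBINT x. v x * v' x)"
proof -
  have "integrable lborel (\<lambda>x. u x * u' x)" "integrable lborel (\<lambda>x. v x * v' x)"
    using assms by (auto intro: integrable_mult_square_integrable)
  from integral_lborel_mult[OF this] show ?thesis
    by (simp add: mult_ac)
qed

lemma square_integrable_gauss:
  fixes u :: "'a::euclidean_space"
  assumes "b > 0"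
  shows "square_integrable lborel (gauss b :: 'a \<Rightarrow> real)"
    and "square_integrable lborel (\<lambda>x. (x \<bullet> u) * gauss b x)"
  using integrable_gauss_moments(1)[OF assms, where 'a='a] integrable_gauss_moments(3)[OF assms, of u u]
  by (auto simp: square_integrable_def power_mult_distrib power2_eq_square mult_ac
      intro!: borel_measurable_continuous_onI continuous_intros)

lemma gauss_has_derivative:
  "(gauss b has_derivative (\<lambda>v. - b * (x \<bullet> v) * gauss b x)) (at x)"
  unfolding gauss_def power2_norm_eq_inner
  by (auto intro!: derivative_eq_intros simp: inner_commute)

text \<open>The hypothesis encodes \<open>a\<close> = grad f + b f x, the vector of all (d_k + b
  x_k) f. Along the rotation X' = Y and Y' = -X, so differentiating the Gaussian factor contributes
  b f (X . Y), which completes Y . grad f to Y . a. Exchanging the two slots reverses the sense of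
  rotation, hence the sign in the second claim.\<close>

lemma rot_tensor_has_real_derivative:
  fixes f :: "'a::euclidean_space \<Rightarrow> real" and a :: "'a \<Rightarrow> 'a"
  assumes f: "\<And>x. (f has_derivative (\<lambda>v. v \<bullet> (a x - (b * f x) *\<^sub>R x))) (at x)"
  defines "T \<equiv> \<lambda>z. f (fst z) * gauss b (snd z)"
    and "r \<equiv> \<lambda>z. (snd z \<bullet> a (fst z)) * gauss b (snd z)"
  shows "((\<lambda>t. T (rot (cos t) (sin t) z)) has_real_derivative r (rot (cos t) (sin t) z)) (at t)"
    and "((\<lambda>t. T (prod.swap (rot (cos t) (sin t) z))) has_real_derivative
      - r (prod.swap (rot (cos t) (sin t) z))) (at t)"
proof -
  define X where "X t = fst (rot (cos t) (sin t) z)" for t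
  define Y where "Y t = snd (rot (cos t) (sin t) z)" for t
  have dX: "(X has_vector_derivative Y t) (at t)"
    unfolding X_def Y_def rot_def by (auto intro!: derivative_eq_intros simp: algebra_simps)
  have dY: "(Y has_vector_derivative - X t) (at t)"
    unfolding X_def Y_def rot_def by (auto intro!: derivative_eq_intros simp: algebra_simps)
  have chain: "((\<lambda>t. g (Z t)) has_real_derivative g' Z') (at t)"
    if "(Z has_vector_derivative Z') (at t)" "(g has_derivative g') (at (Z t))" for Z Z' and g :: "'a \<Rightarrow> real" and g'
    using vector_derivative_diff_chain_within[OF that(1) has_derivative_at_withinI[OF that(2)]]
    by (simp add: has_real_derivative_iff_has_vector_derivative o_def)
  note d = chain[OF dX f] chain[OF dY f] chain[OF dX gauss_has_derivative] chain[OF dY gauss_has_derivative]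
  have "((\<lambda>t. f (X t) * gauss b (Y t)) has_real_derivative (Y t \<bullet> a (X t)) * gauss b (Y t)) (at t)"
    by (rule derivative_eq_intros d refl)+ (simp add: algebra_simps inner_commute)
  then show "((\<lambda>t. T (rot (cos t) (sin t) z)) has_real_derivative r (rot (cos t) (sin t) z)) (at t)"
    by (simp add: T_def r_def X_def Y_def)
  have "((\<lambda>t. f (Y t) * gauss b (X t)) has_real_derivative - ((X t \<bullet> a (Y t)) * gauss b (X t))) (at t)"
    by (rule derivative_eq_intros d refl)+ (simp add: algebra_simps inner_commute)
  then show "((\<lambda>t. T (prod.swap (rot (cos t) (sin t) z))) has_real_derivative
      - r (prod.swap (rot (cos t) (sin t) z))) (at t)"
    by (simp add: T_def r_def X_def Y_def prod.swap_def)
qed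

text \<open>In coordinates \<open>r\<close> is a sum of tensor products of a_i with y_i gauss. The
  second factors are orthogonal with squared norm Z / (2 b), so all mixed terms drop out; this is
  why the squared speed of the rotation curve is the energy of f up to a constant. The third claim
  supplies the moment term of the odd case.\<close>

lemma
  fixes a :: "'a::euclidean_space \<Rightarrow> 'a" and f :: "'a \<Rightarrow> real"
  assumes b: "b > 0" and a: "\<And>i. i \<in> Basis \<Longrightarrow> square_integrable lborel (\<lambda>x. a x \<bullet> i)"
    and f: "square_integrable lborel f"
  defines "r \<equiv> \<lambda>z. (snd z \<bullet> a (fst z)) * gauss b (snd z)"
  shows square_integrable_inner_gauss: "square_integrable lborel r"
    and integral_inner_gauss_power2:
      "(LBINT z. (r z)\<^sup>2) = gauss_mass TYPE('a) b / (2 * b) * (LBINT x. (norm (a x))\<^sup>2)"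
    and integral_inner_gauss_tensor:
      "(LBINT z. r z * (gauss b (fst z) * f (snd z)))
        = (\<Sum>i\<in>Basis. (LBINT x. (a x \<bullet> i) * gauss b x) * (LBINT x. (x \<bullet> i) * gauss b x * f x))"
proof -
  define t where "t i z = (a (fst z) \<bullet> i) * ((snd z \<bullet> i) * gauss b (snd z))" for i and z :: "'a \<times> 'a"
  have r: "r = (\<lambda>z. \<Sum>i\<in>Basis. t i z)"
    unfolding r_def t_def by (subst euclidean_inner) (simp add: sum_distrib_left sum_distrib_right mult_ac)
  have t: "square_integrable lborel (t i)" if "i \<in> Basis" for i
    unfolding t_def by (intro square_integrable_tensor a that square_integrable_gauss(2) b)
  show "square_integrable lborel r"
    unfolding r by (intro square_integrable_sum t)
  have tt: "(LBINT z. t i z * t j z)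
      = (if i = j then gauss_mass TYPE('a) b / (2 * b) * (LBINT x. (a x \<bullet> i)\<^sup>2) else 0)"
    if "i \<in> Basis" "j \<in> Basis" for i j
  proof -
    have "(LBINT z. t i z * t j z) = (LBINT x. (a x \<bullet> i) * (a x \<bullet> j))
        * (LBINT x. ((x \<bullet> i) * gauss b x) * ((x \<bullet> j) * gauss b x))"
      unfolding t_def by (intro integral_tensor_mult a that square_integrable_gauss(2) b)
    also have "(LBINT x. ((x \<bullet> i) * gauss b x) * ((x \<bullet> j) * gauss b x))
        = (LBINT x. (x \<bullet> i) * (x \<bullet> j) * (gauss b x)\<^sup>2)"
      by (simp add: power2_eq_square mult_ac)
    also have "\<dots> = (i \<bullet> j) / (2 * b) * gauss_mass TYPE('a) b"
      by (rule gauss_second_moment[OF b])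
    finally show ?thesis
      using that by (simp add: inner_Basis power2_eq_square)
  qed
  have "(LBINT z. (r z)\<^sup>2) = (\<integral>z. (\<Sum>i\<in>Basis. \<Sum>j\<in>Basis. t i z * t j z) \<partial>lborel)"
    by (simp add: r power2_eq_square sum_product)
  also have "\<dots> = (\<Sum>i\<in>Basis. \<integral>z. (\<Sum>j\<in>Basis. t i z * t j z) \<partial>lborel)"
    by (intro Bochner_Integration.integral_sum Bochner_Integration.integrable_sum
        integrable_mult_square_integrable t)
  also have "\<dots> = (\<Sum>i\<in>Basis. \<Sum>j\<in>Basis. LBINT z. t i z * t j z)"
    by (intro sum.cong refl Bochner_Integration.integral_sum integrable_mult_square_integrable t)
  also have "\<dots> = (\<Sum>i\<in>Basis. gauss_mass TYPE('a) b / (2 * b) * (LBINT x. (a x \<bullet> i)\<^sup>2))"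
    by (simp add: tt cong: sum.cong)
  also have "\<dots> = gauss_mass TYPE('a) b / (2 * b) * (\<integral>x. (\<Sum>i\<in>Basis. (a x \<bullet> i)\<^sup>2) \<partial>lborel)"
    using a by (subst Bochner_Integration.integral_sum) (auto simp: square_integrable_def sum_distrib_left)
  also have "(\<lambda>x. \<Sum>i\<in>Basis. (a x \<bullet> i)\<^sup>2) = (\<lambda>x. (norm (a x))\<^sup>2)"
    unfolding power2_norm_eq_inner by (subst (2) euclidean_inner) (simp add: power2_eq_square)
  finally show "(LBINT z. (r z)\<^sup>2) = gauss_mass TYPE('a) b / (2 * b) * (LBINT x. (norm (a x))\<^sup>2)" .
  have gf: "square_integrable lborel (\<lambda>z :: 'a \<times> 'a. gauss b (fst z) * f (snd z))"
    by (rule square_integrable_tensor[OF square_integrable_gauss(1)[OF b] f])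
  have "(LBINT z. r z * (gauss b (fst z) * f (snd z)))
      = (\<integral>z. (\<Sum>i\<in>Basis. t i z * (gauss b (fst z) * f (snd z))) \<partial>lborel)"
    by (simp add: r sum_distrib_right)
  also have "\<dots> = (\<Sum>i\<in>Basis. LBINT z. t i z * (gauss b (fst z) * f (snd z)))"
    by (intro Bochner_Integration.integral_sum integrable_mult_square_integrable t gf)
  also have "\<dots> = (\<Sum>i\<in>Basis. (LBINT x. (a x \<bullet> i) * gauss b x) * (LBINT x. (x \<bullet> i) * gauss b x * f x))"
    unfolding t_def by (intro sum.cong refl integral_tensor_mult a square_integrable_gauss f b)
  finally show "(LBINT z. r z * (gauss b (fst z) * f (snd z)))
        = (\<Sum>i\<in>Basis. (LBINT x. (a x \<bullet> i) * gauss b x) * (LBINT x. (x \<bullet> i) * gauss b x * f x))" .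
qed

text \<open>Machin's formula gives pi / 4 <= 4 arctan (1 / 5) <= 4 / 5. The trivial bound pi / 4 <=
  1 would produce a gap of only 2b in the even case.\<close>

lemma pi_quarter_power2_le: "(pi / 4)\<^sup>2 \<le> 16 / 25"
proof -
  have "arctan (1 / 5) \<le> 1 / 5" by (rule arctan_le_self) simp
  moreover have "0 \<le> arctan (1 / 239)" by simp
  ultimately have "pi / 4 \<le> 4 / 5" using machin by linarith
  then have "(pi / 4)\<^sup>2 \<le> (4 / 5)\<^sup>2" by (intro power_mono) auto
  then show ?thesis by (simp add: power2_eq_square)
qed

lemma square_integrable_measure_preserving:
  fixes F :: "'b::euclidean_space \<Rightarrow> real"
  assumes "distr lborel borel T = lborel" "T \<in> borel_measurable borel" "square_integrable lborel F"
  shows "square_integrable lborel (\<lambda>z. F (T z))"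
proof -
  have F: "F \<in> borel_measurable borel" using assms(3) by (simp add: square_integrable_def)
  have "(\<lambda>z. F (T z)) \<in> borel_measurable borel" by (rule measurable_compose[OF assms(2) F])
  then show ?thesis
    using assms(3) F measure_preserving_integral(2)[OF assms(1,2), of "\<lambda>z. (F z)\<^sup>2"]
    by (simp add: square_integrable_def)
qed

text \<open>The curve runs through the rotations of a function that the quarter turn maps to its negative,
  so its points at parameter distance \<open>\<pi>/4\<close> are orthogonal.\<close>

lemma spectral_gap_even:
  fixes f :: "'a::euclidean_space \<Rightarrow> real" and a :: "'a \<Rightarrow> 'a"
  assumes b: "b > 0"
    and deriv: "\<And>x. (f has_derivative (\<lambda>v. v \<bullet> (a x - (b * f x) *\<^sub>R x))) (at x)"
    and cont: "continuous_on UNIV a"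
    and f: "square_integrable lborel f" and a: "\<And>i. i \<in> Basis \<Longrightarrow> square_integrable lborel (\<lambda>x. a x \<bullet> i)"
    and even: "\<And>x. f (- x) = f x"
  shows "3 * b * ((LBINT x. (f x)\<^sup>2) - (LBINT x. f x * gauss b x)\<^sup>2 / gauss_mass TYPE('a) b)
    \<le> (LBINT x. (norm (a x))\<^sup>2)"
proof -
  define T where "T z = f (fst z) * gauss b (snd z)" for z :: "'a \<times> 'a"
  define r where "r z = (snd z \<bullet> a (fst z)) * gauss b (snd z)" for z :: "'a \<times> 'a"
  \<comment> \<open>Antisymmetrising removes the Gaussian component: the squared norm of
    \<open>g\<close> is 2 Z times the squared distance of f from the line of the Gaussian.\<close>
  define g where "g z = T z - T (prod.swap z)" for z
  define D where "D z = r z + r (prod.swap z)" for z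
  define Z where "Z = gauss_mass TYPE('a) b"
  have Z: "Z > 0" unfolding Z_def by (rule gauss_mass_pos[OF b])
  define F where "F = (LBINT x. (f x)\<^sup>2)"
  define m where "m = (LBINT x. f x * gauss b x)"
  define S where "S = (LBINT x. (norm (a x))\<^sup>2)"
  have contf: "continuous_on UNIV f"
    using deriv by (intro differentiable_imp_continuous_on) (auto simp: differentiable_on_def differentiable_def)
  have comp: "continuous_on S (\<lambda>x. f (h x))" "continuous_on S (\<lambda>x. a (h x))" if "continuous_on S h"
    for S and h :: "'b::topological_space \<Rightarrow> 'a"
    using continuous_on_compose2[OF contf that] continuous_on_compose2[OF cont that] by auto
  note cont_intros = comp continuous_intros
  have e: "square_integrable lborel (gauss b :: 'a \<Rightarrow> real)" by (rule square_integrable_gauss[OF b])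
  have T: "square_integrable lborel T" unfolding T_def by (intro square_integrable_tensor f e)
  have r: "square_integrable lborel r" unfolding r_def by (rule square_integrable_inner_gauss[OF b a f])
  have sw: "square_integrable lborel (\<lambda>z. h (prod.swap z))" if "square_integrable lborel h" for h :: "'a \<times> 'a \<Rightarrow> real"
    by (rule square_integrable_measure_preserving[OF distr_swap measurable_swap that])
  have g: "square_integrable lborel g" unfolding g_def by (intro square_integrable_diff T sw)
  have D: "square_integrable lborel D" unfolding D_def by (intro square_integrable_add r sw)
  have swap_int: "(LBINT z. h (prod.swap z)) = (LBINT z. h z)"
    if "h \<in> borel_measurable borel" for h :: "'a \<times> 'a \<Rightarrow> real"
    by (rule measure_preserving_integral(1)[OF distr_swap measurable_swap that])
  have g2: "(LBINT z. (g z)\<^sup>2) = 2 * Z * F - 2 * m\<^sup>2"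
  proof -
    have "(LBINT z. (T (prod.swap z))\<^sup>2) = (LBINT z. (T z)\<^sup>2)"
      using T by (intro swap_int) (auto simp: square_integrable_def)
    moreover have "(LBINT z. (T z)\<^sup>2) = F * Z"
      using integral_tensor_mult[OF f e f e] by (simp add: T_def F_def Z_def power2_eq_square)
    moreover have "(LBINT z. T z * T (prod.swap z)) = m * m"
      using integral_tensor_mult[OF f e e f] by (simp add: T_def m_def mult_ac)
    ultimately show ?thesis
      using integral_diff_power2[OF T sw[OF T]] by (simp add: g_def power2_eq_square)
  qed
  have D2: "(LBINT z. (D z)\<^sup>2) \<le> 4 * (Z / (2 * b) * S)"
  proof -
    have sr: "(LBINT z. (r (prod.swap z))\<^sup>2) = (LBINT z. (r z)\<^sup>2)"
      using r by (intro swap_int) (auto simp: square_integrable_def)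
    \<comment> \<open>The cross term is estimated by the squares instead of being computed, at the
      cost of a factor of at most 2; the resulting gap is still 25/8 times b.\<close>
    have "(LBINT z. (D z)\<^sup>2) \<le> (LBINT z. 2 * (r z)\<^sup>2 + 2 * (r (prod.swap z))\<^sup>2)"
    proof (rule integral_mono)
      fix z
      show "(D z)\<^sup>2 \<le> 2 * (r z)\<^sup>2 + 2 * (r (prod.swap z))\<^sup>2"
        using sum_squares_bound[of "r z" "r (prod.swap z)"] by (simp add: D_def power2_sum)
    qed (use D r sw[OF r] in \<open>auto simp: square_integrable_def\<close>)
    also have "\<dots> = 4 * (LBINT z. (r z)\<^sup>2)"
      using r sw[OF r] sr by (subst Bochner_Integration.integral_add) (auto simp: square_integrable_def)
    also have "(LBINT z. (r z)\<^sup>2) = Z / (2 * b) * S"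
      unfolding r_def Z_def S_def by (rule integral_inner_gauss_power2[OF b a f])
    finally show ?thesis .
  qed
  define R where "R t = (rot (cos t) (sin t) :: 'a \<times> 'a \<Rightarrow> 'a \<times> 'a)" for t
  have Rpres: "distr lborel borel (R t) = lborel" "R t \<in> borel_measurable borel" for t
    by (simp_all add: R_def distr_rot)
  have "(LBINT z. (g (R (pi / 4) z) - g (R 0 z))\<^sup>2) \<le> (pi / 4)\<^sup>2 * (4 * (Z / (2 * b) * S))"
  proof (rule integral_path_increment_le[where D = "\<lambda>t z. D (R t z)"])
    show "((\<lambda>t. g (R t z)) has_real_derivative D (R t z)) (at t)" for t z
      unfolding g_def D_def R_def T_def r_def
      using DERIV_diff[OF rot_tensor_has_real_derivative[OF deriv, of z t]] by simp
    show "continuous_on UNIV (\<lambda>p. D (R (fst p) (snd p)))"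
      unfolding D_def r_def R_def prod.swap_def by (intro cont_intros)
    show "continuous_on UNIV (\<lambda>z. g (R (pi / 4) z))" "continuous_on UNIV (\<lambda>z. g (R 0 z))"
      unfolding g_def T_def R_def prod.swap_def by (intro cont_intros)+
    show "integrable lborel (\<lambda>z. (D (R t z))\<^sup>2)" for t
      using square_integrable_measure_preserving[OF Rpres D] by (simp add: square_integrable_def)
    show "(LBINT z. (D (R t z))\<^sup>2) \<le> 4 * (Z / (2 * b) * S)" for t
    proof -
      have "(LBINT z. (D (R t z))\<^sup>2) = (LBINT z. (D z)\<^sup>2)"
        using D by (intro measure_preserving_integral(1)[OF Rpres]) (auto simp: square_integrable_def)
      with D2 show ?thesis by simp
    qed
  qed simp
  moreover have "(LBINT z. (g (R (pi / 4) z) - g (R 0 z))\<^sup>2) = 2 * (LBINT z. (g z)\<^sup>2)"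
  proof -
    have R0: "R 0 z = z" for z by (simp add: R_def rot_def)
    have gR: "square_integrable lborel (\<lambda>z. g (R (pi / 4) z))"
      by (rule square_integrable_measure_preserving[OF Rpres g])
    have RR: "R (pi / 4) (R (pi / 4) z) = (snd z, - fst z)" for z
      by (simp add: R_def rot_compose cos_45 sin_45) (simp add: rot_def)
    have gRR: "g (R (pi / 4) (R (pi / 4) z)) = - g z" for z
      unfolding RR by (simp add: g_def T_def even)
    have m: "(\<lambda>z. g (R (pi / 4) z) * g z) \<in> borel_measurable borel"
      using gR g by (auto simp: square_integrable_def)
    \<comment> \<open>Write U for the turn by pi/4. Since U preserves inner products and U U g = -g,
      one has <U g, g> = <U U g, U g> = - <g, U g>.\<close>
    have "(LBINT z. g (R (pi / 4) z) * g z) = 0"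
      using measure_preserving_integral(1)[OF Rpres m, of "pi / 4"] by (simp add: gRR mult.commute)
    moreover have "(LBINT z. (g (R (pi / 4) z))\<^sup>2) = (LBINT z. (g z)\<^sup>2)"
      using g by (intro measure_preserving_integral(1)[OF Rpres]) (auto simp: square_integrable_def)
    ultimately show ?thesis
      using integral_diff_power2[OF gR g] by (simp add: R0)
  qed
  ultimately have "2 * (2 * Z * F - 2 * m\<^sup>2) \<le> (pi / 4)\<^sup>2 * (4 * (Z / (2 * b) * S))"
    by (simp add: g2)
  also have "\<dots> \<le> 16 / 25 * (4 * (Z / (2 * b) * S))"
    using Z b by (intro mult_right_mono pi_quarter_power2_le) (auto simp: S_def)
  finally have "25 * (2 * (2 * Z * F - 2 * m\<^sup>2)) * b \<le> 32 * Z * S" using b by (simp add: field_simps)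
  then have "25 / 8 * (b * (F - m\<^sup>2 / Z)) \<le> S"
    using Z by (simp add: field_simps)
  moreover have "m\<^sup>2 \<le> F * Z"
    using integral_Cauchy_Schwarz[OF f e] by (simp add: m_def F_def Z_def)
  then have "0 \<le> b * (F - m\<^sup>2 / Z)" using Z b by (simp add: field_simps)
  ultimately have "3 * (b * (F - m\<^sup>2 / Z)) \<le> S" by argo
  then show ?thesis by (simp add: F_def m_def Z_def S_def mult.assoc)
qed

text \<open>For odd \<open>f\<close> the quarter turn \<open>J\<close> satisfies \<open>J\<^sup>2 = -1\<close>, and the curve is
  \<open>exp (t J)\<close> applied to the rotated tensor product.\<close>

lemma spectral_gap_odd:
  fixes f :: "'a::euclidean_space \<Rightarrow> real" and a :: "'a \<Rightarrow> 'a"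
  assumes b: "b > 0"
    and deriv: "\<And>x. (f has_derivative (\<lambda>v. v \<bullet> (a x - (b * f x) *\<^sub>R x))) (at x)"
    and cont: "continuous_on UNIV a"
    and f: "square_integrable lborel f" and a: "\<And>i. i \<in> Basis \<Longrightarrow> square_integrable lborel (\<lambda>x. a x \<bullet> i)"
    and odd: "\<And>x. f (- x) = - f x" "\<And>x. a (- x) = a x"
  shows "3 * b * (LBINT x. (f x)\<^sup>2) - 4 * b / gauss_mass TYPE('a) b *
      (\<Sum>i\<in>Basis. (LBINT x. (a x \<bullet> i) * gauss b x) * (LBINT x. (x \<bullet> i) * gauss b x * f x))
    \<le> (LBINT x. (norm (a x))\<^sup>2)"
proof -
  define T where "T z = f (fst z) * gauss b (snd z)" for z :: "'a \<times> 'a"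
  define r where "r z = (snd z \<bullet> a (fst z)) * gauss b (snd z)" for z :: "'a \<times> 'a"
  \<comment> \<open>The velocity at time 0: \<open>r\<close> comes from the rotation, the other term
    from J.\<close>
  define p where "p z = r z + T (prod.swap z)" for z
  define R where "R t = (rot (cos t) (sin t) :: 'a \<times> 'a \<Rightarrow> 'a \<times> 'a)" for t
  \<comment> \<open>By parity a rotated odd tensor product becomes orthogonal to its start only
    after a quarter turn, too long a path for a gap above 2b. The factor exp (t J) shortens it to
    pi/4, at the price of the terms F Z and 2 M in the squared speed; M consists of the moments on
    the eigenspace of 2b.\<close>
  define G where "G t z = cos t * T (R t z) + sin t * T (prod.swap (R t z))" for t z
  define D where "D t z = cos t * p (R t z) - sin t * p (prod.swap (R t z))" for t z
  define Z where "Z = gauss_mass TYPE('a) b"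
  have Z: "Z > 0" unfolding Z_def by (rule gauss_mass_pos[OF b])
  define F where "F = (LBINT x. (f x)\<^sup>2)"
  define S where "S = (LBINT x. (norm (a x))\<^sup>2)"
  define M where "M = (\<Sum>i\<in>Basis. (LBINT x. (a x \<bullet> i) * gauss b x) * (LBINT x. (x \<bullet> i) * gauss b x * f x))"
  have contf: "continuous_on UNIV f"
    using deriv by (intro differentiable_imp_continuous_on) (auto simp: differentiable_on_def differentiable_def)
  have comp: "continuous_on S (\<lambda>x. f (h x))" "continuous_on S (\<lambda>x. a (h x))" if "continuous_on S h"
    for S and h :: "'b::topological_space \<Rightarrow> 'a"
    using continuous_on_compose2[OF contf that] continuous_on_compose2[OF cont that] by auto
  note cont_intros = comp continuous_intros
  have e: "square_integrable lborel (gauss b :: 'a \<Rightarrow> real)" by (rule square_integrable_gauss[OF b])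
  have T: "square_integrable lborel T" unfolding T_def by (intro square_integrable_tensor f e)
  have r: "square_integrable lborel r" unfolding r_def by (rule square_integrable_inner_gauss[OF b a f])
  have sw: "square_integrable lborel (\<lambda>z. h (prod.swap z))" if "square_integrable lborel h" for h :: "'a \<times> 'a \<Rightarrow> real"
    by (rule square_integrable_measure_preserving[OF distr_swap measurable_swap that])
  have p: "square_integrable lborel p" unfolding p_def by (intro square_integrable_add r sw T)
  have swap_int: "(LBINT z. h (prod.swap z)) = (LBINT z. h z)"
    if "h \<in> borel_measurable borel" for h :: "'a \<times> 'a \<Rightarrow> real"
    by (rule measure_preserving_integral(1)[OF distr_swap measurable_swap that])
  have Rpres: "distr lborel borel (R t) = lborel" "R t \<in> borel_measurable borel" for t
    by (simp_all add: R_def distr_rot)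
  have R_int: "(LBINT z. h (R t z)) = (LBINT z. h z)"
    if "h \<in> borel_measurable borel" for h :: "'a \<times> 'a \<Rightarrow> real" and t
    by (rule measure_preserving_integral(1)[OF Rpres that])
  have sR: "square_integrable lborel (\<lambda>z. h (R t z))" if "square_integrable lborel h" for h :: "'a \<times> 'a \<Rightarrow> real" and t
    by (rule square_integrable_measure_preserving[OF Rpres that])
  have meas: "h \<in> borel_measurable borel" if "square_integrable lborel h" for h :: "'a \<times> 'a \<Rightarrow> real"
    using that by (simp add: square_integrable_def)
  have quarter: "R (pi / 2) z = (snd z, - fst z)" for z by (simp add: R_def rot_def)
  have T2: "(LBINT z. (T z)\<^sup>2) = F * Z"
    using integral_tensor_mult[OF f e f e] by (simp add: T_def F_def Z_def power2_eq_square)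
  have sT2: "(LBINT z. (T (prod.swap z))\<^sup>2) = (LBINT z. (T z)\<^sup>2)"
    by (rule swap_int[of "\<lambda>z. (T z)\<^sup>2"]) (use meas[OF T] in simp)
  have sp2: "(LBINT z. (p (prod.swap z))\<^sup>2) = (LBINT z. (p z)\<^sup>2)"
    by (rule swap_int[of "\<lambda>z. (p z)\<^sup>2"]) (use meas[OF p] in simp)
  have p2: "(LBINT z. (p z)\<^sup>2) = Z / (2 * b) * S + 2 * M + F * Z"
  proof -
    have "(LBINT z. (r z)\<^sup>2) = Z / (2 * b) * S"
      unfolding r_def Z_def S_def by (rule integral_inner_gauss_power2[OF b a f])
    moreover have "(LBINT z. r z * T (prod.swap z)) = M"
      using integral_inner_gauss_tensor[OF b a f] by (simp add: r_def T_def M_def mult_ac)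
    ultimately show ?thesis
      using integral_add_power2[OF r sw[OF T]] by (simp add: p_def sT2 T2)
  qed
  have TT: "(LBINT z. T z * T (prod.swap z)) = 0"
  proof -
    have "(LBINT z. T z * T (prod.swap z)) = (LBINT z. T (R (pi / 2) z) * T (prod.swap (R (pi / 2) z)))"
      by (rule R_int[symmetric]) (use meas[OF T] meas[OF sw[OF T]] in simp)
    also have "\<dots> = (LBINT z. - (T z * T (prod.swap z)))"
      by (simp add: quarter T_def odd mult_ac)
    finally show ?thesis by simp
  qed
  \<comment> \<open>Being orthogonal and of equal norm, \<open>p\<close> and its swap give every
    \<open>D t\<close> the same norm: the curve has constant speed.\<close>
  have pp: "(LBINT z. p z * p (prod.swap z)) = 0"
  proof -
    have "(LBINT z. p z * p (prod.swap z)) = (LBINT z. p (R (pi / 2) z) * p (prod.swap (R (pi / 2) z)))"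
      by (rule R_int[symmetric]) (use meas[OF p] meas[OF sw[OF p]] in simp)
    also have "\<dots> = (LBINT z. - (p z * p (prod.swap z)))"
    proof (rule Bochner_Integration.integral_cong[OF refl])
      fix z
      have "p (R (pi / 2) z) = - p (prod.swap z)" "p (prod.swap (R (pi / 2) z)) = p z"
        by (simp_all add: quarter p_def r_def T_def odd)
      then show "p (R (pi / 2) z) * p (prod.swap (R (pi / 2) z)) = - (p z * p (prod.swap z))" by simp
    qed
    finally show ?thesis by simp
  qed
  have D: "square_integrable lborel (D t)" for t
    unfolding D_def using sR[OF p] sR[OF sw[OF p]]
    by (intro square_integrable_diff square_integrable_mult_left)
  have D2: "(LBINT z. (D t z)\<^sup>2) = (LBINT z. (p z)\<^sup>2)" for t
  proof -
    define q where "q z = cos t * p z - sin t * p (prod.swap z)" for z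
    have q: "square_integrable lborel q"
      unfolding q_def by (intro square_integrable_diff square_integrable_mult_left p sw)
    have "(LBINT z. (D t z)\<^sup>2) = (LBINT z. (q z)\<^sup>2)"
      unfolding D_def q_def by (rule R_int) (use meas[OF p] meas[OF sw[OF p]] in simp)
    also have "\<dots> = (cos t)\<^sup>2 * (LBINT z. (p z)\<^sup>2) + (sin t)\<^sup>2 * (LBINT z. (p z)\<^sup>2)
        - 2 * (LBINT z. cos t * sin t * (p z * p (prod.swap z)))"
      unfolding q_def
      using integral_diff_power2[OF square_integrable_mult_left[OF p] square_integrable_mult_left[OF sw[OF p]], of "cos t" "sin t"]
      by (simp add: power_mult_distrib sp2 mult_ac)
    also have "\<dots> = ((cos t)\<^sup>2 + (sin t)\<^sup>2) * (LBINT z. (p z)\<^sup>2)"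
      unfolding Bochner_Integration.integral_mult_right_zero pp by (simp flip: distrib_right)
    finally show ?thesis by simp
  qed
  have "(LBINT z. (G (pi / 4) z - G 0 z)\<^sup>2) \<le> (pi / 4)\<^sup>2 * (LBINT z. (p z)\<^sup>2)"
  proof (rule integral_path_increment_le[where D = D])
    show "((\<lambda>t. G t z) has_real_derivative D t z) (at t)" for t z
      unfolding G_def R_def
      by (rule derivative_eq_intros rot_tensor_has_real_derivative[OF deriv, folded T_def] refl)+
        (simp add: D_def p_def R_def r_def T_def algebra_simps)
    show "continuous_on UNIV (\<lambda>q. D (fst q) (snd q))"
      unfolding D_def p_def r_def T_def R_def prod.swap_def by (intro cont_intros)
    show "continuous_on UNIV (G (pi / 4))" "continuous_on UNIV (G 0)"
      unfolding G_def T_def R_def prod.swap_def by (intro cont_intros)+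
    show "integrable lborel (\<lambda>z. (D t z)\<^sup>2)" for t
      using D by (simp add: square_integrable_def)
    show "(LBINT z. (D t z)\<^sup>2) \<le> (LBINT z. (p z)\<^sup>2)" for t
      by (simp add: D2)
  qed simp
  moreover have "(LBINT z. (G (pi / 4) z - G 0 z)\<^sup>2) = 2 * (F * Z)"
  proof -
    define q where "q = sqrt 2 / 2"
    have q: "q\<^sup>2 = 1 / 2" by (simp add: q_def power_divide)
    define H where "H z = T z + T (prod.swap z)" for z
    have H: "square_integrable lborel H" unfolding H_def by (intro square_integrable_add T sw)
    have G4: "G (pi / 4) = (\<lambda>z. q * H (R (pi / 4) z))"
      by (auto simp: G_def H_def q_def cos_45 sin_45 algebra_simps)
    have G0: "G 0 = T" by (auto simp: G_def R_def rot_def)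
    have "(LBINT z. (H z)\<^sup>2) = 2 * (F * Z)"
      unfolding H_def using integral_add_power2[OF T sw[OF T]] by (simp add: TT sT2 T2)
    moreover have "(LBINT z. (H (R (pi / 4) z))\<^sup>2) = (LBINT z. (H z)\<^sup>2)"
      by (rule R_int) (use meas[OF H] in simp)
    ultimately have 1: "(LBINT z. (G (pi / 4) z)\<^sup>2) = F * Z"
      by (simp add: G4 power_mult_distrib q)
    \<comment> \<open>The reflection of (x, y) to (-x, y) preserves the measure and negates T, as f
      is odd. It fixes the other factor: before the turn by pi/4 it amounts to a swap after it, and
      H is symmetric under the swap.\<close>
    have 2: "(LBINT z. H (R (pi / 4) z) * T z) = 0"
    proof -
      define \<rho> where "\<rho> = prod.swap \<circ> R (pi / 2)"
      have \<rho>: "\<rho> z = (- fst z, snd z)" for z by (simp add: \<rho>_def quarter)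
      have \<rho>_pres: "distr lborel borel \<rho> = lborel" "\<rho> \<in> borel_measurable borel"
        unfolding \<rho>_def using Rpres measurable_swap distr_swap
        by (auto intro!: distr_compose_lborel measurable_comp[where N=borel])
      have "R (pi / 4) (\<rho> z) = prod.swap (R (pi / 4) z)" for z
        by (simp add: \<rho> R_def rot_def cos_45 sin_45 algebra_simps)
      then have "H (R (pi / 4) (\<rho> z)) * T (\<rho> z) = - (H (R (pi / 4) z) * T z)" for z
        by (simp add: H_def T_def \<rho> odd add.commute)
      moreover have "(LBINT z. H (R (pi / 4) (\<rho> z)) * T (\<rho> z)) = (LBINT z. H (R (pi / 4) z) * T z)"
        by (rule measure_preserving_integral(1)[OF \<rho>_pres]) (use meas[OF sR[OF H]] meas[OF T] in simp)
      ultimately show ?thesis by simp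
    qed
    have G4s: "square_integrable lborel (G (pi / 4))"
      unfolding G4 by (intro square_integrable_mult_left sR H)
    have "(LBINT z. G (pi / 4) z * G 0 z) = 0"
      unfolding G4 G0 using 2 by (simp add: mult.assoc)
    then show ?thesis
      using integral_diff_power2[OF G4s, of "G 0"] T by (simp add: 1 G0 T2)
  qed
  moreover have "(pi / 4)\<^sup>2 * (LBINT z. (p z)\<^sup>2) \<le> 16 / 25 * (LBINT z. (p z)\<^sup>2)"
    by (intro mult_right_mono pi_quarter_power2_le) auto
  ultimately have "2 * (F * Z) \<le> 16 / 25 * (LBINT z. (p z)\<^sup>2)" by linarith
  then have "2 * (F * Z) \<le> 16 / 25 * (Z / (2 * b) * S + 2 * M + F * Z)" by (simp add: p2)
  then have "50 * (F * Z) \<le> 8 * (Z / b * S) + 32 * M + 16 * (F * Z)" using b by (simp add: mult.commute)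
  then have "17 * (F * Z) * b \<le> 4 * (Z * S) + 16 * M * b" using b by (simp add: field_simps)
  then have "17 / 4 * (F * b) - 4 * b / Z * M \<le> S" using Z by (simp add: field_simps)
  moreover have "0 \<le> F * b" using b by (simp add: F_def)
  ultimately have "3 * (F * b) - 4 * b / Z * M \<le> S" by argo
  then show ?thesis by (simp add: F_def M_def Z_def S_def mult_ac)
qed

lemma distr_uminus_lborel: "distr lborel borel uminus = (lborel :: 'a::euclidean_space measure)"
  using lborel_affine[of "-1" "0 :: 'a"] by (simp add: density_1)

text \<open>Even and odd parts can be treated separately: d_k + b x_k reverses parity, so norms and
  energies add up, the Gaussian sees only the even part and the x_i gauss see only the odd part. In
  the sum the two factors agree up to 2 b whenever integration by parts is possible, and their
  product is then a multiple of the squared component along x_i gauss.\<close>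

lemma spectral_gap:
  fixes f :: "'a::euclidean_space \<Rightarrow> real" and a :: "'a \<Rightarrow> 'a"
  assumes b: "b > 0"
    and deriv: "\<And>x. (f has_derivative (\<lambda>v. v \<bullet> (a x - (b * f x) *\<^sub>R x))) (at x)"
    and cont: "continuous_on UNIV a"
    and f: "square_integrable lborel f" and a: "\<And>i. i \<in> Basis \<Longrightarrow> square_integrable lborel (\<lambda>x. a x \<bullet> i)"
  shows "3 * b * ((LBINT x. (f x)\<^sup>2) - (LBINT x. f x * gauss b x)\<^sup>2 / gauss_mass TYPE('a) b)
      - 4 * b / gauss_mass TYPE('a) b *
      (\<Sum>i\<in>Basis. (LBINT x. (a x \<bullet> i) * gauss b x) * (LBINT x. (x \<bullet> i) * gauss b x * f x))
    \<le> (LBINT x. (norm (a x))\<^sup>2)"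
proof -
  define f0 where "f0 x = (f x + f (- x)) / 2" for x
  define f1 where "f1 x = (f x - f (- x)) / 2" for x
  \<comment> \<open>The odd part of \<open>a\<close> goes with the even part of f, as the operators
    reverse parity.\<close>
  define a0 where "a0 x = (1 / 2) *\<^sub>R (a x - a (- x))" for x
  define a1 where "a1 x = (1 / 2) *\<^sub>R (a x + a (- x))" for x
  note defs = f0_def f1_def a0_def a1_def
  have pres: "distr lborel borel uminus = (lborel :: 'a measure)" "uminus \<in> borel_measurable (borel :: 'a measure)"
    by (auto simp: distr_uminus_lborel)
  have refl_int: "(LBINT x. h (- x)) = (LBINT x. h x)"
    if "h \<in> borel_measurable borel" for h :: "'a \<Rightarrow> real"
    by (rule measure_preserving_integral(1)[OF pres that])
  have refl_sq: "square_integrable lborel (\<lambda>x. h (- x))" if "square_integrable lborel h" for h :: "'a \<Rightarrow> real"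
    by (rule square_integrable_measure_preserving[OF pres that])
  have half: "square_integrable lborel (\<lambda>x. (h x + h (- x)) / 2)" "square_integrable lborel (\<lambda>x. (h x - h (- x)) / 2)"
    if "square_integrable lborel h" for h :: "'a \<Rightarrow> real"
    using square_integrable_mult_left[OF square_integrable_add[OF that refl_sq[OF that]], of "1 / 2"]
      square_integrable_mult_left[OF square_integrable_diff[OF that refl_sq[OF that]], of "1 / 2"] by simp_all
  have split: "(LBINT x. ((h x + h (- x)) / 2)\<^sup>2) + (LBINT x. ((h x - h (- x)) / 2)\<^sup>2) = (LBINT x. (h x)\<^sup>2)"
    if h: "square_integrable lborel h" for h :: "'a \<Rightarrow> real"
  proof -
    have "(LBINT x. (h (- x))\<^sup>2) = (LBINT x. (h x)\<^sup>2)"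
      using h by (intro refl_int borel_measurable_power) (simp add: square_integrable_def)
    then show ?thesis
      using integral_add_power2[OF h refl_sq[OF h]] integral_diff_power2[OF h refl_sq[OF h]]
      by (simp add: power_divide field_simps)
  qed
  have half_mode: "(LBINT x. (h x + h (- x)) / 2 * g x) = (LBINT x. h x * g x)"
      "(LBINT x. (h x - h (- x)) / 2 * g' x) = (LBINT x. h x * g' x)"
    if h: "square_integrable lborel h" and g: "square_integrable lborel g" "\<And>x. g (- x) = g x"
      and g': "square_integrable lborel g'" "\<And>x. g' (- x) = - g' x" for h g g' :: "'a \<Rightarrow> real"
  proof -
    have i: "integrable lborel (\<lambda>x. h x * g x)" "integrable lborel (\<lambda>x. h (- x) * g x)"
      "integrable lborel (\<lambda>x. h x * g' x)" "integrable lborel (\<lambda>x. h (- x) * g' x)"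
      using h g g' refl_sq[OF h] by (auto intro: integrable_mult_square_integrable)
    have "(LBINT x. h (- x) * g x) = (LBINT x. h x * g x)"
      using refl_int[of "\<lambda>x. h x * g x"] i by (simp add: g)
    then show "(LBINT x. (h x + h (- x)) / 2 * g x) = (LBINT x. h x * g x)"
      using i by (simp add: add_divide_distrib distrib_right)
    have "(LBINT x. h (- x) * g' x) = - (LBINT x. h x * g' x)"
      using refl_int[of "\<lambda>x. h x * g' x"] i by (simp add: g')
    then show "(LBINT x. (h x - h (- x)) / 2 * g' x) = (LBINT x. h x * g' x)"
      using i by (simp add: diff_divide_distrib left_diff_distrib)
  qed
  have dm: "((\<lambda>x. f (- x)) has_derivative (\<lambda>v. - v \<bullet> (a (- x) - (b * f (- x)) *\<^sub>R (- x)))) (at x)" for x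
    by (rule has_derivative_compose[OF _ deriv]) (auto intro!: derivative_eq_intros)
  have d0: "(f0 has_derivative (\<lambda>v. v \<bullet> (a0 x - (b * f0 x) *\<^sub>R x))) (at x)" for x
    unfolding defs
    by (rule derivative_eq_intros deriv dm refl)+ (auto simp: inner_diff_right inner_add_right algebra_simps add_divide_distrib diff_divide_distrib)
  have d1: "(f1 has_derivative (\<lambda>v. v \<bullet> (a1 x - (b * f1 x) *\<^sub>R x))) (at x)" for x
    unfolding defs
    by (rule derivative_eq_intros deriv dm refl)+ (auto simp: inner_diff_right inner_add_right algebra_simps add_divide_distrib diff_divide_distrib)
  have contm: "continuous_on UNIV (\<lambda>x. a (- x))"
    by (rule continuous_on_compose2[OF cont]) (auto intro: continuous_intros)
  have c: "continuous_on UNIV a0" "continuous_on UNIV a1"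
    unfolding defs by (intro continuous_intros cont contm)+
  have ai: "a0 x \<bullet> i = (a x \<bullet> i - a (- x) \<bullet> i) / 2" "a1 x \<bullet> i = (a x \<bullet> i + a (- x) \<bullet> i) / 2" for x i
    by (simp_all add: defs inner_diff_left inner_add_left)
  have sf: "square_integrable lborel f0" "square_integrable lborel f1"
    unfolding f0_def f1_def by (intro half f)+
  have sa: "square_integrable lborel (\<lambda>x. a0 x \<bullet> i)" "square_integrable lborel (\<lambda>x. a1 x \<bullet> i)"
    if "i \<in> Basis" for i
    unfolding ai using half[OF a[OF that]] by auto
  have norm_eq: "(LBINT x. (norm (h x))\<^sup>2) = (\<Sum>i\<in>Basis. LBINT x. (h x \<bullet> i)\<^sup>2)"
    if "\<And>i. i \<in> Basis \<Longrightarrow> square_integrable lborel (\<lambda>x. h x \<bullet> i)" for h :: "'a \<Rightarrow> 'a"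
  proof -
    have "(\<lambda>x. (norm (h x))\<^sup>2) = (\<lambda>x. \<Sum>i\<in>Basis. (h x \<bullet> i)\<^sup>2)"
      unfolding power2_norm_eq_inner by (subst euclidean_inner) (simp add: power2_eq_square)
    then show ?thesis
      using that by (auto simp: square_integrable_def intro!: Bochner_Integration.integral_sum)
  qed
  have S: "(LBINT x. (norm (a x))\<^sup>2) = (LBINT x. (norm (a0 x))\<^sup>2) + (LBINT x. (norm (a1 x))\<^sup>2)"
  proof -
    have "(LBINT x. (norm (a0 x))\<^sup>2) + (LBINT x. (norm (a1 x))\<^sup>2)
        = (\<Sum>i\<in>Basis. (LBINT x. (a0 x \<bullet> i)\<^sup>2) + (LBINT x. (a1 x \<bullet> i)\<^sup>2))"
      using sa by (simp add: norm_eq sum.distrib)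
    also have "\<dots> = (\<Sum>i\<in>Basis. LBINT x. (a x \<bullet> i)\<^sup>2)"
      unfolding ai by (intro sum.cong refl, subst add.commute) (use split[OF a] in simp)
    finally show ?thesis using a by (simp add: norm_eq)
  qed
  have F: "(LBINT x. (f x)\<^sup>2) = (LBINT x. (f0 x)\<^sup>2) + (LBINT x. (f1 x)\<^sup>2)"
    unfolding f0_def f1_def using split[OF f] by simp
  have m: "(LBINT x. f0 x * gauss b x) = (LBINT x. f x * gauss b x)"
    unfolding f0_def
    by (rule half_mode(1)[OF f square_integrable_gauss(1)[OF b] _ square_integrable_gauss(2)[OF b, of 0]]) auto
  have M1: "(LBINT x. (a1 x \<bullet> i) * gauss b x) = (LBINT x. (a x \<bullet> i) * gauss b x)" if "i \<in> Basis" for i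
    unfolding ai
    by (rule half_mode(1)[OF a[OF that] square_integrable_gauss(1)[OF b] _ square_integrable_gauss(2)[OF b, of 0]]) auto
  have M2: "(LBINT x. (x \<bullet> i) * gauss b x * f1 x) = (LBINT x. (x \<bullet> i) * gauss b x * f x)" for i
    unfolding f1_def
    using half_mode(2)[OF f square_integrable_gauss(1)[OF b] _ square_integrable_gauss(2)[OF b, of i]]
    by (simp add: mult_ac)
  have M: "(\<Sum>i\<in>Basis. (LBINT x. (a1 x \<bullet> i) * gauss b x) * (LBINT x. (x \<bullet> i) * gauss b x * f1 x))
      = (\<Sum>i\<in>Basis. (LBINT x. (a x \<bullet> i) * gauss b x) * (LBINT x. (x \<bullet> i) * gauss b x * f x))"
    by (intro sum.cong refl) (simp add: M1 M2)
  have "3 * b * ((LBINT x. (f0 x)\<^sup>2) - (LBINT x. f0 x * gauss b x)\<^sup>2 / gauss_mass TYPE('a) b)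
    \<le> (LBINT x. (norm (a0 x))\<^sup>2)"
    by (rule spectral_gap_even[OF b d0 c(1) sf(1) sa(1)]) (simp_all add: f0_def add.commute)
  moreover have "3 * b * (LBINT x. (f1 x)\<^sup>2) - 4 * b / gauss_mass TYPE('a) b *
      (\<Sum>i\<in>Basis. (LBINT x. (a1 x \<bullet> i) * gauss b x) * (LBINT x. (x \<bullet> i) * gauss b x * f1 x))
    \<le> (LBINT x. (norm (a1 x))\<^sup>2)"
    by (rule spectral_gap_odd[OF b d1 c(2) sf(2) sa(2)]) (simp_all add: f1_def a1_def add.commute diff_divide_distrib)
  ultimately show ?thesis
    unfolding S F m M by (simp add: algebra_simps)
qed

section \<open>Test functions\<close>

lemma partial_eqI: "(f has_derivative f') (at x) \<Longrightarrow> partial i f x = f' (axis i 1)"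
  unfolding partial_def using frechet_derivative_at by metis

lemma has_derivative_grad:
  fixes f :: "real^'n \<Rightarrow> real"
  assumes "f differentiable (at x)"
  shows "(f has_derivative (\<lambda>v. v \<bullet> grad f x)) (at x)"
proof -
  define f' where "f' = frechet_derivative f (at x)"
  have f': "(f has_derivative f') (at x)"
    using assms unfolding f'_def by (simp add: frechet_derivative_works)
  interpret bounded_linear f' using f' by (rule has_derivative_bounded_linear)
  have "f' v = v \<bullet> grad f x" for v
  proof -
    have "f' v = f' (\<Sum>i\<in>UNIV. v $ i *\<^sub>R axis i 1)"
      by (simp add: basis_expansion flip: scalar_mult_eq_scaleR)
    also have "\<dots> = (\<Sum>i\<in>UNIV. v $ i * f' (axis i 1))"
      by (simp add: sum scaleR)
    also have "\<dots> = v \<bullet> grad f x"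
      by (simp add: inner_vec_def grad_def partial_def f'_def)
    finally show ?thesis .
  qed
  then have "f' = (\<lambda>v. v \<bullet> grad f x)" by auto
  with f' show ?thesis by simp
qed

lemma partial_has_real_derivative:
  fixes f :: "real^'n \<Rightarrow> real"
  assumes "f differentiable (at x)"
  shows "((\<lambda>t. f (x + t *\<^sub>R axis i 1)) has_real_derivative partial i f x) (at 0)"
proof -
  have "((\<lambda>t. f (x + t *\<^sub>R axis i 1)) has_derivative (\<lambda>t. (t *\<^sub>R axis i 1) \<bullet> grad f x)) (at 0)"
    by (rule has_derivative_compose[where g = f])
      (auto intro!: derivative_eq_intros has_derivative_grad[OF assms])
  then show ?thesis
    by (simp add: has_field_derivative_def inner_axis' grad_def mult_commute_abs)
qed

lemma
  fixes f g :: "real^'n \<Rightarrow> real"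
  assumes f: "f differentiable (at x)" and g: "g differentiable (at x)"
  shows partial_add: "partial i (\<lambda>x. f x + g x) x = partial i f x + partial i g x"
    and partial_diff: "partial i (\<lambda>x. f x - g x) x = partial i f x - partial i g x"
    and partial_mult: "partial i (\<lambda>x. f x * g x) x = partial i f x * g x + f x * partial i g x"
proof -
  note d = has_derivative_grad[OF f] has_derivative_grad[OF g]
  have 1: "axis i 1 \<bullet> grad h x = partial i h x" for h :: "real^'n \<Rightarrow> real"
    by (simp add: inner_axis' grad_def)
  show "partial i (\<lambda>x. f x + g x) x = partial i f x + partial i g x"
    using partial_eqI[OF has_derivative_add[OF d]] by (simp add: 1)
  show "partial i (\<lambda>x. f x - g x) x = partial i f x - partial i g x"
    using partial_eqI[OF has_derivative_diff[OF d]] by (simp add: 1)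
  show "partial i (\<lambda>x. f x * g x) x = partial i f x * g x + f x * partial i g x"
    using partial_eqI[OF has_derivative_mult[OF d]] by (simp add: 1)
qed

lemma C_k_Suc_imp: "C_k (Suc k) f \<Longrightarrow> C_k k f"
proof (induction k arbitrary: f)
  case 0
  then show ?case by (auto intro: differentiable_imp_continuous_on)
qed auto

lemma C_k_Suc_differentiable: "C_k (Suc k) f \<Longrightarrow> f differentiable (at x)"
  by (auto simp: differentiable_on_def)

lemma C_k_add: "C_k k f \<Longrightarrow> C_k k g \<Longrightarrow> C_k k (\<lambda>x. f x + g x)"
proof (induction k arbitrary: f g)
  case (Suc k)
  have "partial i (\<lambda>x. f x + g x) = (\<lambda>x. partial i f x + partial i g x)" for i
    using C_k_Suc_differentiable Suc.prems by (blast intro: partial_add)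
  with Suc show ?case by (auto intro: differentiable_on_add)
qed (auto intro: continuous_on_add)

lemma C_k_diff: "C_k k f \<Longrightarrow> C_k k g \<Longrightarrow> C_k k (\<lambda>x. f x - g x)"
proof (induction k arbitrary: f g)
  case (Suc k)
  have "partial i (\<lambda>x. f x - g x) = (\<lambda>x. partial i f x - partial i g x)" for i
    using C_k_Suc_differentiable Suc.prems by (blast intro: partial_diff)
  with Suc show ?case by (auto intro: differentiable_on_diff)
qed (auto intro: continuous_on_diff)

lemma C_k_mult: "C_k k f \<Longrightarrow> C_k k g \<Longrightarrow> C_k k (\<lambda>x. f x * g x)"
proof (induction k arbitrary: f g)
  case (Suc k)
  have "partial i (\<lambda>x. f x * g x) = (\<lambda>x. partial i f x * g x + f x * partial i g x)" for i
    using C_k_Suc_differentiable Suc.prems by (blast intro: partial_mult)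
  moreover have "C_k k f" "C_k k g" using Suc.prems by (blast intro: C_k_Suc_imp)+
  ultimately show ?case using Suc by (auto intro!: differentiable_on_mult C_k_add)
qed (auto intro: continuous_on_mult)

text \<open>Mere continuity is asked for, so the class is stable under products with coordinates,
  Gaussians and other continuous functions without a proof of smoothness, and its members are
  integrable. Any compact set may witness the support, which makes sums and products
  immediate.\<close>

definition compactly_supported :: "('a::euclidean_space \<Rightarrow> real) \<Rightarrow> bool" where
  "compactly_supported f \<longleftrightarrow> continuous_on UNIV f \<and> (\<exists>K. compact K \<and> (\<forall>x. x \<notin> K \<longrightarrow> f x = 0))"

named_theorems cs_intros

lemma cs_continuous: "compactly_supported f \<Longrightarrow> continuous_on UNIV f"
  by (simp add: compactly_supported_def)

lemma cs_mult_left [cs_intros]: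
  "compactly_supported f \<Longrightarrow> continuous_on UNIV g \<Longrightarrow> compactly_supported (\<lambda>x. f x * g x)"
  unfolding compactly_supported_def by (auto intro!: continuous_intros)

lemma cs_mult_right [cs_intros]:
  "continuous_on UNIV g \<Longrightarrow> compactly_supported f \<Longrightarrow> compactly_supported (\<lambda>x. g x * f x)"
  unfolding compactly_supported_def by (auto intro!: continuous_intros)

lemma cs_add [cs_intros]:
  assumes "compactly_supported f" "compactly_supported g"
  shows "compactly_supported (\<lambda>x. f x + g x)"
proof -
  obtain K L where "compact K" "\<forall>x. x \<notin> K \<longrightarrow> f x = 0" "compact L" "\<forall>x. x \<notin> L \<longrightarrow> g x = 0"
    using assms by (auto simp: compactly_supported_def)
  then have "compact (K \<union> L)" "\<forall>x. x \<notin> K \<union> L \<longrightarrow> f x + g x = 0" by auto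
  with assms show ?thesis unfolding compactly_supported_def by (blast intro: continuous_on_add)
qed

lemma cs_minus [cs_intros]: "compactly_supported f \<Longrightarrow> compactly_supported (\<lambda>x. - f x)"
  using cs_mult_right[of "\<lambda>_. -1" f] by simp

lemma cs_diff [cs_intros]:
  "compactly_supported f \<Longrightarrow> compactly_supported g \<Longrightarrow> compactly_supported (\<lambda>x. f x - g x)"
  using cs_add[OF _ cs_minus] by simp

lemma cs_power2 [cs_intros]: "compactly_supported f \<Longrightarrow> compactly_supported (\<lambda>x. (f x)\<^sup>2)"
  using cs_mult_left[OF _ cs_continuous] by (auto simp: power2_eq_square)

lemma cs_zero [cs_intros]: "compactly_supported (\<lambda>x. 0)"
  by (auto simp: compactly_supported_def)

lemma cs_sum [cs_intros]:
  "(\<And>i. i \<in> I \<Longrightarrow> compactly_supported (f i)) \<Longrightarrow> compactly_supported (\<lambda>x. \<Sum>i\<in>I. f i x)"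
  by (induction I rule: infinite_finite_induct) (auto intro: cs_intros)

lemma cs_integrable:
  fixes f :: "'a::euclidean_space \<Rightarrow> real"
  assumes "compactly_supported f"
  shows "integrable lborel f"
proof -
  obtain K where K: "compact K" "\<And>x. x \<notin> K \<Longrightarrow> f x = 0"
    using assms by (auto simp: compactly_supported_def)
  have "integrable lborel (\<lambda>x. indicator K x *\<^sub>R f x)"
    using K(1) by (rule borel_integrable_compact) (rule continuous_on_subset[OF cs_continuous[OF assms]], simp)
  moreover have "(\<lambda>x. indicator K x *\<^sub>R f x) = f"
    by (rule ext) (use K(2) in \<open>auto simp: indicator_def\<close>)
  ultimately show ?thesis by simp
qed

lemma cs_square_integrable: "compactly_supported f \<Longrightarrow> square_integrable lborel f"
  unfolding square_integrable_def
  by (auto intro: cs_integrable cs_power2 borel_measurable_continuous_onI cs_continuous)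

lemma cs_integral_derivative_eq_0:
  fixes h h' :: "'a::euclidean_space \<Rightarrow> real"
  assumes "compactly_supported h" "compactly_supported h'"
    and "\<And>x. ((\<lambda>t. h (x + t *\<^sub>R e)) has_real_derivative h' x) (at 0)"
  shows "integral\<^sup>L lborel h' = 0"
  using assms by (intro integral_directional_derivative_eq_0[of h e h'] cs_integrable) (auto dest: cs_continuous)

lemma test_differentiable: "f \<in> test_functions \<Longrightarrow> f differentiable (at x)"
  unfolding test_functions_def using C_k_Suc_differentiable[of 0 f x] by blast

lemma partial_zero_nhd:
  assumes "open S" "x \<in> S" "\<And>y. y \<in> S \<Longrightarrow> f y = 0"
  shows "partial i f x = 0"
proof -
  have "(f has_derivative (\<lambda>v. 0)) (at x)"
    by (rule has_derivative_transform_within_open[of "\<lambda>_. 0" _ x UNIV S]) (use assms in auto)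
  then show ?thesis by (rule partial_eqI)
qed

lemma partial_test:
  assumes "f \<in> test_functions"
  shows "partial i f \<in> test_functions"
proof -
  have "{x. partial i f x \<noteq> 0} \<subseteq> closure {x. f x \<noteq> 0}"
  proof (rule ccontr)
    assume "\<not> ?thesis"
    then obtain x where x: "partial i f x \<noteq> 0" "x \<in> - closure {x. f x \<noteq> 0}" by auto
    have "partial i f x = 0"
      by (rule partial_zero_nhd[OF _ x(2)]) (use closure_subset[of "{x. f x \<noteq> 0}"] in auto)
    with x show False by simp
  qed
  then have "closure {x. partial i f x \<noteq> 0} \<subseteq> closure {x. f x \<noteq> 0}"
    by (rule closure_minimal) simp
  moreover have "bounded (closure {x. f x \<noteq> 0})"
    using assms unfolding test_functions_def by (auto intro: compact_imp_bounded)
  ultimately have "compact (closure {x. partial i f x \<noteq> 0})"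
    using bounded_subset compact_eq_bounded_closed by blast
  moreover have "C_k k (partial i f)" for k
  proof -
    have "C_k (Suc k) f" using assms unfolding test_functions_def by blast
    then show ?thesis by simp
  qed
  ultimately show ?thesis
    unfolding test_functions_def by blast
qed

lemma test_cs: "f \<in> test_functions \<Longrightarrow> compactly_supported f"
proof -
  assume f: "f \<in> test_functions"
  then have "C_k 0 f" "compact (closure {x. f x \<noteq> 0})" unfolding test_functions_def mem_Collect_eq by blast+
  moreover have "\<forall>x. x \<notin> closure {x. f x \<noteq> 0} \<longrightarrow> f x = 0"
    using closure_subset[of "{x. f x \<noteq> 0}"] by blast
  ultimately show "compactly_supported f" unfolding compactly_supported_def C_k.simps by blast
qed

lemma test_diff:
  assumes "f \<in> test_functions" "g \<in> test_functions"
  shows "(\<lambda>x. f x - g x) \<in> test_functions"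
proof -
  have C: "C_k k f" "C_k k g" and b: "bounded {x. f x \<noteq> 0}" "bounded {x. g x \<noteq> 0}" for k
    using assms unfolding test_functions_def mem_Collect_eq compact_closure by blast+
  have "bounded ({x. f x \<noteq> 0} \<union> {x. g x \<noteq> 0})"
    using b by (simp add: bounded_Un)
  then have "bounded {x. f x - g x \<noteq> 0}"
    by (rule bounded_subset) auto
  moreover have "C_k k (\<lambda>x. f x - g x)" for k
    by (intro C_k_diff C)
  ultimately show ?thesis
    unfolding test_functions_def mem_Collect_eq compact_closure by blast
qed

text \<open>Two applications of the mean value theorem express the second difference of f over a
  small parallelogram as h^2 times a mixed derivative at a nearby point, in either order of
  differentiation; continuity then identifies the two values at x.\<close>

lemma directional_derivatives_commute:
  fixes f :: "'a::real_normed_vector \<Rightarrow> real"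
  assumes u: "\<And>x. ((\<lambda>t. f (x + t *\<^sub>R u)) has_real_derivative fu x) (at 0)"
    and v: "\<And>x. ((\<lambda>t. f (x + t *\<^sub>R v)) has_real_derivative fv x) (at 0)"
    and uv: "\<And>x. ((\<lambda>t. fu (x + t *\<^sub>R v)) has_real_derivative fuv x) (at 0)"
    and vu: "\<And>x. ((\<lambda>t. fv (x + t *\<^sub>R u)) has_real_derivative fvu x) (at 0)"
    and cont: "continuous_on UNIV fuv" "continuous_on UNIV fvu"
  shows "fuv x = fvu x"
proof -
  have mean: "\<exists>s t. 0 < s \<and> s < h \<and> 0 < t \<and> t < h \<and>
      f (x + h *\<^sub>R p + h *\<^sub>R q) - f (x + h *\<^sub>R p) - f (x + h *\<^sub>R q) + f x = h * h * fpq (x + s *\<^sub>R p + t *\<^sub>R q)"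
    if h: "h > 0" and p: "\<And>x. ((\<lambda>t. f (x + t *\<^sub>R p)) has_real_derivative fp x) (at 0)"
      and pq: "\<And>x. ((\<lambda>t. fp (x + t *\<^sub>R q)) has_real_derivative fpq x) (at 0)" for h p q fp fpq
  proof -
    have shift: "((\<lambda>t. g (y + t *\<^sub>R r)) has_real_derivative g' (y + s *\<^sub>R r)) (at s)"
      if "\<And>x. ((\<lambda>t. g (x + t *\<^sub>R r)) has_real_derivative g' x) (at 0)" for g g' :: "'a \<Rightarrow> real" and r y s
      using DERIV_shift[of "\<lambda>t. g (y + t *\<^sub>R r)" "g' (y + s *\<^sub>R r)" 0 s] that[of "y + s *\<^sub>R r"]
      by (simp add: algebra_simps)
    have "\<exists>s>0. s < h \<and> (f ((x + h *\<^sub>R q) + h *\<^sub>R p) - f (x + h *\<^sub>R p))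
        - (f ((x + h *\<^sub>R q) + 0 *\<^sub>R p) - f (x + 0 *\<^sub>R p))
        = (h - 0) * (fp ((x + h *\<^sub>R q) + s *\<^sub>R p) - fp (x + s *\<^sub>R p))"
      using MVT2[OF h, of "\<lambda>s. f ((x + h *\<^sub>R q) + s *\<^sub>R p) - f (x + s *\<^sub>R p)"
          "\<lambda>s. fp ((x + h *\<^sub>R q) + s *\<^sub>R p) - fp (x + s *\<^sub>R p)"]
        DERIV_diff[OF shift[where g = f and g' = fp and r = p, OF p] shift[where g = f and g' = fp and r = p, OF p]]
      by blast
    then obtain s where s: "0 < s" "s < h"
      "f (x + h *\<^sub>R p + h *\<^sub>R q) - f (x + h *\<^sub>R p) - f (x + h *\<^sub>R q) + f x
        = h * (fp (x + s *\<^sub>R p + h *\<^sub>R q) - fp (x + s *\<^sub>R p))"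
      by (auto simp: algebra_simps)
    have "\<exists>t>0. t < h \<and> fp ((x + s *\<^sub>R p) + h *\<^sub>R q) - fp ((x + s *\<^sub>R p) + 0 *\<^sub>R q)
        = (h - 0) * fpq ((x + s *\<^sub>R p) + t *\<^sub>R q)"
      using MVT2[OF h, of "\<lambda>t. fp ((x + s *\<^sub>R p) + t *\<^sub>R q)" "\<lambda>t. fpq ((x + s *\<^sub>R p) + t *\<^sub>R q)"]
        shift[where g = fp and g' = fpq and r = q, OF pq] by blast
    then obtain t where "0 < t" "t < h"
      "fp (x + s *\<^sub>R p + h *\<^sub>R q) - fp (x + s *\<^sub>R p) = h * fpq (x + s *\<^sub>R p + t *\<^sub>R q)"
      by auto
    with s show ?thesis by auto
  qed
  show ?thesis
  proof (rule ccontr)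
    assume ne: "fuv x \<noteq> fvu x"
    define \<epsilon> where "\<epsilon> = \<bar>fuv x - fvu x\<bar> / 2"
    have \<epsilon>: "\<epsilon> > 0" using ne by (simp add: \<epsilon>_def)
    obtain d1 where d1: "d1 > 0" "\<And>y. dist y x < d1 \<Longrightarrow> dist (fuv y) (fuv x) < \<epsilon>"
      using cont(1) \<epsilon> unfolding continuous_on_iff by (metis UNIV_I)
    obtain d2 where d2: "d2 > 0" "\<And>y. dist y x < d2 \<Longrightarrow> dist (fvu y) (fvu x) < \<epsilon>"
      using cont(2) \<epsilon> unfolding continuous_on_iff by (metis UNIV_I)
    \<comment> \<open>Small enough that every intermediate point of the parallelogram lies within
      both radii. Each mixed derivative there is less than half of the supposed difference away from
      its value at x, which is contradictory.\<close>
    define h where "h = min d1 d2 / (norm u + norm v + 1)"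
    have nn: "norm u + norm v + 1 > 0" by (simp add: add_nonneg_pos)
    have h: "h > 0" using d1 d2 nn by (simp add: h_def)
    have close: "dist (x + s *\<^sub>R p + t *\<^sub>R q) x < min d1 d2"
      if "0 < s" "s < h" "0 < t" "t < h" "norm p + norm q = norm u + norm v" for s t p q
    proof -
      have "dist (x + s *\<^sub>R p + t *\<^sub>R q) x \<le> s * norm p + t * norm q"
        using that norm_triangle_ineq[of "s *\<^sub>R p" "t *\<^sub>R q"] by (simp add: dist_norm)
      also have "\<dots> \<le> h * norm p + h * norm q"
        using that by (intro add_mono mult_right_mono) auto
      also have "\<dots> = h * (norm u + norm v)" using that by (simp flip: distrib_left)
      also have "\<dots> < h * (norm u + norm v + 1)" using h by simp
      also have "\<dots> = min d1 d2" using nn by (simp add: h_def)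
      finally show ?thesis .
    qed
    obtain s t where 1: "0 < s" "s < h" "0 < t" "t < h"
      "f (x + h *\<^sub>R u + h *\<^sub>R v) - f (x + h *\<^sub>R u) - f (x + h *\<^sub>R v) + f x = h * h * fuv (x + s *\<^sub>R u + t *\<^sub>R v)"
      using mean[OF h u uv] by blast
    obtain s' t' where 2: "0 < s'" "s' < h" "0 < t'" "t' < h"
      "f (x + h *\<^sub>R v + h *\<^sub>R u) - f (x + h *\<^sub>R v) - f (x + h *\<^sub>R u) + f x = h * h * fvu (x + s' *\<^sub>R v + t' *\<^sub>R u)"
      using mean[OF h v vu] by blast
    have swap: "x + h *\<^sub>R v + h *\<^sub>R u = x + h *\<^sub>R u + h *\<^sub>R v" by (simp add: algebra_simps)
    have "h * h * fuv (x + s *\<^sub>R u + t *\<^sub>R v) = h * h * fvu (x + s' *\<^sub>R v + t' *\<^sub>R u)"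
      using 1(5) 2(5)[unfolded swap] by linarith
    then have "fuv (x + s *\<^sub>R u + t *\<^sub>R v) = fvu (x + s' *\<^sub>R v + t' *\<^sub>R u)" using h by simp
    moreover have "dist (fuv (x + s *\<^sub>R u + t *\<^sub>R v)) (fuv x) < \<epsilon>"
      using close[OF 1(1-4)] by (intro d1) auto
    moreover have "dist (fvu (x + s' *\<^sub>R v + t' *\<^sub>R u)) (fvu x) < \<epsilon>"
      using close[OF 2(1-4)] by (intro d2) auto
    ultimately show False by (simp add: \<epsilon>_def dist_real_def abs_if split: if_splits)
  qed
qed

lemma partial_commute:
  fixes f :: "real^'n \<Rightarrow> real"
  assumes "f \<in> test_functions"
  shows "partial i (partial j f) = partial j (partial i f)"
proof
  fix x
  have c: "continuous_on UNIV (partial i (partial j f))" for i j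
    using assms by (intro cs_continuous test_cs partial_test)
  show "partial i (partial j f) x = partial j (partial i f) x"
    by (rule directional_derivatives_commute[where f = f and u = "axis j 1" and v = "axis i 1"
          and fu = "partial j f" and fv = "partial i f"])
      (intro partial_has_real_derivative test_differentiable partial_test assms c)+
qed

section \<open>The inequality for test functions\<close>

lemma gauss_first_moment:
  fixes u :: "'a::euclidean_space"
  assumes b: "b > 0"
  shows "(LBINT x. (x \<bullet> u) * (gauss b x)\<^sup>2) = 0"
proof -
  have "(LBINT x. - 2 * b * ((x \<bullet> u) * (gauss b x)\<^sup>2)) = 0"
  proof (rule integral_directional_derivative_eq_0[where e = u and h = "\<lambda>x. (gauss b x)\<^sup>2"])
    show "((\<lambda>t. (gauss b (x + t *\<^sub>R u))\<^sup>2) has_real_derivative - 2 * b * ((x \<bullet> u) * (gauss b x)\<^sup>2)) (at 0)" for x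
      by (auto intro!: derivative_eq_intros gauss_has_real_derivative simp: power2_eq_square)
    show "continuous_on UNIV (\<lambda>x. - 2 * b * ((x \<bullet> u) * (gauss b x)\<^sup>2))"
      by (intro continuous_intros)
  qed (intro integrable_mult_right integrable_gauss_moments[OF b])+
  then show ?thesis using b by simp
qed

lemma coord_has_real_derivative:
  fixes x :: "real^'n"
  shows "((\<lambda>t. (x + t *\<^sub>R axis i 1) $ k) has_real_derivative (if i = k then 1 else 0)) (at 0)"
  by (auto intro!: derivative_eq_intros simp: axis_def)

lemma axis_nth_neq: "i \<noteq> k \<Longrightarrow> axis i 1 $ k = (0::real)"
  by (simp add: axis_def)

lemma gauss_has_partial_derivative:
  fixes x :: "real^'n"
  shows "((\<lambda>t. gauss b (x + t *\<^sub>R axis i 1)) has_real_derivative - (b * x $ i * gauss b x)) (at 0)"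
  using gauss_has_real_derivative[of b x "axis i 1"] by (simp add: inner_axis)

lemma cs_integral_add: "compactly_supported f \<Longrightarrow> compactly_supported g \<Longrightarrow> integral\<^sup>L lborel (\<lambda>x. f x + g x) = integral\<^sup>L lborel f + integral\<^sup>L lborel g"
  by (simp add: cs_integrable)

text \<open>Compact support of one factor disposes of the boundary terms, so the other one may be a
  coordinate or a Gaussian.\<close>

lemma cs_integral_by_parts:
  assumes "compactly_supported f" "compactly_supported f'" "continuous_on UNIV g" "continuous_on UNIV g'"
    and "\<And>x. ((\<lambda>t. f (x + t *\<^sub>R e)) has_real_derivative f' x) (at 0)"
    and "\<And>x. ((\<lambda>t. g (x + t *\<^sub>R e)) has_real_derivative g' x) (at 0)"
  shows "integral\<^sup>L lborel (\<lambda>x. f' x * g x) = - integral\<^sup>L lborel (\<lambda>x. f x * g' x)"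
proof -
  have "integral\<^sup>L lborel (\<lambda>x. f' x * g x + f x * g' x) = 0"
  proof (rule cs_integral_derivative_eq_0)
    show "((\<lambda>t. f (x + t *\<^sub>R e) * g (x + t *\<^sub>R e)) has_real_derivative f' x * g x + f x * g' x) (at 0)" for x
      using DERIV_mult[OF assms(5)[of x] assms(6)[of x]] by (simp add: algebra_simps)
  qed (intro cs_intros assms)+
  moreover have "integral\<^sup>L lborel (\<lambda>x. f' x * g x + f x * g' x) = integral\<^sup>L lborel (\<lambda>x. f' x * g x) + integral\<^sup>L lborel (\<lambda>x. f x * g' x)"
    by (intro cs_integral_add cs_intros assms)
  ultimately show ?thesis by simp
qed

lemma cs_integral_add_power2:
  assumes "compactly_supported f" "compactly_supported g"
  shows "integral\<^sup>L lborel (\<lambda>x. (f x + g x)\<^sup>2) = integral\<^sup>L lborel (\<lambda>x. (f x)\<^sup>2) + 2 * integral\<^sup>L lborel (\<lambda>x. f x * g x) + integral\<^sup>L lborel (\<lambda>x. (g x)\<^sup>2)"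
  by (rule integral_add_power2) (intro cs_square_integrable assms)+

lemma gauss_coord:
  fixes k :: "'n::finite"
  assumes b: "b > 0"
  shows "square_integrable lborel (\<lambda>x::real^'n. x $ k * gauss b x)"
    "integral\<^sup>L lborel (\<lambda>x. (x $ k * gauss b x)\<^sup>2) = gauss_mass TYPE(real^'n) b / (2 * b)"
    "integral\<^sup>L lborel (\<lambda>x. x $ k * (gauss b x)\<^sup>2) = 0"
  using square_integrable_gauss(2)[OF b, of "axis k (1::real)"] gauss_second_moment[OF b, of "axis k 1" "axis k (1::real)"]
    gauss_first_moment[OF b, of "axis k (1::real)"]
  by (simp_all add: inner_axis power2_eq_square mult_ac)

section \<open>Energy identities for a fixed test function\<close>

context
  fixes \<phi> :: "real^'n \<Rightarrow> real" and b :: real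
  assumes \<phi>: "\<phi> \<in> test_functions" and b: "b > 0"
begin

private abbreviation (input) "I \<equiv> integral\<^sup>L (lborel :: (real^'n) measure)"
private abbreviation (input) "F j \<equiv> partial j \<phi>"
private abbreviation (input) "H j k \<equiv> partial k (partial j \<phi>)"
text \<open>\<open>ND\<close>, \<open>PD\<close>, \<open>WD\<close> and \<open>ED\<close> are the
  integrals of |grad phi|^2, |Laplacian phi|^2, |x|^2 |grad phi|^2 and the energy E_b of the
  overview, written by coordinates because all integrations by parts are done one coordinate at a
  time. In \<open>H j k\<close> the outer derivative is the k-th.\<close>

private abbreviation (input) "ND \<equiv> (\<Sum>j\<in>UNIV. I (\<lambda>x. (F j x)\<^sup>2))"
private abbreviation (input) "PD \<equiv> I (\<lambda>x. (\<Sum>j\<in>UNIV. H j j x)\<^sup>2)"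
private abbreviation (input) "WD \<equiv> (\<Sum>j\<in>UNIV. \<Sum>k\<in>UNIV. I (\<lambda>x. (x $ k)\<^sup>2 * (F j x)\<^sup>2))"
private abbreviation (input) "ED \<equiv> PD + b\<^sup>2 * WD - (real CARD('n) + 2) * b * ND"

private lemma hessian_sym: "H j k = H k j"
  by (rule partial_commute[OF \<phi>])

private lemma grad_test: "F j \<in> test_functions"
  by (intro partial_test \<phi>)

private lemma test_jet_cs: "compactly_supported \<phi>" "compactly_supported (F j)" "compactly_supported (H j k)"
  by (intro test_cs partial_test \<phi>)+

private lemma test_jet_continuous: "continuous_on UNIV \<phi>" "continuous_on UNIV (F j)" "continuous_on UNIV (H j k)"
  by (intro cs_continuous test_jet_cs)+

private lemmas test_jet_intros = cs_intros test_jet_cs test_jet_continuous continuous_intros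

private lemma test_jet_derivatives:
  "((\<lambda>t. \<phi> (x + t *\<^sub>R axis i 1)) has_real_derivative F i x) (at 0)"
  "((\<lambda>t. F j (x + t *\<^sub>R axis i 1)) has_real_derivative H j i x) (at 0)"
  "((\<lambda>t. H j k (x + t *\<^sub>R axis i 1)) has_real_derivative partial i (H j k) x) (at 0)"
  by (intro partial_has_real_derivative test_differentiable partial_test \<phi>)+

text \<open>Under the integral stands x_j times the j-th derivative of (F_k)^2 / 2, and integration
  by parts moves the derivative to x_j.\<close>

private lemma integral_coord_grad_hessian: "I (\<lambda>x. x $ j * F k x * H k j x) = - (1 / 2) * I (\<lambda>x. (F k x)\<^sup>2)"
proof -
  have "I (\<lambda>x. (2 * (F k x * H k j x)) * x $ j) = - I (\<lambda>x. (F k x * F k x) * 1)"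
    by (rule cs_integral_by_parts[where e = "axis j 1"])
      (auto intro!: test_jet_intros derivative_eq_intros test_jet_derivatives coord_has_real_derivative[THEN DERIV_cong])
  then have "I (\<lambda>x. 2 * (x $ j * F k x * H k j x)) = - I (\<lambda>x. (F k x)\<^sup>2)"
    by (simp only: power2_eq_square mult_ac mult_1_right mult_1_left)
  then show ?thesis by simp
qed

private lemma integral_mult_hessian_diag: "I (\<lambda>x. \<phi> x * H j j x) = - I (\<lambda>x. (F j x)\<^sup>2)"
proof -
  have "I (\<lambda>x. H j j x * \<phi> x) = - I (\<lambda>x. F j x * F j x)"
    by (rule cs_integral_by_parts[where e = "axis j 1"]) (auto intro!: test_jet_intros test_jet_derivatives)
  then show ?thesis by (simp add: power2_eq_square mult_ac)
qed

private lemma integral_coord_grad_self: "I (\<lambda>x. x $ j * F j x * \<phi> x) = - (1 / 2) * I (\<lambda>x. (\<phi> x)\<^sup>2)"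
proof -
  have "I (\<lambda>x. (2 * (\<phi> x * F j x)) * x $ j) = - I (\<lambda>x. (\<phi> x * \<phi> x) * 1)"
    by (rule cs_integral_by_parts[where e = "axis j 1"])
      (auto intro!: test_jet_intros derivative_eq_intros test_jet_derivatives coord_has_real_derivative[THEN DERIV_cong])
  then have "I (\<lambda>x. 2 * (x $ j * F j x * \<phi> x)) = - I (\<lambda>x. (\<phi> x)\<^sup>2)"
    by (simp only: power2_eq_square mult_ac mult_1_right mult_1_left)
  then show ?thesis by simp
qed

text \<open>Already for single indices the square of d_j d_k phi and the product of d_j d_j phi with
  d_k d_k phi have the same integral: one integration by parts turns both into minus the integral of
  F_j against the same third derivative.\<close>

private lemma sum_hessian_power2_eq: "(\<Sum>j\<in>UNIV. \<Sum>k\<in>UNIV. I (\<lambda>x. (H j k x)\<^sup>2)) = PD"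
proof -
  have "I (\<lambda>x. (H j k x)\<^sup>2) = I (\<lambda>x. H j j x * H k k x)" for j k
  proof -
    have third: "partial k (H j k) = partial j (H k k)"
      using partial_commute[OF grad_test, of k k j] partial_commute[OF \<phi>] partial_commute[OF grad_test, of j k k] by metis
    have "I (\<lambda>x. H j k x * H j k x) = - I (\<lambda>x. F j x * partial k (H j k) x)"
      by (rule cs_integral_by_parts[where e = "axis k 1"])
        (auto intro!: test_jet_intros test_jet_derivatives cs_continuous[OF test_cs] partial_test \<phi>)
    moreover have "I (\<lambda>x. H j j x * H k k x) = - I (\<lambda>x. F j x * partial j (H k k) x)"
      by (rule cs_integral_by_parts[where e = "axis j 1"])
        (auto intro!: test_jet_intros test_jet_derivatives cs_continuous[OF test_cs] partial_test \<phi>)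
    ultimately show ?thesis by (simp add: third power2_eq_square)
  qed
  then have "(\<Sum>j\<in>UNIV. \<Sum>k\<in>UNIV. I (\<lambda>x. (H j k x)\<^sup>2)) = (\<Sum>j\<in>UNIV. \<Sum>k\<in>UNIV. I (\<lambda>x. H j j x * H k k x))"
    by simp
  also have "\<dots> = (\<Sum>j\<in>UNIV. I (\<lambda>x. \<Sum>k\<in>UNIV. H j j x * H k k x))"
    by (intro sum.cong refl Bochner_Integration.integral_sum[symmetric] cs_integrable test_jet_intros)
  also have "\<dots> = I (\<lambda>x. \<Sum>j\<in>UNIV. \<Sum>k\<in>UNIV. H j j x * H k k x)"
    by (intro Bochner_Integration.integral_sum[symmetric] cs_integrable test_jet_intros)
  finally show ?thesis by (simp add: power2_eq_square sum_product)
qed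

text \<open>This is \<open>\<partial>\<^sub>k (\<partial>\<^sub>j + b x\<^sub>j) \<phi>\<close>, which vanishes if \<open>\<phi>\<close> is the Gaussian.\<close>

private definition energy_tensor where "energy_tensor j k x = H j k x + b * (x $ j * F k x) + (if j = k then b * \<phi> x else 0)"

private lemma energy_tensor_cs: "compactly_supported (energy_tensor j k)"
  unfolding energy_tensor_def by (cases "j = k") (simp_all, (intro test_jet_intros)+)

text \<open>The square of (d_j + b x_j) F_k; its cross term is evaluated by parts and yields the
  negative term.\<close>

private lemma integral_lowered_grad_power2: "I (\<lambda>x. (H j k x + b * (x $ j * F k x))\<^sup>2)
    = I (\<lambda>x. (H j k x)\<^sup>2) - b * I (\<lambda>x. (F k x)\<^sup>2) + b\<^sup>2 * I (\<lambda>x. (x $ j)\<^sup>2 * (F k x)\<^sup>2)"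
proof -
  have "I (\<lambda>x. H j k x * (b * (x $ j * F k x))) = b * I (\<lambda>x. x $ j * F k x * H k j x)"
    by (simp add: hessian_sym[of j k] mult_ac)
  then show ?thesis
    by (subst cs_integral_add_power2) (auto intro!: test_jet_intros simp: integral_coord_grad_hessian power_mult_distrib)
qed

text \<open>On the diagonal the added b phi brings b^2 phi^2, which cancels against the cross term
  with b x_k F_k; so no integral of phi^2 survives. The cross term with the second derivative leaves
  - 2 b (F_k)^2, and these terms later raise n to n + 2.\<close>

private lemma integral_energy_tensor_power2: "I (\<lambda>x. (energy_tensor j k x)\<^sup>2) = I (\<lambda>x. (H j k x)\<^sup>2) - b * I (\<lambda>x. (F k x)\<^sup>2)
    + b\<^sup>2 * I (\<lambda>x. (x $ j)\<^sup>2 * (F k x)\<^sup>2) - (if j = k then 2 * b * I (\<lambda>x. (F j x)\<^sup>2) else 0)"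
proof (cases "j = k")
  case False
  then show ?thesis by (simp add: energy_tensor_def integral_lowered_grad_power2)
next
  case [simp]: True
  have "I (\<lambda>x. (H k k x + b * (x $ k * F k x)) * (b * \<phi> x))
      = b * I (\<lambda>x. \<phi> x * H k k x) + b\<^sup>2 * I (\<lambda>x. x $ k * F k x * \<phi> x)"
  proof -
    have "I (\<lambda>x. (H k k x + b * (x $ k * F k x)) * (b * \<phi> x))
      = I (\<lambda>x. b * (\<phi> x * H k k x) + b\<^sup>2 * (x $ k * F k x * \<phi> x))"
      by (simp add: algebra_simps power2_eq_square)
    also have "\<dots> = b * I (\<lambda>x. \<phi> x * H k k x) + b\<^sup>2 * I (\<lambda>x. x $ k * F k x * \<phi> x)"
      by (subst cs_integral_add) (auto intro!: test_jet_intros)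
    finally show ?thesis .
  qed
  then have "I (\<lambda>x. (H k k x + b * (x $ k * F k x) + b * \<phi> x)\<^sup>2) = I (\<lambda>x. (H k k x + b * (x $ k * F k x))\<^sup>2)
      + 2 * (b * I (\<lambda>x. \<phi> x * H k k x) + b\<^sup>2 * I (\<lambda>x. x $ k * F k x * \<phi> x)) + b\<^sup>2 * I (\<lambda>x. (\<phi> x)\<^sup>2)"
    by (subst cs_integral_add_power2) (auto intro!: test_jet_intros simp: power_mult_distrib)
  then show ?thesis by (simp add: energy_tensor_def integral_lowered_grad_power2 integral_mult_hessian_diag integral_coord_grad_self)
qed

text \<open>This is the number operator's energy of the gradient components. Without the diagonal
  term b phi the coefficient of \<open>b * ND\<close> is - n instead of - (n + 2); the difference 2b
  is the eigenvalue to which x_j gauss belongs.\<close>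

private lemma sum_integral_lowered_grad_power2: "(\<Sum>j\<in>UNIV. \<Sum>k\<in>UNIV. I (\<lambda>x. (H j k x + b * (x $ k * F j x))\<^sup>2)) = ED + 2 * b * ND"
proof -
  have "(\<Sum>j\<in>UNIV. \<Sum>k\<in>UNIV. I (\<lambda>x. (H j k x + b * (x $ k * F j x))\<^sup>2))
      = (\<Sum>j\<in>UNIV. \<Sum>k\<in>UNIV. I (\<lambda>x. (H j k x)\<^sup>2) - b * I (\<lambda>x. (F j x)\<^sup>2) + b\<^sup>2 * I (\<lambda>x. (x $ k)\<^sup>2 * (F j x)\<^sup>2))"
    using integral_lowered_grad_power2[of k j for k j] by (simp add: hessian_sym[of _ j for j] cong: sum.cong)
  also have "\<dots> = PD - real CARD('n) * b * ND + b\<^sup>2 * WD"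
    by (simp add: sum.distrib sum_subtractf sum_hessian_power2_eq sum_distrib_left mult_ac)
  finally show ?thesis by (simp add: algebra_simps)
qed

private lemma sum_integral_energy_tensor_power2: "(\<Sum>j\<in>UNIV. \<Sum>k\<in>UNIV. I (\<lambda>x. (energy_tensor j k x)\<^sup>2)) = ED"
proof -
  have "(\<Sum>j\<in>UNIV. \<Sum>k\<in>UNIV. I (\<lambda>x. (x $ j)\<^sup>2 * (F k x)\<^sup>2)) = WD"
    by (rule sum.swap)
  then have "(\<Sum>j\<in>UNIV. \<Sum>k\<in>UNIV. I (\<lambda>x. (energy_tensor j k x)\<^sup>2)) = PD - real CARD('n) * b * ND + b\<^sup>2 * WD - 2 * b * ND"
    by (simp add: integral_energy_tensor_power2 sum.distrib sum_subtractf sum_hessian_power2_eq sum_distrib_left[symmetric] mult.assoc)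
  then show ?thesis by (simp add: algebra_simps)
qed

section \<open>Moments of the gradient on the two lowest eigenspaces\<close>

private lemma cs_gauss_integral_bound:
  assumes "compactly_supported f"
  shows "(I (\<lambda>x. f x * gauss b x))\<^sup>2 \<le> I (\<lambda>x. (f x)\<^sup>2) * gauss_mass TYPE(real^'n) b"
    and "(I (\<lambda>x. f x * (x $ k * gauss b x)))\<^sup>2 \<le> I (\<lambda>x. (f x)\<^sup>2) * (gauss_mass TYPE(real^'n) b / (2 * b))"
  using integral_Cauchy_Schwarz[OF cs_square_integrable[OF assms] square_integrable_gauss(1)[OF b]]
    integral_Cauchy_Schwarz[OF cs_square_integrable[OF assms] gauss_coord(1)[OF b]] by (simp_all add: gauss_coord(2)[OF b])

text \<open>Only the antisymmetric part of the energy tensor enters: it is the angular momentum of \<open>\<phi>\<close>.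
  This is where dimension at least two is needed.\<close>

private lemma gauss_mean_grad_eq:
  assumes "j \<noteq> k"
  shows "I (\<lambda>x. (energy_tensor k j x - energy_tensor j k x) * (x $ k * gauss b x)) = I (\<lambda>x. F j x * gauss b x)"
proof -
  have 1: "I (\<lambda>x. F j x * ((x $ k)\<^sup>2 * gauss b x)) = - I (\<lambda>x. \<phi> x * (- b * x $ j * (x $ k)\<^sup>2 * gauss b x))"
    using assms
    by (intro cs_integral_by_parts[where e = "axis j 1"])
      (auto intro!: test_jet_intros derivative_eq_intros test_jet_derivatives coord_has_real_derivative gauss_has_partial_derivative simp: axis_nth_neq)
  have 2: "I (\<lambda>x. F k x * (x $ j * x $ k * gauss b x))
      = - I (\<lambda>x. \<phi> x * (x $ j * gauss b x - b * x $ j * (x $ k)\<^sup>2 * gauss b x))"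
    using assms
    by (intro cs_integral_by_parts[where e = "axis k 1"])
      (auto intro!: test_jet_intros derivative_eq_intros test_jet_derivatives coord_has_real_derivative gauss_has_partial_derivative simp: axis_nth_neq power2_eq_square algebra_simps)
  have 3: "I (\<lambda>x. F j x * gauss b x) = - I (\<lambda>x. \<phi> x * (- b * x $ j * gauss b x))"
    by (intro cs_integral_by_parts[where e = "axis j 1"])
      (auto intro!: test_jet_intros test_jet_derivatives gauss_has_partial_derivative)
  \<comment> \<open>The second derivatives cancel by symmetry and leave b (x_k d_j - x_j d_k) phi.
    After integration by parts the cubic terms cancel as well, and the moment of phi against x_j
    gauss remains.\<close>
  have "I (\<lambda>x. (energy_tensor k j x - energy_tensor j k x) * (x $ k * gauss b x))
      = I (\<lambda>x. b * (F j x * ((x $ k)\<^sup>2 * gauss b x)) - b * (F k x * (x $ j * x $ k * gauss b x)))"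
    using assms by (simp add: energy_tensor_def hessian_sym[of k j] algebra_simps power2_eq_square)
  also have "\<dots> = b * I (\<lambda>x. F j x * ((x $ k)\<^sup>2 * gauss b x)) - b * I (\<lambda>x. F k x * (x $ j * x $ k * gauss b x))"
  proof (subst Bochner_Integration.integral_diff)
    show "integrable lborel (\<lambda>x. b * (F j x * ((x $ k)\<^sup>2 * gauss b x)))"
      "integrable lborel (\<lambda>x. b * (F k x * (x $ j * x $ k * gauss b x)))"
      by (intro integrable_mult_right cs_integrable cs_mult_left test_jet_cs continuous_intros)+
  qed simp
  also have "\<dots> = b * (I (\<lambda>x. \<phi> x * (x $ j * gauss b x - b * x $ j * (x $ k)\<^sup>2 * gauss b x))
      - I (\<lambda>x. \<phi> x * (- b * x $ j * (x $ k)\<^sup>2 * gauss b x)))"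
    unfolding 1 2 by (simp add: algebra_simps)
  also have "\<dots> = b * I (\<lambda>x. \<phi> x * (x $ j * gauss b x))"
  proof (subst Bochner_Integration.integral_diff[symmetric])
    show "integrable lborel (\<lambda>x. \<phi> x * (x $ j * gauss b x - b * x $ j * (x $ k)\<^sup>2 * gauss b x))"
      "integrable lborel (\<lambda>x. \<phi> x * (- b * x $ j * (x $ k)\<^sup>2 * gauss b x))"
      by (intro cs_integrable cs_mult_left test_jet_cs continuous_intros)+
  qed (simp add: algebra_simps)
  also have "\<dots> = I (\<lambda>x. F j x * gauss b x)"
    unfolding 3 by (simp add: mult_ac)
  finally show ?thesis .
qed

text \<open>Each j borrows one partner k, and Cauchy-Schwarz against x_k gauss contributes Z / (2
  b). The single pair is then enlarged to the sum over all k; the two index orders give 2 E_b each,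
  so the factor is 4 Z / (2 b).\<close>

private lemma sum_gauss_mean_grad_power2_le:
  assumes "CARD('n) \<ge> 2"
  shows "(\<Sum>j\<in>UNIV. (I (\<lambda>x. F j x * gauss b x))\<^sup>2) \<le> 2 * gauss_mass TYPE(real^'n) b / b * ED"
proof -
  have D: "compactly_supported (\<lambda>x. energy_tensor k j x - energy_tensor j k x)" for j k
    by (intro cs_intros energy_tensor_cs)
  have D2: "I (\<lambda>x. (energy_tensor k j x - energy_tensor j k x)\<^sup>2) \<le> 2 * I (\<lambda>x. (energy_tensor k j x)\<^sup>2) + 2 * I (\<lambda>x. (energy_tensor j k x)\<^sup>2)" for j k
  proof -
    have "I (\<lambda>x. (energy_tensor k j x - energy_tensor j k x)\<^sup>2) \<le> I (\<lambda>x. 2 * (energy_tensor k j x)\<^sup>2 + 2 * (energy_tensor j k x)\<^sup>2)"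
    proof (rule integral_mono)
      show "(energy_tensor k j x - energy_tensor j k x)\<^sup>2 \<le> 2 * (energy_tensor k j x)\<^sup>2 + 2 * (energy_tensor j k x)\<^sup>2" for x
        using zero_le_power2[of "energy_tensor k j x + energy_tensor j k x"] by (simp add: power2_sum power2_diff)
    qed (intro cs_integrable test_jet_intros energy_tensor_cs)+
    also have "\<dots> = 2 * I (\<lambda>x. (energy_tensor k j x)\<^sup>2) + 2 * I (\<lambda>x. (energy_tensor j k x)\<^sup>2)"
      by (subst cs_integral_add) (auto intro!: test_jet_intros energy_tensor_cs)
    finally show ?thesis .
  qed
  have "(I (\<lambda>x. F j x * gauss b x))\<^sup>2
      \<le> (\<Sum>k\<in>UNIV. 2 * I (\<lambda>x. (energy_tensor k j x)\<^sup>2) + 2 * I (\<lambda>x. (energy_tensor j k x)\<^sup>2)) * (gauss_mass TYPE(real^'n) b / (2 * b))" for j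
  proof -
    have "\<exists>k. j \<noteq> k"
    proof (rule ccontr)
      assume "\<not> ?thesis"
      then have "(UNIV :: 'n set) = {j}" by auto
      then have "CARD('n) = card {j}" by metis
      with assms show False by simp
    qed
    then obtain k where k: "j \<noteq> k" by blast
    have "(I (\<lambda>x. F j x * gauss b x))\<^sup>2 \<le> I (\<lambda>x. (energy_tensor k j x - energy_tensor j k x)\<^sup>2) * (gauss_mass TYPE(real^'n) b / (2 * b))"
      unfolding gauss_mean_grad_eq[OF k, symmetric] by (rule cs_gauss_integral_bound(2)[OF D])
    also have "\<dots> \<le> (2 * I (\<lambda>x. (energy_tensor k j x)\<^sup>2) + 2 * I (\<lambda>x. (energy_tensor j k x)\<^sup>2)) * (gauss_mass TYPE(real^'n) b / (2 * b))"
      using b by (intro mult_right_mono D2) auto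
    also have "\<dots> \<le> (\<Sum>k\<in>UNIV. 2 * I (\<lambda>x. (energy_tensor k j x)\<^sup>2) + 2 * I (\<lambda>x. (energy_tensor j k x)\<^sup>2)) * (gauss_mass TYPE(real^'n) b / (2 * b))"
      using b by (intro mult_right_mono member_le_sum) auto
    finally show ?thesis .
  qed
  then have "(\<Sum>j\<in>UNIV. (I (\<lambda>x. F j x * gauss b x))\<^sup>2)
      \<le> (\<Sum>j\<in>UNIV. (\<Sum>k\<in>UNIV. 2 * I (\<lambda>x. (energy_tensor k j x)\<^sup>2) + 2 * I (\<lambda>x. (energy_tensor j k x)\<^sup>2)) * (gauss_mass TYPE(real^'n) b / (2 * b)))"
    by (rule sum_mono)
  also have "\<dots> = (2 * (\<Sum>j\<in>UNIV. \<Sum>k\<in>UNIV. I (\<lambda>x. (energy_tensor k j x)\<^sup>2))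
      + 2 * (\<Sum>j\<in>UNIV. \<Sum>k\<in>UNIV. I (\<lambda>x. (energy_tensor j k x)\<^sup>2))) * (gauss_mass TYPE(real^'n) b / (2 * b))"
    by (simp only: sum_distrib_right[symmetric] sum.distrib sum_distrib_left[symmetric])
  also have "(\<Sum>j\<in>UNIV. \<Sum>k\<in>UNIV. I (\<lambda>x. (energy_tensor k j x)\<^sup>2)) = (\<Sum>j\<in>UNIV. \<Sum>k\<in>UNIV. I (\<lambda>x. (energy_tensor j k x)\<^sup>2))"
    by (rule sum.swap)
  finally show ?thesis unfolding sum_integral_energy_tensor_power2 using b by (simp add: field_simps)
qed

definition gradient_moment where
  "gradient_moment j k = I (\<lambda>x. F j x * (x $ k * gauss b x))"

private abbreviation (input) "M \<equiv> gradient_moment"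

private lemma hessian_gauss_moment: "I (\<lambda>x. H j k x * gauss b x) = b * M j k"
proof -
  have "I (\<lambda>x. H j k x * gauss b x) = - I (\<lambda>x. F j x * (- b * x $ k * gauss b x))"
    by (intro cs_integral_by_parts[where e = "axis k 1"]) (auto intro!: test_jet_intros test_jet_derivatives gauss_has_partial_derivative)
  then show ?thesis by (simp add: gradient_moment_def mult_ac)
qed

text \<open>Inherited from the Hessian, whose Gaussian mean is b times this matrix.\<close>

private lemma gradient_moment_sym: "M j k = M k j"
  using hessian_gauss_moment[of j k] hessian_gauss_moment[of k j] b by (simp add: hessian_sym)

private lemma lowered_grad_gauss_moment: "I (\<lambda>x. (H j k x + b * (x $ k * F j x)) * gauss b x) = 2 * b * M j k"
proof -
  have "I (\<lambda>x. (H j k x + b * (x $ k * F j x)) * gauss b x)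
      = I (\<lambda>x. H j k x * gauss b x + b * (F j x * (x $ k * gauss b x)))"
    by (simp add: algebra_simps)
  also have "\<dots> = I (\<lambda>x. H j k x * gauss b x) + b * M j k"
  proof (subst cs_integral_add)
    show "compactly_supported (\<lambda>x. b * (F j x * (x $ k * gauss b x)))"
      by (intro cs_mult_right[of "\<lambda>_. b"] cs_mult_left test_jet_cs continuous_intros)
    show "compactly_supported (\<lambda>x. H j k x * gauss b x)"
      by (intro cs_mult_left test_jet_cs continuous_intros)
  qed (simp add: gradient_moment_def)
  finally show ?thesis by (simp add: hessian_gauss_moment)
qed

text \<open>The energy tensor sees the moment matrix only up to a multiple of the identity, because
  of the extra mean of phi on the diagonal. Hence the energy controls the trace-free part, while the
  trace, the Gaussian direction, escapes.\<close>

private lemma energy_tensor_gauss_moment: "I (\<lambda>x. energy_tensor j k x * gauss b x) = 2 * b * M j k + (if j = k then b * I (\<lambda>x. \<phi> x * gauss b x) else 0)"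
proof -
  have eq: "(\<lambda>x. energy_tensor j k x * gauss b x)
      = (\<lambda>x. (H k j x + b * (x $ j * F k x)) * gauss b x + (if j = k then b else 0) * (\<phi> x * gauss b x))"
    by (auto simp: energy_tensor_def hessian_sym[of j k] algebra_simps)
  have "I (\<lambda>x. energy_tensor j k x * gauss b x) = 2 * b * M k j + (if j = k then b else 0) * I (\<lambda>x. \<phi> x * gauss b x)"
    unfolding eq
  proof (subst cs_integral_add)
    show "compactly_supported (\<lambda>x. (H k j x + b * (x $ j * F k x)) * gauss b x)"
      by (intro cs_mult_left test_jet_intros)
    show "compactly_supported (\<lambda>x. (if j = k then b else 0) * (\<phi> x * gauss b x))"
      by (intro cs_mult_right[of "\<lambda>_. if j = k then b else 0"] cs_mult_left test_jet_cs continuous_intros)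
  qed (simp add: lowered_grad_gauss_moment)
  then show ?thesis by (simp add: gradient_moment_sym)
qed

text \<open>The spectral gap for the \<open>j\<close>-th component of the gradient of \<open>\<phi> - c \<gamma>\<close>, where \<open>\<gamma>\<close> is the Gaussian;
  \<open>c\<close> will be chosen such that the moment matrix becomes trace-free.\<close>

private lemma spectral_gap_shifted_grad:
  "3 * b * (I (\<lambda>x. (F j x)\<^sup>2) + 2 * c * b * M j j + c\<^sup>2 * b * gauss_mass TYPE(real^'n) b / 2 - (I (\<lambda>x. F j x * gauss b x))\<^sup>2 / gauss_mass TYPE(real^'n) b)
    - 8 * b\<^sup>2 / gauss_mass TYPE(real^'n) b * (\<Sum>k\<in>UNIV. (M j k + (if j = k then c * gauss_mass TYPE(real^'n) b / 2 else 0))\<^sup>2)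
   \<le> (\<Sum>k\<in>UNIV. I (\<lambda>x. (H j k x + b * (x $ k * F j x))\<^sup>2)) + 4 * c * b\<^sup>2 * M j j + c\<^sup>2 * b\<^sup>2 * gauss_mass TYPE(real^'n) b"
proof -
  define f where "f x = F j x + c * b * (x $ j * gauss b x)" for x
  \<comment> \<open>This is (d_k + b x_k) f. Applied to x_j gauss the operator gives gauss if j = k
    and 0 otherwise, whence the last summand.\<close>
  define A where "A k x = H j k x + b * (x $ k * F j x) + (if j = k then c * b * gauss b x else 0)" for k x
  define a where "a x = (\<chi> k. A k x)" for x
  have dgj: "((\<lambda>x::real^'n. x $ j * gauss b x) has_derivative (\<lambda>v. v \<bullet> ((gauss b x) *\<^sub>R axis j 1 - (b * (x $ j * gauss b x)) *\<^sub>R x))) (at x)" for x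
    by (rule derivative_eq_intros gauss_has_derivative bounded_linear_imp_has_derivative bounded_linear_vec_nth refl)+
      (auto simp: inner_axis inner_diff_right inner_commute algebra_simps)
  have ga: "grad (F j) x + (c * b) *\<^sub>R (gauss b x *\<^sub>R axis j 1 - (b * (x $ j * gauss b x)) *\<^sub>R x)
      = a x - (b * f x) *\<^sub>R x" for x
    by (vector grad_def a_def A_def f_def axis_def) (auto simp: algebra_simps)
  have deriv: "(f has_derivative (\<lambda>v. v \<bullet> (a x - (b * f x) *\<^sub>R x))) (at x)" for x
  proof -
    have "(f has_derivative (\<lambda>v. v \<bullet> grad (F j) x + c * b * (v \<bullet> ((gauss b x) *\<^sub>R axis j 1 - (b * (x $ j * gauss b x)) *\<^sub>R x)))) (at x)"
      unfolding f_def by (intro has_derivative_add has_derivative_mult_right dgj has_derivative_grad test_differentiable grad_test)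
    then show ?thesis unfolding ga[symmetric] by (simp add: inner_add_right)
  qed
  have contA: "continuous_on UNIV (A k)" for k
    unfolding A_def by (cases "j = k") (simp_all, (intro test_jet_continuous continuous_intros)+)
  have cont: "continuous_on UNIV a"
    unfolding a_def by (intro continuous_on_vec_lambda contA)
  have gj: "square_integrable lborel (\<lambda>x::real^'n. c * b * (x $ j * gauss b x))"
    by (intro square_integrable_mult_left gauss_coord b)
  have sF: "square_integrable lborel (F j)" by (intro cs_square_integrable test_jet_cs)
  have f: "square_integrable lborel f" unfolding f_def by (intro square_integrable_add sF gj)
  have sHF: "compactly_supported (\<lambda>x. H j k x + b * (x $ k * F j x))" for k by (intro test_jet_intros)
  have sg: "square_integrable lborel (\<lambda>x::real^'n. if j = k then c * b * gauss b x else 0)" for k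
    using square_integrable_mult_left[OF square_integrable_gauss(1)[OF b, where 'a = "real^'n"], of "c * b"]
    by (cases "j = k") (auto simp: square_integrable_def)
  have A: "square_integrable lborel (A k)" for k
    unfolding A_def by (rule square_integrable_add[OF cs_square_integrable[OF sHF] sg])
  have a: "square_integrable lborel (\<lambda>x. a x \<bullet> i)" if "i \<in> Basis" for i
    using that A by (auto simp: Basis_vec_def inner_axis a_def)
  have F2: "I (\<lambda>x. (f x)\<^sup>2) = I (\<lambda>x. (F j x)\<^sup>2) + 2 * c * b * M j j + c\<^sup>2 * b * gauss_mass TYPE(real^'n) b / 2"
    unfolding f_def using integral_add_power2[OF sF gj] b
    by (simp add: gradient_moment_def gauss_coord(2)[OF b] power_mult_distrib[of "c * b"] mult.left_commute[of _ "c * b"])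
      (simp add: power2_eq_square)
  have m: "I (\<lambda>x. f x * gauss b x) = I (\<lambda>x. F j x * gauss b x)"
  proof -
    have "I (\<lambda>x. f x * gauss b x) = I (\<lambda>x. F j x * gauss b x + c * b * (x $ j * (gauss b x)\<^sup>2))"
      by (simp add: f_def algebra_simps power2_eq_square)
    also have "\<dots> = I (\<lambda>x. F j x * gauss b x)"
    proof (subst Bochner_Integration.integral_add)
      show "integrable lborel (\<lambda>x. F j x * gauss b x)"
        by (intro cs_integrable cs_mult_left test_jet_cs continuous_intros)
    qed (use gauss_coord(3)[OF b, of j] integrable_gauss_moments(2)[OF b, of "axis j (1::real)"] in \<open>simp_all add: inner_axis\<close>)
    finally show ?thesis .
  qed
  have gkk: "I (\<lambda>x. (x $ j * gauss b x) * (x $ k * gauss b x)) = (if j = k then gauss_mass TYPE(real^'n) b / (2 * b) else 0)" for k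
    using gauss_second_moment[OF b, of "axis j 1" "axis k (1::real)"]
    by (auto simp: inner_axis inner_axis_axis axis_nth_neq power2_eq_square mult_ac)
  have modes: "I (\<lambda>x. A k x * gauss b x) = 2 * b * (M j k + (if j = k then c * gauss_mass TYPE(real^'n) b / 2 else 0))" for k
  proof -
    have "I (\<lambda>x. A k x * gauss b x) = I (\<lambda>x. (H j k x + b * (x $ k * F j x)) * gauss b x
        + (if j = k then c * b else 0) * (gauss b x)\<^sup>2)"
      by (auto simp: A_def algebra_simps power2_eq_square intro!: Bochner_Integration.integral_cong)
    also have "\<dots> = I (\<lambda>x. (H j k x + b * (x $ k * F j x)) * gauss b x) + (if j = k then c * b else 0) * gauss_mass TYPE(real^'n) b"
    proof (subst Bochner_Integration.integral_add)
      show "integrable lborel (\<lambda>x. (H j k x + b * (x $ k * F j x)) * gauss b x)"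
        by (intro cs_integrable cs_mult_left sHF continuous_intros)
    qed (use integrable_gauss_moments(1)[OF b, where 'a = "real^'n"] in simp_all)
    finally show ?thesis unfolding lowered_grad_gauss_moment by (auto simp: algebra_simps)
  qed
  have modes': "I (\<lambda>x. x $ k * gauss b x * f x) = M j k + (if j = k then c * gauss_mass TYPE(real^'n) b / 2 else 0)" for k
  proof -
    have "I (\<lambda>x. x $ k * gauss b x * f x) = I (\<lambda>x. F j x * (x $ k * gauss b x)
        + c * b * ((x $ j * gauss b x) * (x $ k * gauss b x)))"
      by (simp add: f_def algebra_simps)
    also have "\<dots> = M j k + c * b * (if j = k then gauss_mass TYPE(real^'n) b / (2 * b) else 0)"
      using integrable_mult_square_integrable[OF gauss_coord(1)[OF b] gauss_coord(1)[OF b], of j k] unfolding gradient_moment_def gkk[symmetric]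
    proof (subst Bochner_Integration.integral_add)
      show "integrable lborel (\<lambda>x. F j x * (x $ k * gauss b x))"
        by (intro cs_integrable cs_mult_left test_jet_cs continuous_intros)
    qed simp_all
    finally show ?thesis using b by auto
  qed
  have A2: "I (\<lambda>x. (A k x)\<^sup>2) = I (\<lambda>x. (H j k x + b * (x $ k * F j x))\<^sup>2)
      + (if j = k then 4 * c * b\<^sup>2 * M j j + c\<^sup>2 * b\<^sup>2 * gauss_mass TYPE(real^'n) b else 0)" for k
    unfolding A_def using integral_add_power2[OF cs_square_integrable[OF sHF] sg, of k k] lowered_grad_gauss_moment[of j k]
    by (auto simp: power_mult_distrib mult.left_commute[of _ "c * b"]) (simp add: power2_eq_square)
  have norm_a: "I (\<lambda>x. (norm (a x))\<^sup>2) = (\<Sum>k\<in>UNIV. I (\<lambda>x. (A k x)\<^sup>2))"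
  proof -
    have "(\<lambda>x. (norm (a x))\<^sup>2) = (\<lambda>x. \<Sum>k\<in>UNIV. (A k x)\<^sup>2)"
      unfolding power2_norm_eq_inner by (simp add: inner_vec_def a_def power2_eq_square)
    then show ?thesis using A by (auto simp: square_integrable_def intro!: Bochner_Integration.integral_sum)
  qed
  have basis_sum: "(\<Sum>i\<in>Basis. g i) = (\<Sum>k\<in>UNIV. g (axis k 1))" for g :: "real^'n \<Rightarrow> real"
  proof -
    have "(Basis :: (real^'n) set) = range (\<lambda>k::'n. axis k (1::real))" by (auto simp: Basis_vec_def)
    moreover have inj: "inj (\<lambda>k::'n. axis k (1::real))" by (auto simp: inj_on_def axis_eq_axis)
    have "sum g (range (\<lambda>k::'n. axis k (1::real))) = (\<Sum>k\<in>UNIV. g (axis k 1))"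
      unfolding sum.reindex[OF inj] o_def ..
    ultimately show ?thesis by (simp only:)
  qed
  have "4 * b / gauss_mass TYPE(real^'n) b * (\<Sum>i\<in>Basis. I (\<lambda>x. (a x \<bullet> i) * gauss b x) * I (\<lambda>x. (x \<bullet> i) * gauss b x * f x))
      = 8 * b\<^sup>2 / gauss_mass TYPE(real^'n) b * (\<Sum>k\<in>UNIV. (M j k + (if j = k then c * gauss_mass TYPE(real^'n) b / 2 else 0))\<^sup>2)"
  proof -
    have "I (\<lambda>x. (a x \<bullet> axis k 1) * gauss b x) * I (\<lambda>x. (x \<bullet> axis k 1) * gauss b x * f x)
        = 2 * b * (M j k + (if j = k then c * gauss_mass TYPE(real^'n) b / 2 else 0))\<^sup>2" for k
      by (simp add: inner_axis a_def modes modes' power2_eq_square)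
    then show ?thesis
      unfolding basis_sum by (simp add: sum_distrib_left[symmetric]) (simp add: power2_eq_square)
  qed
  moreover have "(\<Sum>k\<in>UNIV. I (\<lambda>x. (A k x)\<^sup>2)) = (\<Sum>k\<in>UNIV. I (\<lambda>x. (H j k x + b * (x $ k * F j x))\<^sup>2))
      + 4 * c * b\<^sup>2 * M j j + c\<^sup>2 * b\<^sup>2 * gauss_mass TYPE(real^'n) b"
    by (simp add: A2 sum.distrib)
  ultimately show ?thesis
    using spectral_gap[OF b deriv cont f a] unfolding norm_a F2 m by linarith
qed

text \<open>Summing the gaps of the components gives 3 b N' - 6 E - 2 E <= E + 2 b N', where N' is
  the squared distance of grad phi from the line spanned by the gradient of the Gaussian; hence 9 =
  1 + 6 + 2.\<close>

lemma energy_spectral_gap: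
  assumes "CARD('n) \<ge> 2"
  shows "b * (ND - 2 * b * (\<Sum>j\<in>UNIV. M j j)\<^sup>2 / (real CARD('n) * gauss_mass TYPE(real^'n) b)) \<le> 9 * ED"
proof -
  have Z: "gauss_mass TYPE(real^'n) b > 0" by (rule gauss_mass_pos[OF b])
  define n where "n = real CARD('n)"
  have n: "n > 0" by (simp add: n_def)
  define t where "t = (\<Sum>j\<in>UNIV. M j j)"
  \<comment> \<open>Chosen to make the trace of \<open>M'\<close> vanish. The same c minimises the
    norm of the gradient of phi - c gauss, so \<open>N'\<close> is indeed the squared distance to
    the line.\<close>
  define c where "c = - 2 * t / (n * gauss_mass TYPE(real^'n) b)"
  define N where "N = ND"
  define E where "E = ED"
  define S where "S = (\<Sum>j\<in>UNIV. (I (\<lambda>x. F j x * gauss b x))\<^sup>2)"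
  define M' where "M' j k = M j k + (if j = k then c * gauss_mass TYPE(real^'n) b / 2 else 0)" for j k
  define T where "T = (\<Sum>j\<in>UNIV. \<Sum>k\<in>UNIV. (M' j k)\<^sup>2)"
  define N' where "N' = N + 2 * c * b * t + n * (c\<^sup>2 * b * gauss_mass TYPE(real^'n) b / 2)"
  have "3 * b * (N + 2 * c * b * t + n * (c\<^sup>2 * b * gauss_mass TYPE(real^'n) b / 2) - S / gauss_mass TYPE(real^'n) b) - 8 * b\<^sup>2 / gauss_mass TYPE(real^'n) b * T
      \<le> (E + 2 * b * N) + 4 * c * b\<^sup>2 * t + n * (c\<^sup>2 * b\<^sup>2 * gauss_mass TYPE(real^'n) b)"
  proof -
    have "(\<Sum>j\<in>UNIV. 3 * b * (I (\<lambda>x. (F j x)\<^sup>2) + 2 * c * b * M j j + c\<^sup>2 * b * gauss_mass TYPE(real^'n) b / 2 - (I (\<lambda>x. F j x * gauss b x))\<^sup>2 / gauss_mass TYPE(real^'n) b)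
        - 8 * b\<^sup>2 / gauss_mass TYPE(real^'n) b * (\<Sum>k\<in>UNIV. (M' j k)\<^sup>2))
      \<le> (\<Sum>j\<in>UNIV. (\<Sum>k\<in>UNIV. I (\<lambda>x. (H j k x + b * (x $ k * F j x))\<^sup>2)) + 4 * c * b\<^sup>2 * M j j + c\<^sup>2 * b\<^sup>2 * gauss_mass TYPE(real^'n) b)"
      unfolding M'_def by (intro sum_mono spectral_gap_shifted_grad)
    then show ?thesis
      unfolding sum.distrib sum_subtractf sum_integral_lowered_grad_power2
      by (simp add: sum.distrib sum_subtractf sum_distrib_left[symmetric] sum_divide_distrib[symmetric]
          N_def E_def S_def T_def t_def n_def)
  qed
  \<comment> \<open>The shift moves along the eigenspace of 2b, so it changes the energy by exactly
    2b times the change of the squared norm, and both sides can be written with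
    \<open>N'\<close>.\<close>
  moreover have e: "2 * b * (N + 2 * c * b * t + n * (c\<^sup>2 * b * gauss_mass TYPE(real^'n) b / 2)) = 2 * b * N + 4 * c * b\<^sup>2 * t + n * (c\<^sup>2 * b\<^sup>2 * gauss_mass TYPE(real^'n) b)"
    by (simp add: algebra_simps power2_eq_square)
  ultimately have "3 * (b * N') - 3 * (b * (S / gauss_mass TYPE(real^'n) b)) - 8 * b\<^sup>2 / gauss_mass TYPE(real^'n) b * T
      \<le> E + 2 * (b * N')"
    unfolding N'_def[symmetric] by (simp add: right_diff_distrib mult.assoc)
  moreover have N': "N' = N - 2 * b * t\<^sup>2 / (n * gauss_mass TYPE(real^'n) b)"
    unfolding N'_def using n Z by (simp add: c_def field_simps power2_eq_square)
  moreover have "b * (S / gauss_mass TYPE(real^'n) b) \<le> 2 * E"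
  proof -
    have "S \<le> 2 * gauss_mass TYPE(real^'n) b / b * E" unfolding S_def E_def by (rule sum_gauss_mean_grad_power2_le[OF assms])
    then show ?thesis using b Z by (simp add: field_simps)
  qed
  moreover have "8 * b\<^sup>2 / gauss_mass TYPE(real^'n) b * T \<le> 2 * E"
  proof -
    define \<mu> where "\<mu> = b * I (\<lambda>x. \<phi> x * gauss b x) - b * c * gauss_mass TYPE(real^'n) b"
    have "I (\<lambda>x. energy_tensor j k x * gauss b x) = 2 * b * M' j k + (if j = k then \<mu> else 0)" for j k
      using energy_tensor_gauss_moment[of j k] by (auto simp: M'_def \<mu>_def algebra_simps)
    then have "(I (\<lambda>x. energy_tensor j k x * gauss b x))\<^sup>2
        = 4 * b\<^sup>2 * (M' j k)\<^sup>2 + (if j = k then 4 * b * \<mu> * M' j j + \<mu>\<^sup>2 else 0)" for j k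
      by (auto simp: power2_eq_square algebra_simps)
    then have "(\<Sum>j\<in>UNIV. \<Sum>k\<in>UNIV. (I (\<lambda>x. energy_tensor j k x * gauss b x))\<^sup>2)
        = 4 * b\<^sup>2 * T + 4 * b * \<mu> * (\<Sum>j\<in>UNIV. M' j j) + n * \<mu>\<^sup>2"
      by (simp add: sum.distrib sum_distrib_left T_def n_def)
    moreover have "(\<Sum>j\<in>UNIV. M' j j) = 0"
      using Z by (simp add: M'_def c_def t_def n_def sum_subtractf)
    moreover have "(\<Sum>j\<in>UNIV. \<Sum>k\<in>UNIV. (I (\<lambda>x. energy_tensor j k x * gauss b x))\<^sup>2) \<le> E * gauss_mass TYPE(real^'n) b"
      unfolding E_def sum_integral_energy_tensor_power2[symmetric] sum_distrib_right
      by (intro sum_mono cs_gauss_integral_bound(1) energy_tensor_cs)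
    moreover have "0 \<le> n * \<mu>\<^sup>2" using n by simp
    ultimately have "4 * b\<^sup>2 * T \<le> E * gauss_mass TYPE(real^'n) b" by simp
    then show ?thesis using Z by (simp add: field_simps)
  qed
  ultimately have "b * N' \<le> 9 * E" by linarith
  then show ?thesis unfolding N' by (simp add: N_def t_def n_def E_def)
qed

text \<open>One coordinate is enough: integration by parts expresses the integral of phi^2 as -2
  times that of x_j F_j phi, and Cauchy-Schwarz follows. In the limit it shows that a nonzero
  element has a nonzero gradient.\<close>

lemma weighted_hardy: "I (\<lambda>x. (\<phi> x)\<^sup>2) \<le> 4 * WD"
proof -
  fix j :: 'n
  define U where "U = I (\<lambda>x. (\<phi> x)\<^sup>2)"
  define V where "V = I (\<lambda>x. (x $ j)\<^sup>2 * (F j x)\<^sup>2)"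
  have U: "U \<ge> 0" by (simp add: U_def)
  have "(I (\<lambda>x. (x $ j * F j x) * \<phi> x))\<^sup>2 \<le> I (\<lambda>x. (x $ j * F j x)\<^sup>2) * U"
    unfolding U_def by (intro integral_Cauchy_Schwarz cs_square_integrable test_jet_intros)
  then have "U * U \<le> 4 * V * U"
    using integral_coord_grad_self[of j] by (simp add: U_def[symmetric] V_def power_mult_distrib) (simp add: power2_eq_square)
  then have "U \<le> 4 * V"
    using U by (cases "U = 0") (auto simp: V_def mult_le_cancel_right)
  moreover have "V \<le> (\<Sum>k\<in>UNIV. I (\<lambda>x. (x $ k)\<^sup>2 * (F j x)\<^sup>2))"
    unfolding V_def by (rule member_le_sum) auto
  moreover have "\<dots> \<le> WD"
    by (rule member_le_sum) (auto intro!: sum_nonneg)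
  ultimately show ?thesis by (simp add: U_def)
qed

text \<open>A sum of squares. For all b together this is the underlying uncertainty inequality; b =
  1 bounds the gradient by \<open>H_norm\<close>.\<close>

lemma energy_nonneg: "ED \<ge> 0"
  unfolding sum_integral_energy_tensor_power2[symmetric] by (intro sum_nonneg) auto

end

section \<open>The fundamental lemma of the calculus of variations\<close>

text \<open>The polynomial makes the family closed under differentiation, so that smoothness at 0 is
  proved for all derivatives at once. \<open>flat 1\<close> is the classical exp (-1/t) extended by
  0.\<close>

definition flat :: "real poly \<Rightarrow> real \<Rightarrow> real" where
  "flat p t = (if t > 0 then poly p (1 / t) * exp (- (1 / t)) else 0)"

lemma flat_tendsto_0: "(flat p \<longlongrightarrow> 0) (at_right 0)"
proof -
  have "((\<lambda>y. poly p y * exp (- y)) \<longlongrightarrow> 0) at_top"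
  proof -
    have "((\<lambda>y. \<Sum>i\<le>degree p. coeff p i * (y ^ i / exp y)) \<longlongrightarrow> (\<Sum>i\<le>degree p. coeff p i * 0)) at_top"
      by (intro tendsto_sum tendsto_mult tendsto_const tendsto_power_div_exp_0)
    then show ?thesis
      by (simp add: poly_altdef sum_distrib_right sum_divide_distrib exp_minus inverse_eq_divide)
  qed
  from filterlim_compose[OF this filterlim_inverse_at_top_right]
  have "((\<lambda>t. poly p (inverse t) * exp (- inverse t)) \<longlongrightarrow> 0) (at_right 0)" .
  then show ?thesis
    by (rule Lim_transform_eventually)
      (auto simp: eventually_at_filter flat_def inverse_eq_divide)
qed

lemma flat_has_real_derivative:
  "(flat p has_real_derivative flat ([:0, 0, 1:] * (p - pderiv p)) t) (at t)"
proof -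
  consider "t > 0" | "t < 0" | "t = 0" by linarith
  then show ?thesis
  proof cases
    case 1
    have "((\<lambda>t. poly p (1 / t) * exp (- (1 / t))) has_real_derivative
        flat ([:0, 0, 1:] * (p - pderiv p)) t) (at t)"
      using 1 by (auto intro!: derivative_eq_intros simp: flat_def field_simps power2_eq_square)
    then show ?thesis
      by (rule DERIV_cong_ev[THEN iffD1, OF refl _ refl, rotated])
        (use 1 in \<open>auto simp: flat_def intro!: eventually_mono[OF eventually_nhds_in_open[of "{0<..}"]]\<close>)
  next
    case 2
    have "((\<lambda>t. 0) has_real_derivative flat ([:0, 0, 1:] * (p - pderiv p)) t) (at t)"
      using 2 by (simp add: flat_def)
    then show ?thesis
      by (rule DERIV_cong_ev[THEN iffD1, OF refl _ refl, rotated])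
        (use 2 in \<open>auto simp: flat_def intro!: eventually_mono[OF eventually_nhds_in_open[of "{..<0}"]]\<close>)
  next
    case [simp]: 3
    \<comment> \<open>Dividing by h multiplies the polynomial in 1/h by its variable, so the
      difference quotient is again a member of the family.\<close>
    have "((\<lambda>h. flat p h / h) \<longlongrightarrow> 0) (at_right 0)"
      by (rule Lim_transform_eventually[OF flat_tendsto_0[of "pCons 0 p"]])
        (auto simp: eventually_at_filter flat_def)
    moreover have "((\<lambda>h. flat p h / h) \<longlongrightarrow> 0) (at_left 0)"
      by (rule Lim_transform_eventually[OF tendsto_const]) (auto simp: eventually_at_filter flat_def)
    ultimately have "((\<lambda>h. flat p h / h) \<longlongrightarrow> 0) (at 0)"
      by (simp add: filterlim_at_split)
    then show ?thesis by (simp add: DERIV_def flat_def)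
  qed
qed

lemma C_k_const: "C_k k (\<lambda>x::real^'n. c)"
proof (induction k arbitrary: c)
  case (Suc k)
  have "partial i (\<lambda>x::real^'n. c) = (\<lambda>x. 0)" for i
    by (rule ext) (rule partial_eqI[OF has_derivative_const])
  with Suc show ?case by simp
qed simp

text \<open>All derivatives are supplied beforehand as a sequence; the induction then shifts m at
  each order, a partial derivative being \<open>\<beta> (Suc m)\<close> times 0 or 1.\<close>

lemma C_k_coord:
  fixes \<beta> :: "nat \<Rightarrow> real \<Rightarrow> real" and i :: "'n::finite"
  assumes \<beta>: "\<And>m t. (\<beta> m has_real_derivative \<beta> (Suc m) t) (at t)"
  shows "C_k k (\<lambda>x::real^'n. \<beta> m (x $ i))"
proof (induction k arbitrary: m)
  case 0
  have "continuous_on UNIV (\<beta> m)"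
    using \<beta> by (intro DERIV_continuous_on[of UNIV "\<beta> m"]) (auto intro: has_field_derivative_at_within)
  moreover have "continuous_on UNIV (\<lambda>x::real^'n. x $ i)"
    by (intro continuous_intros)
  ultimately show ?case
    using continuous_on_compose2[of UNIV "\<beta> m" UNIV "\<lambda>x::real^'n. x $ i"] by simp
next
  case (Suc k)
  have d: "((\<lambda>x::real^'n. \<beta> m (x $ i)) has_derivative (\<lambda>v. \<beta> (Suc m) (x $ i) * v $ i)) (at x)" for x
    by (rule has_derivative_compose[OF bounded_linear_imp_has_derivative[OF bounded_linear_vec_nth]
          has_field_derivative_imp_has_derivative[OF \<beta>]])
  have "partial j (\<lambda>x::real^'n. \<beta> m (x $ i)) = (\<lambda>x. (if j = i then 1 else 0) * \<beta> (Suc m) (x $ i))" for j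
    by (rule ext) (use partial_eqI[OF d] in \<open>auto simp: axis_def\<close>)
  then show ?case
    using d Suc by (auto simp: differentiable_on_def differentiable_def intro!: C_k_mult C_k_const)
qed

lemma C_k_prod: "(\<And>i. i \<in> A \<Longrightarrow> C_k k (f i)) \<Longrightarrow> C_k k (\<lambda>x. \<Prod>i\<in>A. f i x)"
  by (induction A rule: infinite_finite_induct) (auto intro: C_k_const C_k_mult)

lemma C_k_flat: "C_k k (\<lambda>x::real^'n. flat p (s * (x $ i - c)))"
proof -
  define d where "d p = [:0, 0, 1:] * (p - pderiv p)" for p :: "real poly"
  define \<beta> where "\<beta> m t = s ^ m * flat ((d ^^ m) p) (s * (t - c))" for m t
  have "(\<beta> m has_real_derivative \<beta> (Suc m) t) (at t)" for m t
  proof -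
    have "((\<lambda>t. flat ((d ^^ m) p) (s * (t - c))) has_real_derivative flat (d ((d ^^ m) p)) (s * (t - c)) * s) (at t)"
      by (rule DERIV_chain2[OF flat_has_real_derivative[folded d_def]]) (auto intro!: derivative_eq_intros)
    from DERIV_cmult[OF this, of "s ^ m"] show ?thesis by (simp add: \<beta>_def[abs_def] mult_ac)
  qed
  from C_k_coord[of \<beta>, OF this, of k 0 i] show ?thesis by (simp add: \<beta>_def)
qed

text \<open>A smooth substitute for the indicator of the box: as m grows, exp (- 1 / (m t)) tends to
  1 for every t > 0, while the values stay between 0 and 1 and vanish off the box.\<close>

definition box_bump :: "real^'n \<Rightarrow> real^'n \<Rightarrow> nat \<Rightarrow> real^'n \<Rightarrow> real" where
  "box_bump a b m x = (\<Prod>i\<in>UNIV. flat 1 (real m * (x $ i - a $ i)) * flat 1 (- real m * (x $ i - b $ i)))"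

lemma flat_1_bounds: "0 \<le> flat 1 t" "flat 1 t \<le> 1"
  by (auto simp: flat_def)

lemma box_bump_bounds: "0 \<le> box_bump a b m x" "box_bump a b m x \<le> 1"
  unfolding box_bump_def by (auto intro!: prod_nonneg prod_le_1 mult_nonneg_nonneg mult_le_one simp: flat_1_bounds)

lemma box_bump_eq_0: "x \<notin> box a b \<Longrightarrow> box_bump a b m x = 0"
proof -
  assume "x \<notin> box a b"
  then obtain i where "\<not> (a $ i < x $ i \<and> x $ i < b $ i)" by (auto simp: mem_box_cart)
  then have "\<not> (real m * (x $ i - a $ i) > 0 \<and> - real m * (x $ i - b $ i) > 0)"
    by (auto simp: zero_less_mult_iff mult_less_0_iff)
  then have "flat 1 (real m * (x $ i - a $ i)) * flat 1 (- real m * (x $ i - b $ i)) = 0"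
    by (auto simp: flat_def)
  then show ?thesis unfolding box_bump_def by (intro prod_zero) auto
qed

lemma box_bump_test: "box_bump a b m \<in> test_functions"
proof -
  have "C_k k (box_bump a b m)" for k
    unfolding box_bump_def[abs_def] by (intro C_k_prod C_k_mult C_k_flat)
  moreover have "bounded {x. box_bump a b m x \<noteq> 0}"
    by (rule bounded_subset[OF bounded_box[of a b]]) (use box_bump_eq_0 in blast)
  ultimately show ?thesis
    unfolding test_functions_def mem_Collect_eq compact_closure by blast
qed

lemma box_bump_tendsto: "(\<lambda>m. box_bump a b m x) \<longlonglongrightarrow> indicator (box a b) x"
proof (cases "x \<in> box a b")
  case True
  have 1: "(\<lambda>m. flat 1 (real m * t)) \<longlonglongrightarrow> 1" if t: "t > 0" for t
  proof -
    have "filterlim (\<lambda>m. real m * t) at_top sequentially"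
      using filterlim_tendsto_pos_mult_at_top[OF tendsto_const t filterlim_real_sequentially]
      by (simp add: mult.commute)
    then have "(\<lambda>m. exp (- inverse (real m * t))) \<longlonglongrightarrow> exp (- 0)"
      by (intro tendsto_intros tendsto_inverse_0_at_top)
    moreover have "eventually (\<lambda>m. exp (- inverse (real m * t)) = flat 1 (real m * t)) sequentially"
      using eventually_gt_at_top[of "0::nat"] by eventually_elim (use t in \<open>simp add: flat_def inverse_eq_divide\<close>)
    ultimately show ?thesis by (simp add: Lim_transform_eventually)
  qed
  have "(\<lambda>m. \<Prod>i\<in>UNIV. flat 1 (real m * (x $ i - a $ i)) * flat 1 (real m * (b $ i - x $ i))) \<longlonglongrightarrow> (\<Prod>i\<in>(UNIV::'a set). 1 * 1)"
    using True by (intro tendsto_prod tendsto_mult 1) (auto simp: mem_box_cart)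
  moreover have "- real m * (x $ i - b $ i) = real m * (b $ i - x $ i)" for m i
    by (simp add: algebra_simps)
  ultimately show ?thesis using True by (simp add: box_bump_def)
qed (simp add: box_bump_eq_0)

text \<open>Testing with the bumps and dominated convergence shows that the integral of g over every
  box is 0; Lebesgue differentiation over shrinking cubes recovers g almost everywhere.\<close>

lemma fundamental_lemma:
  fixes g :: "real^'n \<Rightarrow> real"
  assumes g: "loc_integrable g" and zero: "\<And>\<psi>. \<psi> \<in> test_functions \<Longrightarrow> (LINT x|lebesgue. g x * \<psi> x) = 0"
  shows "AE x in lebesgue. g x = 0"
proof -
  have int: "integral (cbox a b) g = 0" for a b
  proof -
    have sb: "set_integrable lebesgue (cbox a b) g" using g by (auto simp: loc_integrable_def)
    then have so: "set_integrable lebesgue (box a b) g"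
      by (rule set_integrable_subset) (auto simp: box_subset_cbox)
    have "(\<lambda>m. LINT x|lebesgue. g x * box_bump a b m x) \<longlonglongrightarrow> (LINT x|lebesgue. g x * indicator (box a b) x)"
    proof (rule integral_dominated_convergence[where w = "\<lambda>x. \<bar>indicator (box a b) x * g x\<bar>"])
      show "integrable lebesgue (\<lambda>x. \<bar>indicator (box a b) x * g x\<bar>)"
        using so by (simp add: set_integrable_def)
      show "(\<lambda>x. g x * indicator (box a b) x) \<in> borel_measurable lebesgue"
        using so by (simp add: set_integrable_def mult.commute integrable_iff_bounded)
      show "(\<lambda>x. g x * box_bump a b m x) \<in> borel_measurable lebesgue" for m
      proof -
        have "box_bump a b m \<in> borel_measurable lebesgue"
          using cs_continuous[OF test_cs[OF box_bump_test]]
          by (intro measurable_completion) (auto intro: borel_measurable_continuous_onI)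
        moreover have "(\<lambda>x. indicator (box a b) x * g x) \<in> borel_measurable lebesgue"
          using so by (simp add: set_integrable_def integrable_iff_bounded)
        ultimately have "(\<lambda>x. (indicator (box a b) x * g x) * box_bump a b m x) \<in> borel_measurable lebesgue"
          by simp
        moreover have "(\<lambda>x. (indicator (box a b) x * g x) * box_bump a b m x) = (\<lambda>x. g x * box_bump a b m x)"
          using box_bump_eq_0[of _ a b m] by (fastforce simp: indicator_def)
        ultimately show ?thesis by simp
      qed
      show "AE x in lebesgue. (\<lambda>m. g x * box_bump a b m x) \<longlonglongrightarrow> g x * indicator (box a b) x"
        by (intro AE_I2 tendsto_mult tendsto_const box_bump_tendsto)
      have "norm (g x * box_bump a b m x) \<le> \<bar>indicator (box a b) x * g x\<bar>" for m x
        using box_bump_bounds[of a b m x] box_bump_eq_0[of x a b m]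
        by (auto simp: indicator_def abs_mult intro: mult_left_le)
      then show "AE x in lebesgue. norm (g x * box_bump a b m x) \<le> \<bar>indicator (box a b) x * g x\<bar>" for m
        by simp
    qed
    then have "(LINT x|lebesgue. g x * indicator (box a b) x) = 0"
      using zero[OF box_bump_test] by (simp add: LIMSEQ_const_iff)
    then have "integral (box a b) g = 0"
      using set_lebesgue_integral_eq_integral(2)[OF so] by (simp add: set_lebesgue_integral_def mult.commute)
    then show ?thesis by (simp add: integral_open_interval)
  qed
  have "g integrable_on cbox a b" for a b
    using g by (intro set_lebesgue_integral_eq_integral(1)) (auto simp: loc_integrable_def)
  then obtain N where N: "negligible N"
    "\<And>x e. \<lbrakk>x \<notin> N; 0 < e\<rbrakk> \<Longrightarrow> \<exists>d>0. \<forall>h. 0 < h \<and> h < d \<longrightarrow>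
        norm (integral (cbox x (x + h *\<^sub>R One)) g /\<^sub>R h ^ DIM(real^'n) - g x) < e"
    using integrable_ccontinuous_explicit[of g] by blast
  have "g x = 0" if x: "x \<notin> N" for x
  proof (rule ccontr)
    assume "g x \<noteq> 0"
    then obtain d where d: "d > 0"
      "\<forall>h. 0 < h \<and> h < d \<longrightarrow> norm (integral (cbox x (x + h *\<^sub>R One)) g /\<^sub>R h ^ DIM(real^'n) - g x) < \<bar>g x\<bar>"
      using N(2)[OF x, of "\<bar>g x\<bar>"] by auto
    from d(2)[rule_format, of "d / 2"] d(1) show False by (simp add: int)
  qed
  then show ?thesis
    using N(1) by (intro AE_I'[of N]) (auto simp: negligible_iff_null_sets)
qed

section \<open>Completeness\<close>

text \<open>The Riesz-Fischer argument: a fast subsequence converges almost everywhere, and Fatou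
  along it carries the Cauchy estimate over to the limit.\<close>

lemma square_integrable_Cauchy_complete:
  fixes f :: "nat \<Rightarrow> 'a \<Rightarrow> real"
  assumes f: "\<And>k. square_integrable M (f k)"
    and Cauchy: "\<And>e. e > 0 \<Longrightarrow> \<exists>N. \<forall>j\<ge>N. \<forall>k\<ge>N. (\<integral>x. (f j x - f k x)\<^sup>2 \<partial>M) < e"
  obtains g where "square_integrable M g" "(\<lambda>k. \<integral>x. (f k x - g x)\<^sup>2 \<partial>M) \<longlonglongrightarrow> 0"
proof -
  have meas [measurable]: "f k \<in> borel_measurable M" for k
    using f by (simp add: square_integrable_def)
  have diff: "integrable M (\<lambda>x. (f j x - f k x)\<^sup>2)" for j k
    using square_integrable_diff[OF f f] by (simp add: square_integrable_def)
  have "\<exists>N. \<forall>j\<ge>N. \<forall>k\<ge>N. (\<integral>x. (f j x - f k x)\<^sup>2 \<partial>M) < (1 / 4) ^ i" for i :: nat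
    by (rule Cauchy) simp
  then obtain R where R: "\<And>i j k. j \<ge> R i \<Longrightarrow> k \<ge> R i \<Longrightarrow> (\<integral>x. (f j x - f k x)\<^sup>2 \<partial>M) < (1 / 4) ^ i"
    by metis
  \<comment> \<open>Partial sums make the indices monotone and at least \<open>R i\<close>; the
    added i makes them unbounded.\<close>
  define r where "r i = (\<Sum>l\<le>i. R l) + i" for i
  have r: "r i \<ge> R i" "r i \<ge> i" "r (Suc i) \<ge> r i" for i
    by (auto simp: r_def intro: trans_le_add1 member_le_sum)
  define d where "d i x = f (r (Suc i)) x - f (r i) x" for i x
  have [measurable]: "d i \<in> borel_measurable M" for i by (simp add: d_def[abs_def])
  have d: "(\<integral>\<^sup>+x. ennreal (2 ^ i * (d i x)\<^sup>2) \<partial>M) \<le> ennreal ((1 / 2) ^ i)" for i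
  proof -
    have "(\<integral>x. 2 ^ i * (d i x)\<^sup>2 \<partial>M) = 2 ^ i * (\<integral>x. (d i x)\<^sup>2 \<partial>M)" by simp
    also have "\<dots> \<le> 2 ^ i * (1 / 4) ^ i"
      unfolding d_def by (intro mult_left_mono less_imp_le[OF R] order_trans[OF r(1) r(3)] r(1)) simp
    also have "\<dots> = (1 / 2) ^ i" by (simp flip: power_mult_distrib)
    finally show ?thesis
      using diff by (subst nn_integral_eq_integral) (auto simp: d_def intro: ennreal_leI)
  qed
  have "(\<integral>\<^sup>+x. (\<Sum>i. ennreal (2 ^ i * (d i x)\<^sup>2)) \<partial>M) = (\<Sum>i. \<integral>\<^sup>+x. ennreal (2 ^ i * (d i x)\<^sup>2) \<partial>M)"
    by (rule nn_integral_suminf) simp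
  also have "\<dots> \<le> (\<Sum>i. ennreal ((1 / 2) ^ i))"
    by (intro suminf_le d) auto
  also have "\<dots> = ennreal (\<Sum>i. (1 / 2) ^ i)"
    by (rule suminf_ennreal2) (auto intro: summable_geometric)
  also have "\<dots> < \<infinity>" by simp
  finally have "AE x in M. (\<Sum>i. ennreal (2 ^ i * (d i x)\<^sup>2)) \<noteq> \<infinity>"
    by (intro nn_integral_PInf_AE) auto
  then have conv: "AE x in M. convergent (\<lambda>i. f (r i) x)"
  proof eventually_elim
    case (elim x)
    then have 1: "summable (\<lambda>i. 2 ^ i * (d i x)\<^sup>2)"
      by (intro summable_suminf_not_top) auto
    \<comment> \<open>From 2 s <= s^2 + 1 with s = 2^i |d|. Squared increments below 4^(-i) remain
      summable with the weight 2^i, which makes the increments themselves summable.\<close>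
    have bound: "norm (d i x) \<le> 2 ^ i * (d i x)\<^sup>2 + (1 / 2) ^ i" for i
    proof -
      have "0 \<le> (2 ^ i * \<bar>d i x\<bar> - 1)\<^sup>2" by simp
      then have "2 * (2 ^ i * \<bar>d i x\<bar>) \<le> (2 ^ i * \<bar>d i x\<bar>)\<^sup>2 + 1" by (simp add: power2_diff)
      also have "\<dots> = 2 ^ i * (2 ^ i * (d i x)\<^sup>2 + (1 / 2) ^ i)"
      proof -
        have p: "2 ^ i * (1 / 2) ^ i = (1::real)" by (simp flip: power_mult_distrib)
        show ?thesis
          by (simp only: p power_mult_distrib power2_abs distrib_left) (simp add: power2_eq_square)
      qed
      finally have "2 * \<bar>d i x\<bar> \<le> 2 ^ i * (d i x)\<^sup>2 + (1 / 2) ^ i"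
        by (simp add: mult.left_commute[of 2] mult_le_cancel_left_pos)
      then show ?thesis by simp
    qed
    have "summable (\<lambda>i. d i x)"
      by (rule summable_comparison_test'[where N = 0, OF summable_add[OF 1 summable_geometric[of "1 / 2"]]])
        (use bound in auto)
    then have "convergent (\<lambda>n. \<Sum>i<n. d i x)" by (simp add: summable_iff_convergent)
    moreover have "(\<Sum>i<n. d i x) = f (r n) x - f (r 0) x" for n
      unfolding d_def by (rule sum_lessThan_telescope)
    ultimately have "convergent (\<lambda>n. f (r 0) x + (f (r n) x - f (r 0) x))"
      by (intro convergent_add convergent_const) simp
    then show ?case by simp
  qed
  define g where "g x = lim (\<lambda>i. f (r i) x)" for x
  have [measurable]: "g \<in> borel_measurable M"
    unfolding g_def[abs_def] by (intro borel_measurable_lim_metric) simp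
  have limg: "AE x in M. (\<lambda>i. f (r i) x) \<longlonglongrightarrow> g x"
    using conv by eventually_elim (simp add: g_def convergent_LIMSEQ_iff)
  have fatou: "(\<integral>\<^sup>+x. ennreal ((f k x - g x)\<^sup>2) \<partial>M) \<le> ennreal e"
    if e: "\<And>i. i \<ge> N \<Longrightarrow> (\<integral>x. (f k x - f (r i) x)\<^sup>2 \<partial>M) \<le> e" for k e N
  proof -
    have "(\<integral>\<^sup>+x. ennreal ((f k x - g x)\<^sup>2) \<partial>M) = (\<integral>\<^sup>+x. liminf (\<lambda>i. ennreal ((f k x - f (r i) x)\<^sup>2)) \<partial>M)"
    proof (rule nn_integral_cong_AE)
      show "AE x in M. ennreal ((f k x - g x)\<^sup>2) = liminf (\<lambda>i. ennreal ((f k x - f (r i) x)\<^sup>2))"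
        using limg
      proof eventually_elim
        case (elim x)
        have "(\<lambda>i. ennreal ((f k x - f (r i) x)\<^sup>2)) \<longlonglongrightarrow> ennreal ((f k x - g x)\<^sup>2)"
          by (intro tendsto_intros elim)
        from lim_imp_Liminf[OF trivial_limit_sequentially this] show ?case by (rule sym)
      qed
    qed
    also have "\<dots> \<le> liminf (\<lambda>i. \<integral>\<^sup>+x. ennreal ((f k x - f (r i) x)\<^sup>2) \<partial>M)"
      by (rule nn_integral_liminf) simp
    also have "\<dots> \<le> liminf (\<lambda>i. ennreal e)"
      using eventually_ge_at_top[of N]
      by (intro Liminf_mono, elim eventually_mono)
        (auto simp: nn_integral_eq_integral[OF diff] intro!: ennreal_leI e)
    also have "\<dots> = ennreal e" by (simp add: Liminf_const)
    finally show ?thesis .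
  qed
  have small: "\<exists>N. \<forall>k\<ge>N. integrable M (\<lambda>x. (f k x - g x)\<^sup>2) \<and> (\<integral>x. (f k x - g x)\<^sup>2 \<partial>M) \<le> e" if pos: "e > 0" for e
  proof -
    obtain N where N: "\<And>j k. j \<ge> N \<Longrightarrow> k \<ge> N \<Longrightarrow> (\<integral>x. (f j x - f k x)\<^sup>2 \<partial>M) < e"
      using Cauchy[OF pos] by blast
    have "integrable M (\<lambda>x. (f k x - g x)\<^sup>2) \<and> (\<integral>x. (f k x - g x)\<^sup>2 \<partial>M) \<le> e" if k: "k \<ge> N" for k
    proof -
      have le: "(\<integral>\<^sup>+x. ennreal ((f k x - g x)\<^sup>2) \<partial>M) \<le> ennreal e"
        by (rule fatou[of N]) (use N k r(2) in \<open>meson less_imp_le order_trans\<close>)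
      then have i: "integrable M (\<lambda>x. (f k x - g x)\<^sup>2)"
        by (intro integrableI_nonneg) (auto intro: le_less_trans)
      then show ?thesis
        using le \<open>e > 0\<close> by (simp add: nn_integral_eq_integral)
    qed
    then show ?thesis by blast
  qed
  show thesis
  proof
    obtain k where k: "integrable M (\<lambda>x. (f k x - g x)\<^sup>2)" using small[of 1] by auto
    have "square_integrable M (\<lambda>x. f k x - (f k x - g x))"
      by (rule square_integrable_diff[OF f]) (simp add: square_integrable_def k)
    then show "square_integrable M g" by simp
    show "(\<lambda>k. \<integral>x. (f k x - g x)\<^sup>2 \<partial>M) \<longlonglongrightarrow> 0"
    proof (rule LIMSEQ_I)
      fix e :: real assume "e > 0"
      then obtain N where N: "\<And>k. k \<ge> N \<Longrightarrow> (\<integral>x. (f k x - g x)\<^sup>2 \<partial>M) \<le> e / 2"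
        using small[of "e / 2"] by auto
      have "norm ((\<integral>x. (f k x - g x)\<^sup>2 \<partial>M) - 0) < e" if "k \<ge> N" for k
      proof -
        have "(\<integral>x. (f k x - g x)\<^sup>2 \<partial>M) < e" using N[OF that] \<open>e > 0\<close> by linarith
        then show ?thesis by simp
      qed
      then show "\<exists>N. \<forall>k\<ge>N. norm ((\<integral>x. (f k x - g x)\<^sup>2 \<partial>M) - 0) < e" by blast
    qed
  qed
qed

lemma
  assumes f: "\<And>k. square_integrable M (f k)" and g: "square_integrable M g"
    and lim: "(\<lambda>k. \<integral>x. (f k x - g x)\<^sup>2 \<partial>M) \<longlonglongrightarrow> 0"
  shows tendsto_integral_mult_square_integrable:
      "square_integrable M h \<Longrightarrow> (\<lambda>k. \<integral>x. f k x * h x \<partial>M) \<longlonglongrightarrow> (\<integral>x. g x * h x \<partial>M)"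
    and tendsto_integral_power2: "(\<lambda>k. \<integral>x. (f k x)\<^sup>2 \<partial>M) \<longlonglongrightarrow> (\<integral>x. (g x)\<^sup>2 \<partial>M)"
proof -
  have fg: "square_integrable M (\<lambda>x. f k x - g x)" for k by (rule square_integrable_diff[OF f g])
  have 0: "(\<lambda>k. \<integral>x. (f k x - g x) * h x \<partial>M) \<longlonglongrightarrow> 0" if h: "square_integrable M h" for h
  proof (rule tendsto_rabs_zero_cancel, rule tendsto_sandwich[where f = "\<lambda>_. 0"])
    show "\<forall>\<^sub>F k in sequentially. \<bar>\<integral>x. (f k x - g x) * h x \<partial>M\<bar> \<le> sqrt ((\<integral>x. (f k x - g x)\<^sup>2 \<partial>M) * (\<integral>x. (h x)\<^sup>2 \<partial>M))"
      by (intro always_eventually allI real_le_rsqrt) (simp add: integral_Cauchy_Schwarz[OF fg h])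
    have "(\<lambda>k. sqrt ((\<integral>x. (f k x - g x)\<^sup>2 \<partial>M) * (\<integral>x. (h x)\<^sup>2 \<partial>M))) \<longlonglongrightarrow> sqrt (0 * (\<integral>x. (h x)\<^sup>2 \<partial>M))"
      by (intro tendsto_intros lim)
    then show "(\<lambda>k. sqrt ((\<integral>x. (f k x - g x)\<^sup>2 \<partial>M) * (\<integral>x. (h x)\<^sup>2 \<partial>M))) \<longlonglongrightarrow> 0" by simp
  qed auto
  have int: "integrable M (\<lambda>x. f k x * h x)" "integrable M (\<lambda>x. g x * h x)" if "square_integrable M h" for h k
    using that f g by (auto intro: integrable_mult_square_integrable)
  show "(\<lambda>k. \<integral>x. f k x * h x \<partial>M) \<longlonglongrightarrow> (\<integral>x. g x * h x \<partial>M)" if h: "square_integrable M h" for h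
  proof -
    have "(\<lambda>k. (\<integral>x. (f k x - g x) * h x \<partial>M) + (\<integral>x. g x * h x \<partial>M)) \<longlonglongrightarrow> 0 + (\<integral>x. g x * h x \<partial>M)"
      by (intro tendsto_add 0 h tendsto_const)
    then show ?thesis using int[OF h] by (simp add: left_diff_distrib)
  qed
  have "(\<lambda>k. (\<integral>x. (f k x - g x)\<^sup>2 \<partial>M) + 2 * (\<integral>x. (f k x - g x) * g x \<partial>M) + (\<integral>x. (g x)\<^sup>2 \<partial>M))
      \<longlonglongrightarrow> 0 + 2 * 0 + (\<integral>x. (g x)\<^sup>2 \<partial>M)"
    by (intro tendsto_add tendsto_mult tendsto_const lim 0 g)
  then show "(\<lambda>k. \<integral>x. (f k x)\<^sup>2 \<partial>M) \<longlonglongrightarrow> (\<integral>x. (g x)\<^sup>2 \<partial>M)"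
    using integral_add_power2[OF fg g] by simp
qed

section \<open>Weak derivatives in the completion\<close>

lemma integral_lebesgue_continuous:
  fixes f :: "'a::euclidean_space \<Rightarrow> real"
  shows "continuous_on UNIV f \<Longrightarrow> integral\<^sup>L lebesgue f = integral\<^sup>L lborel f"
  by (intro integral_completion) (auto intro: borel_measurable_continuous_onI)

lemma measurable_lebesgue_continuous:
  fixes f :: "'a::euclidean_space \<Rightarrow> real"
  shows "continuous_on UNIV f \<Longrightarrow> f \<in> borel_measurable lebesgue"
  by (intro measurable_completion) (auto intro: borel_measurable_continuous_onI)

lemma square_integrable_completion:
  "square_integrable lborel f \<Longrightarrow> square_integrable lebesgue f"
  by (auto simp: square_integrable_def integrable_completion intro: measurable_completion)

lemma test_square_integrable: "f \<in> test_functions \<Longrightarrow> square_integrable lebesgue f"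
  by (intro square_integrable_completion cs_square_integrable test_cs)

lemma square_integrable_loc_integrable:
  assumes "square_integrable lebesgue f"
  shows "loc_integrable f"
  unfolding loc_integrable_def set_integrable_def
proof (intro allI impI)
  fix K :: "(real^'a) set" assume "compact K"
  then have "integrable lebesgue (indicator K :: _ \<Rightarrow> real)"
    using lmeasurable_compact lmeasurable_iff_integrable by blast
  then have "square_integrable lebesgue (indicator K :: _ \<Rightarrow> real)"
    by (auto simp: square_integrable_def power2_eq_square simp flip: indicator_inter_arith)
  then have "integrable lebesgue (\<lambda>x. indicator K x * f x)"
    by (rule integrable_mult_square_integrable[OF _ assms])
  then show "integrable lebesgue (\<lambda>x. indicator K x *\<^sub>R f x)" by simp
qed

lemma loc_integrable_measurable:
  fixes f :: "real^'n \<Rightarrow> real"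
  assumes "loc_integrable f"
  shows "f \<in> borel_measurable lebesgue"
proof (rule borel_measurable_LIMSEQ_real)
  show "(\<lambda>x. indicator (cball 0 (real n)) x *\<^sub>R f x) \<in> borel_measurable lebesgue" for n
    using assms unfolding loc_integrable_def set_integrable_def
    by (intro borel_measurable_integrable) (blast intro: compact_cball)
  fix x :: "real^'n"
  obtain n where n: "norm x \<le> real n" using real_arch_simple by blast
  show "(\<lambda>n. indicator (cball 0 (real n)) x *\<^sub>R f x) \<longlonglongrightarrow> f x"
    by (rule tendsto_eventually)
      (use n in \<open>auto simp: eventually_sequentially indicator_def intro!: exI[of _ n]\<close>)
qed

lemma integrable_loc_integrable_mult_test:
  fixes g :: "real^'n \<Rightarrow> real"
  assumes g: "loc_integrable g" and \<psi>: "\<psi> \<in> test_functions"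
  shows "integrable lebesgue (\<lambda>x. g x * \<psi> x)"
proof -
  obtain K where K: "compact K" "\<And>x. x \<notin> K \<Longrightarrow> \<psi> x = 0"
    using test_cs[OF \<psi>] by (auto simp: compactly_supported_def)
  have cont: "continuous_on UNIV \<psi>" by (rule cs_continuous[OF test_cs[OF \<psi>]])
  obtain C where C: "\<And>x. x \<in> K \<Longrightarrow> \<bar>\<psi> x\<bar> \<le> C"
    using compact_imp_bounded[OF compact_continuous_image[OF continuous_on_subset[OF cont] K(1)]]
    by (auto simp: bounded_iff)
  have "integrable lebesgue (\<lambda>x. C * \<bar>indicator K x * g x\<bar>)"
    using g K(1) by (auto simp: loc_integrable_def set_integrable_def)
  then show ?thesis
  proof (rule Bochner_Integration.integrable_bound)
    show "(\<lambda>x. g x * \<psi> x) \<in> borel_measurable lebesgue"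
      using loc_integrable_measurable[OF g] measurable_lebesgue_continuous[OF cont] by simp
    have "norm (g x * \<psi> x) \<le> norm (C * \<bar>indicator K x * g x\<bar>)" for x
    proof (cases "x \<in> K")
      case True
      have "\<bar>g x\<bar> * \<bar>\<psi> x\<bar> \<le> \<bar>g x\<bar> * \<bar>C\<bar>"
        using C[OF True] by (intro mult_left_mono) auto
      then show ?thesis using True by (simp add: abs_mult mult.commute)
    qed (simp add: K)
    then show "AE x in lebesgue. norm (g x * \<psi> x) \<le> norm (C * \<bar>indicator K x * g x\<bar>)" by simp
  qed
qed

lemma loc_integrable_AE_unique:
  fixes g h :: "real^'n \<Rightarrow> real"
  assumes g: "loc_integrable g" and h: "loc_integrable h"
    and eq: "\<And>\<psi>. \<psi> \<in> test_functions \<Longrightarrow> (LINT x|lebesgue. g x * \<psi> x) = (LINT x|lebesgue. h x * \<psi> x)"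
  shows "AE x in lebesgue. g x = h x"
proof -
  have "AE x in lebesgue. g x - h x = 0"
  proof (rule fundamental_lemma)
    show "loc_integrable (\<lambda>x. g x - h x)"
      using g h by (auto simp: loc_integrable_def intro: set_integral_diff)
    show "(LINT x|lebesgue. (g x - h x) * \<psi> x) = 0" if "\<psi> \<in> test_functions" for \<psi>
      using integrable_loc_integrable_mult_test[OF g that] integrable_loc_integrable_mult_test[OF h that] eq[OF that]
      by (simp add: left_diff_distrib)
  qed
  then show ?thesis by simp
qed

lemma has_weak_gradD:
  assumes "has_weak_grad u G"
  shows "loc_integrable (\<lambda>x. G x $ i)"
    and "\<psi> \<in> test_functions \<Longrightarrow>
      (LINT x|lebesgue. u x * partial i \<psi> x) = - (LINT x|lebesgue. G x $ i * \<psi> x)"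
  using assms unfolding has_weak_grad_def by blast+

lemma has_weak_laplacianD:
  assumes "has_weak_laplacian u L"
  shows "loc_integrable L"
    and "\<psi> \<in> test_functions \<Longrightarrow>
      (LINT x|lebesgue. u x * laplacian \<psi> x) = (LINT x|lebesgue. L x * \<psi> x)"
  using assms unfolding has_weak_laplacian_def by blast+

text \<open>The choice returns some weak gradient as soon as one exists, and any two agree off a
  null set by the fundamental lemma; local integrability makes the chosen one measurable.\<close>

lemma weak_grad_AE:
  fixes u :: "real^'n \<Rightarrow> real"
  assumes G: "has_weak_grad u G"
  shows "AE x in lebesgue. weak_grad u x = G x"
    and "(\<lambda>x. weak_grad u x $ i) \<in> borel_measurable lebesgue"
proof -
  have w: "has_weak_grad u (weak_grad u)"
    unfolding weak_grad_def by (rule someI[of "has_weak_grad u", OF G])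
  have "AE x in lebesgue. weak_grad u x $ i = G x $ i" for i
  proof (rule loc_integrable_AE_unique[OF has_weak_gradD(1)[OF w] has_weak_gradD(1)[OF G]])
    show "(LINT x|lebesgue. weak_grad u x $ i * \<psi> x) = (LINT x|lebesgue. G x $ i * \<psi> x)"
      if "\<psi> \<in> test_functions" for \<psi>
      using has_weak_gradD(2)[OF w that, of i] has_weak_gradD(2)[OF G that, of i] by linarith
  qed
  then have "AE x in lebesgue. \<forall>i\<in>UNIV. weak_grad u x $ i = G x $ i"
    by (subst AE_finite_all) auto
  then show "AE x in lebesgue. weak_grad u x = G x" by (simp add: vec_eq_iff)
  show "(\<lambda>x. weak_grad u x $ i) \<in> borel_measurable lebesgue"
    by (rule loc_integrable_measurable[OF has_weak_gradD(1)[OF w]])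
qed

lemma weak_laplacian_AE:
  fixes u :: "real^'n \<Rightarrow> real"
  assumes L: "has_weak_laplacian u L"
  shows "AE x in lebesgue. weak_laplacian u x = L x"
    and "weak_laplacian u \<in> borel_measurable lebesgue"
proof -
  have w: "has_weak_laplacian u (weak_laplacian u)"
    unfolding weak_laplacian_def by (rule someI[of "has_weak_laplacian u", OF L])
  show "AE x in lebesgue. weak_laplacian u x = L x"
  proof (rule loc_integrable_AE_unique[OF has_weak_laplacianD(1)[OF w] has_weak_laplacianD(1)[OF L]])
    show "(LINT x|lebesgue. weak_laplacian u x * \<psi> x) = (LINT x|lebesgue. L x * \<psi> x)"
      if "\<psi> \<in> test_functions" for \<psi>
      using has_weak_laplacianD(2)[OF w that] has_weak_laplacianD(2)[OF L that] by linarith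
  qed
  show "weak_laplacian u \<in> borel_measurable lebesgue"
    by (rule loc_integrable_measurable[OF has_weak_laplacianD(1)[OF w]])
qed

lemma norm_power2_vec: "(norm (x :: real^'n))\<^sup>2 = (\<Sum>i\<in>UNIV. (x $ i)\<^sup>2)"
  unfolding power2_norm_eq_inner by (simp add: inner_vec_def power2_eq_square)

lemma laplacian_test:
  assumes "f \<in> test_functions"
  shows "continuous_on UNIV (laplacian f)" "square_integrable lebesgue (laplacian f)"
proof -
  have "compactly_supported (\<lambda>x. \<Sum>i\<in>UNIV. partial i (partial i f) x)"
    by (intro cs_sum test_cs partial_test assms)
  then show "continuous_on UNIV (laplacian f)" "square_integrable lebesgue (laplacian f)"
    unfolding laplacian_def[abs_def]
    by (auto intro: cs_continuous square_integrable_completion cs_square_integrable)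
qed

lemma H_norm_test:
  fixes f :: "real^'n \<Rightarrow> real"
  assumes f: "f \<in> test_functions"
  shows "(H_norm f)\<^sup>2 = integral\<^sup>L lborel (\<lambda>x. (\<Sum>j\<in>UNIV. partial j (partial j f) x)\<^sup>2)
    + (\<Sum>j\<in>UNIV. \<Sum>k\<in>UNIV. integral\<^sup>L lborel (\<lambda>x. (x $ k)\<^sup>2 * (partial j f x)\<^sup>2))"
proof -
  have cs: "compactly_supported (partial j f)" for j by (intro test_cs partial_test f)
  have cont: "continuous_on UNIV (partial j f)" for j by (rule cs_continuous[OF cs])
  have "(LINT x|lebesgue. (laplacian f x)\<^sup>2) = integral\<^sup>L lborel (\<lambda>x. (\<Sum>j\<in>UNIV. partial j (partial j f) x)\<^sup>2)"
    using laplacian_test(1)[OF f]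
    by (subst integral_lebesgue_continuous) (auto intro!: continuous_intros simp: laplacian_def)
  moreover have "(LINT x|lebesgue. (norm (grad f x))\<^sup>2 * (norm x)\<^sup>2)
      = (\<Sum>j\<in>UNIV. \<Sum>k\<in>UNIV. integral\<^sup>L lborel (\<lambda>x. (x $ k)\<^sup>2 * (partial j f x)\<^sup>2))"
  proof -
    have eq: "(\<lambda>x. (norm (grad f x))\<^sup>2 * (norm x)\<^sup>2) = (\<lambda>x. \<Sum>j\<in>UNIV. \<Sum>k\<in>UNIV. (x $ k)\<^sup>2 * (partial j f x)\<^sup>2)"
      unfolding norm_power2_vec sum_product by (simp add: grad_def mult.commute)
    have c: "compactly_supported (\<lambda>x. (x $ k)\<^sup>2 * (partial j f x)\<^sup>2)" for j k
      by (intro cs_mult_right cs_power2 cs continuous_intros)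
    have "(LINT x|lebesgue. (norm (grad f x))\<^sup>2 * (norm x)\<^sup>2)
        = integral\<^sup>L lborel (\<lambda>x. \<Sum>j\<in>UNIV. \<Sum>k\<in>UNIV. (x $ k)\<^sup>2 * (partial j f x)\<^sup>2)"
      unfolding eq by (intro integral_lebesgue_continuous continuous_intros cont)
    also have "\<dots> = (\<Sum>j\<in>UNIV. integral\<^sup>L lborel (\<lambda>x. \<Sum>k\<in>UNIV. (x $ k)\<^sup>2 * (partial j f x)\<^sup>2))"
      by (intro Bochner_Integration.integral_sum cs_integrable cs_sum c)
    also have "\<dots> = (\<Sum>j\<in>UNIV. \<Sum>k\<in>UNIV. integral\<^sup>L lborel (\<lambda>x. (x $ k)\<^sup>2 * (partial j f x)\<^sup>2))"
      by (intro sum.cong refl Bochner_Integration.integral_sum cs_integrable c)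
    finally show ?thesis .
  qed
  ultimately show ?thesis unfolding H_norm_def by (simp add: sum_nonneg)
qed

text \<open>The norm contains no unweighted gradient, but nonnegativity of the energy at b = 1
  bounds it by the two terms that are present. The weighted part is thus counted twice, hence the
  factor 2.\<close>

lemma weighted_partial_le_H_norm:
  fixes f :: "real^'n \<Rightarrow> real"
  assumes f: "f \<in> test_functions"
  shows "(LINT x|lebesgue. (sqrt (1 + (norm x)\<^sup>2) * partial i f x)\<^sup>2) \<le> 2 * (H_norm f)\<^sup>2"
proof -
  define P where "P = integral\<^sup>L lborel (\<lambda>x. (\<Sum>j\<in>UNIV. partial j (partial j f) x)\<^sup>2)"
  define W where "W j k = integral\<^sup>L lborel (\<lambda>x. (x $ k)\<^sup>2 * (partial j f x)\<^sup>2)" for j k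
  define N where "N j = integral\<^sup>L lborel (\<lambda>x. (partial j f x)\<^sup>2)" for j
  have nn: "0 \<le> P" "0 \<le> W j k" "0 \<le> N j" for j k by (simp_all add: P_def W_def N_def)
  have N_le: "(\<Sum>j\<in>UNIV. N j) \<le> P + (\<Sum>j\<in>UNIV. \<Sum>k\<in>UNIV. W j k)"
  proof -
    have "0 \<le> P + (\<Sum>j\<in>UNIV. \<Sum>k\<in>UNIV. W j k) - (real CARD('n) + 2) * (\<Sum>j\<in>UNIV. N j)"
      using energy_nonneg[OF f, of 1] by (simp add: P_def W_def N_def)
    moreover have "1 * (\<Sum>j\<in>UNIV. N j) \<le> (real CARD('n) + 2) * (\<Sum>j\<in>UNIV. N j)"
      by (intro mult_right_mono sum_nonneg nn) auto
    ultimately show ?thesis by simp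
  qed
  have cs: "compactly_supported (partial i f)" by (intro test_cs partial_test f)
  have cont: "continuous_on UNIV (partial i f)" by (rule cs_continuous[OF cs])
  have c: "compactly_supported (\<lambda>x. (x $ k)\<^sup>2 * (partial i f x)\<^sup>2)" for k
    by (intro cs_mult_right cs_power2 cs continuous_intros)
  have eq: "(sqrt (1 + (norm x)\<^sup>2) * partial i f x)\<^sup>2
      = (partial i f x)\<^sup>2 + (\<Sum>k\<in>UNIV. (x $ k)\<^sup>2 * (partial i f x)\<^sup>2)" for x
    by (simp add: power_mult_distrib norm_power2_vec[symmetric] sum_distrib_right[symmetric] distrib_right)
  have "(LINT x|lebesgue. (sqrt (1 + (norm x)\<^sup>2) * partial i f x)\<^sup>2)
      = integral\<^sup>L lborel (\<lambda>x. (partial i f x)\<^sup>2 + (\<Sum>k\<in>UNIV. (x $ k)\<^sup>2 * (partial i f x)\<^sup>2))"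
    unfolding eq by (intro integral_lebesgue_continuous continuous_intros cont)
  also have "\<dots> = N i + (\<Sum>k\<in>UNIV. W i k)"
    unfolding N_def W_def
    by (subst cs_integral_add) (auto intro!: cs_power2 cs_sum cs c Bochner_Integration.integral_sum cs_integrable)
  also have "\<dots> \<le> (\<Sum>j\<in>UNIV. N j) + (\<Sum>j\<in>UNIV. \<Sum>k\<in>UNIV. W j k)"
    by (intro add_mono member_le_sum[of i UNIV N] member_le_sum[of i UNIV "\<lambda>j. \<Sum>k\<in>UNIV. W j k"])
      (auto intro!: sum_nonneg nn)
  also have "\<dots> \<le> (P + (\<Sum>j\<in>UNIV. \<Sum>k\<in>UNIV. W j k)) + (\<Sum>j\<in>UNIV. \<Sum>k\<in>UNIV. W j k)"
    by (intro add_right_mono N_le)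
  finally show ?thesis
    unfolding H_norm_test[OF f, folded P_def W_def] using nn(1) by (simp add: algebra_simps)
qed

lemma tendsto_square_integrable_mult_bounded:
  assumes f: "\<And>k. square_integrable M (f k)" and g: "square_integrable M g"
    and lim: "(\<lambda>k. \<integral>x. (f k x - g x)\<^sup>2 \<partial>M) \<longlonglongrightarrow> 0"
    and h: "h \<in> borel_measurable M" "\<And>x. \<bar>h x\<bar> \<le> 1"
  shows "square_integrable M (\<lambda>x. h x * g x)"
    and "(\<lambda>k. \<integral>x. (h x * f k x - h x * g x)\<^sup>2 \<partial>M) \<longlonglongrightarrow> 0"
proof -
  have le: "\<bar>h x * c\<bar> \<le> \<bar>c\<bar>" for x c
    using mult_right_mono[OF h(2), of "\<bar>c\<bar>" x] by (simp add: abs_mult)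
  have sq: "square_integrable M (\<lambda>x. h x * F x)" if "square_integrable M F" for F
    using that h(1) le by (intro square_integrable_bound[OF that]) (auto simp: square_integrable_def)
  show "square_integrable M (\<lambda>x. h x * g x)" by (rule sq[OF g])
  show "(\<lambda>k. \<integral>x. (h x * f k x - h x * g x)\<^sup>2 \<partial>M) \<longlonglongrightarrow> 0"
  proof (rule tendsto_sandwich[OF _ _ tendsto_const lim])
    show "\<forall>\<^sub>F k in sequentially. (\<integral>x. (h x * f k x - h x * g x)\<^sup>2 \<partial>M) \<le> (\<integral>x. (f k x - g x)\<^sup>2 \<partial>M)"
    proof (intro always_eventually allI integral_mono)
      fix k
      have d: "square_integrable M (\<lambda>x. f k x - g x)" by (rule square_integrable_diff[OF f g])
      show "integrable M (\<lambda>x. (f k x - g x)\<^sup>2)" using d by (simp add: square_integrable_def)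
      show "integrable M (\<lambda>x. (h x * f k x - h x * g x)\<^sup>2)"
        using sq[OF d] by (simp add: square_integrable_def right_diff_distrib)
      show "(h x * f k x - h x * g x)\<^sup>2 \<le> (f k x - g x)\<^sup>2" for x
        using le[of x "f k x - g x"] by (simp add: right_diff_distrib abs_le_square_iff)
    qed
  qed simp
qed

lemma H2_0m2_limits:
  fixes u :: "real^'n \<Rightarrow> real"
  assumes u: "u \<in> H2_0m2"
  obtains \<phi> :: "nat \<Rightarrow> real^'n \<Rightarrow> real" and L :: "real^'n \<Rightarrow> real" and G :: "real^'n \<Rightarrow> real^'n"
  where "\<And>k. \<phi> k \<in> test_functions"
    and "square_integrable lebesgue u" "(\<lambda>k. LINT x|lebesgue. (\<phi> k x - u x)\<^sup>2) \<longlonglongrightarrow> 0"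
    and "square_integrable lebesgue L" "(\<lambda>k. LINT x|lebesgue. (laplacian (\<phi> k) x - L x)\<^sup>2) \<longlonglongrightarrow> 0"
    and "\<And>i. square_integrable lebesgue (\<lambda>x. G x $ i)"
      "\<And>i. (\<lambda>k. LINT x|lebesgue. (partial i (\<phi> k) x - G x $ i)\<^sup>2) \<longlonglongrightarrow> 0"
    and "\<And>i j. square_integrable lebesgue (\<lambda>x. x $ j * G x $ i)"
      "\<And>i j. (\<lambda>k. LINT x|lebesgue. (x $ j * partial i (\<phi> k) x - x $ j * G x $ i)\<^sup>2) \<longlonglongrightarrow> 0"
proof -
  obtain \<phi> :: "nat \<Rightarrow> real^'n \<Rightarrow> real" where \<phi>: "\<And>k. \<phi> k \<in> test_functions"
    and Cauchy: "\<And>e. e > 0 \<Longrightarrow> \<exists>N. \<forall>j\<ge>N. \<forall>k\<ge>N. H_norm (\<lambda>x. \<phi> j x - \<phi> k x) < e"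
    and iu: "\<And>k. integrable lebesgue (\<lambda>x. (\<phi> k x - u x)\<^sup>2)"
    and lu: "(\<lambda>k. LINT x|lebesgue. (\<phi> k x - u x)\<^sup>2) \<longlonglongrightarrow> 0"
    using u unfolding H2_0m2_def by blast
  have mu: "u \<in> borel_measurable lebesgue" using u by (simp add: H2_0m2_def)
  have su: "square_integrable lebesgue u"
  proof -
    have "square_integrable lebesgue (\<lambda>x. \<phi> 0 x - u x)"
      using iu[of 0] borel_measurable_diff[OF square_integrable_measurable[OF test_square_integrable[OF \<phi>]] mu]
      by (simp add: square_integrable_def)
    from square_integrable_diff[OF test_square_integrable[OF \<phi>[of 0]] this] show ?thesis by simp
  qed
  have d1: "partial i (\<lambda>x. \<phi> j x - \<phi> k x) = (\<lambda>x. partial i (\<phi> j) x - partial i (\<phi> k) x)" for i j k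
    by (rule ext) (intro partial_diff test_differentiable \<phi>)
  have d2: "partial i (\<lambda>x. partial i (\<phi> j) x - partial i (\<phi> k) x) x
      = partial i (partial i (\<phi> j)) x - partial i (partial i (\<phi> k)) x" for i j k x
    by (intro partial_diff test_differentiable partial_test \<phi>)
  have dl: "laplacian (\<lambda>x. \<phi> j x - \<phi> k x) x = laplacian (\<phi> j) x - laplacian (\<phi> k) x" for j k x
    by (simp add: laplacian_def d1 d2 sum_subtractf)
  have \<psi>: "(\<lambda>x. \<phi> j x - \<phi> k x) \<in> test_functions" for j k by (intro test_diff \<phi>)
  have Cauchy2: "\<exists>N. \<forall>j\<ge>N. \<forall>k\<ge>N. 2 * (H_norm (\<lambda>x. \<phi> j x - \<phi> k x))\<^sup>2 < e" if "e > 0" for e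
  proof -
    obtain N where N: "\<And>j k. j \<ge> N \<Longrightarrow> k \<ge> N \<Longrightarrow> H_norm (\<lambda>x. \<phi> j x - \<phi> k x) < sqrt (e / 2)"
      using Cauchy[of "sqrt (e / 2)"] \<open>e > 0\<close> by auto
    have "2 * (H_norm (\<lambda>x. \<phi> j x - \<phi> k x))\<^sup>2 < e" if "j \<ge> N" "k \<ge> N" for j k
    proof -
      have "(H_norm (\<lambda>x. \<phi> j x - \<phi> k x))\<^sup>2 < (sqrt (e / 2))\<^sup>2"
        using N[OF that] by (intro power_strict_mono) (auto simp: H_norm_def)
      then show ?thesis using \<open>e > 0\<close> by simp
    qed
    then show ?thesis by blast
  qed
  obtain L where L: "square_integrable lebesgue L"
    "(\<lambda>k. LINT x|lebesgue. (laplacian (\<phi> k) x - L x)\<^sup>2) \<longlonglongrightarrow> 0"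
  proof (rule square_integrable_Cauchy_complete)
    show "square_integrable lebesgue (laplacian (\<phi> k))" for k by (rule laplacian_test(2)[OF \<phi>])
    have "(LINT x|lebesgue. (laplacian (\<phi> j) x - laplacian (\<phi> k) x)\<^sup>2) \<le> 2 * (H_norm (\<lambda>x. \<phi> j x - \<phi> k x))\<^sup>2" for j k
    proof -
      have "(LINT x|lebesgue. (laplacian (\<phi> j) x - laplacian (\<phi> k) x)\<^sup>2) \<le> (H_norm (\<lambda>x. \<phi> j x - \<phi> k x))\<^sup>2"
        unfolding dl[symmetric] H_norm_def by simp
      also have "\<dots> \<le> 2 * (H_norm (\<lambda>x. \<phi> j x - \<phi> k x))\<^sup>2" by simp
      finally show ?thesis .
    qed
    then show "\<exists>N. \<forall>j\<ge>N. \<forall>k\<ge>N. (LINT x|lebesgue. (laplacian (\<phi> j) x - laplacian (\<phi> k) x)\<^sup>2) < e" if "e > 0" for e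
      using Cauchy2[OF that] by (blast intro: le_less_trans)
  qed
  \<comment> \<open>One weight serves for both convergences: from the limit V of w times the
    derivative, the bounded multipliers 1 / w and x_j / w produce the limits of the derivative and
    of x_j times it, which are thereby compatible.\<close>
  define w where "w x = sqrt (1 + (norm x)\<^sup>2)" for x :: "real^'n"
  have w: "w x \<ge> 1" "w x > 0" "w x \<noteq> 0" for x
  proof -
    show "w x \<ge> 1" by (simp add: w_def)
    then show "w x > 0" by linarith
    then show "w x \<noteq> 0" by simp
  qed
  have contw: "continuous_on UNIV w" unfolding w_def by (intro continuous_intros)
  have wp: "square_integrable lebesgue (\<lambda>x. w x * partial i (\<phi> k) x)" for i k
    by (intro square_integrable_completion cs_square_integrable cs_mult_right contw test_cs partial_test \<phi>)
  have "\<forall>i. \<exists>V. square_integrable lebesgue V \<and> (\<lambda>k. LINT x|lebesgue. (w x * partial i (\<phi> k) x - V x)\<^sup>2) \<longlonglongrightarrow> 0"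
  proof
    fix i
    obtain V where "square_integrable lebesgue V"
      "(\<lambda>k. LINT x|lebesgue. (w x * partial i (\<phi> k) x - V x)\<^sup>2) \<longlonglongrightarrow> 0"
    proof (rule square_integrable_Cauchy_complete)
      show "square_integrable lebesgue (\<lambda>x. w x * partial i (\<phi> k) x)" for k by (rule wp)
      have "(LINT x|lebesgue. (w x * partial i (\<phi> j) x - w x * partial i (\<phi> k) x)\<^sup>2)
          \<le> 2 * (H_norm (\<lambda>x. \<phi> j x - \<phi> k x))\<^sup>2" for j k
        using weighted_partial_le_H_norm[OF \<psi>[of j k], of i] unfolding d1 w_def by (simp add: right_diff_distrib)
      then show "\<exists>N. \<forall>j\<ge>N. \<forall>k\<ge>N. (LINT x|lebesgue. (w x * partial i (\<phi> j) x - w x * partial i (\<phi> k) x)\<^sup>2) < e"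
        if "e > 0" for e
        using Cauchy2[OF that] by (blast intro: le_less_trans)
    qed
    then show "\<exists>V. square_integrable lebesgue V \<and> (\<lambda>k. LINT x|lebesgue. (w x * partial i (\<phi> k) x - V x)\<^sup>2) \<longlonglongrightarrow> 0"
      by blast
  qed
  from choice[OF this] obtain V where V: "\<And>i. square_integrable lebesgue (V i)"
    "\<And>i. (\<lambda>k. LINT x|lebesgue. (w x * partial i (\<phi> k) x - V i x)\<^sup>2) \<longlonglongrightarrow> 0"
    by blast
  define G where "G x = (\<chi> i. V i x / w x)" for x
  note bounded = tendsto_square_integrable_mult_bounded[OF wp V]
  have m1: "(\<lambda>x. 1 / w x) \<in> borel_measurable lebesgue" "(\<lambda>x. x $ j / w x) \<in> borel_measurable lebesgue" for j
    using w(3) by (auto intro!: measurable_lebesgue_continuous continuous_on_divide contw continuous_intros)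
  have b1: "\<bar>1 / w x\<bar> \<le> 1" for x using w[of x] by simp
  have b2: "\<bar>x $ j / w x\<bar> \<le> 1" for x j
  proof -
    have "\<bar>x $ j\<bar> \<le> norm x" by (rule component_le_norm_cart)
    also have "\<dots> \<le> w x" unfolding w_def by (rule real_le_rsqrt) simp
    finally show ?thesis using w[of x] by (simp add: divide_le_eq)
  qed
  have e1: "1 / w x * (w x * partial i (\<phi> k) x) = partial i (\<phi> k) x" "1 / w x * V i x = G x $ i"
    "x $ j / w x * (w x * partial i (\<phi> k) x) = x $ j * partial i (\<phi> k) x" "x $ j / w x * V i x = x $ j * G x $ i"
    for x i j k using w(3)[of x] by (simp_all add: G_def)
  show thesis
    by (rule that[of \<phi> L G])
      (rule \<phi> su lu L bounded[OF m1(1) b1, unfolded e1] bounded[OF m1(2) b2, unfolded e1])+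
qed

lemma has_weak_grad_limit:
  fixes u :: "real^'n \<Rightarrow> real"
  assumes \<phi>: "\<And>k. \<phi> k \<in> test_functions"
    and u: "square_integrable lebesgue u" "(\<lambda>k. LINT x|lebesgue. (\<phi> k x - u x)\<^sup>2) \<longlonglongrightarrow> 0"
    and G: "\<And>i. square_integrable lebesgue (\<lambda>x. G x $ i)"
      "\<And>i. (\<lambda>k. LINT x|lebesgue. (partial i (\<phi> k) x - G x $ i)\<^sup>2) \<longlonglongrightarrow> 0"
  shows "has_weak_grad u G"
  unfolding has_weak_grad_def
proof (intro conjI allI ballI)
  show "loc_integrable u" by (rule square_integrable_loc_integrable[OF u(1)])
  show "loc_integrable (\<lambda>x. G x $ i)" for i by (rule square_integrable_loc_integrable[OF G(1)])
  fix \<psi> :: "real^'n \<Rightarrow> real" and i assume \<psi>: "\<psi> \<in> test_functions"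
  have cs: "compactly_supported f" "continuous_on UNIV f" if "f \<in> test_functions" for f :: "real^'n \<Rightarrow> real"
    using test_cs[OF that] cs_continuous[OF test_cs[OF that]] .
  have "(LINT x|lebesgue. \<phi> k x * partial i \<psi> x) = - (LINT x|lebesgue. partial i (\<phi> k) x * \<psi> x)" for k
  proof -
    have "integral\<^sup>L lborel (\<lambda>x. partial i (\<phi> k) x * \<psi> x) = - integral\<^sup>L lborel (\<lambda>x. \<phi> k x * partial i \<psi> x)"
      by (rule cs_integral_by_parts[where e = "axis i 1"])
        (intro cs partial_test \<phi> \<psi> partial_has_real_derivative test_differentiable)+
    then show ?thesis
      using cs(2) \<phi> \<psi> by (simp add: integral_lebesgue_continuous continuous_on_mult partial_test)
  qed
  then have "(\<lambda>k. - (LINT x|lebesgue. partial i (\<phi> k) x * \<psi> x)) \<longlonglongrightarrow> (LINT x|lebesgue. u x * partial i \<psi> x)"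
    using tendsto_integral_mult_square_integrable[OF test_square_integrable[OF \<phi>] u
        test_square_integrable[OF partial_test[OF \<psi>]], of i] by simp
  moreover have "(\<lambda>k. - (LINT x|lebesgue. partial i (\<phi> k) x * \<psi> x)) \<longlonglongrightarrow> - (LINT x|lebesgue. G x $ i * \<psi> x)"
    by (intro tendsto_minus tendsto_integral_mult_square_integrable test_square_integrable partial_test \<phi> \<psi> G)
  ultimately show "(LINT x|lebesgue. u x * partial i \<psi> x) = - (LINT x|lebesgue. G x $ i * \<psi> x)"
    by (rule LIMSEQ_unique)
qed

lemma has_weak_laplacian_limit:
  fixes u :: "real^'n \<Rightarrow> real"
  assumes \<phi>: "\<And>k. \<phi> k \<in> test_functions"
    and u: "square_integrable lebesgue u" "(\<lambda>k. LINT x|lebesgue. (\<phi> k x - u x)\<^sup>2) \<longlonglongrightarrow> 0"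
    and L: "square_integrable lebesgue L" "(\<lambda>k. LINT x|lebesgue. (laplacian (\<phi> k) x - L x)\<^sup>2) \<longlonglongrightarrow> 0"
  shows "has_weak_laplacian u L"
  unfolding has_weak_laplacian_def
proof (intro conjI ballI)
  show "loc_integrable u" "loc_integrable L"
    by (intro square_integrable_loc_integrable u L)+
  fix \<psi> :: "real^'n \<Rightarrow> real" assume \<psi>: "\<psi> \<in> test_functions"
  have cs: "compactly_supported f" "continuous_on UNIV f" if "f \<in> test_functions" for f :: "real^'n \<Rightarrow> real"
    using test_cs[OF that] cs_continuous[OF test_cs[OF that]] .
  have sym: "integral\<^sup>L lborel (\<lambda>x. f x * partial i (partial i g) x) = - integral\<^sup>L lborel (\<lambda>x. partial i g x * partial i f x)"
    if "f \<in> test_functions" "g \<in> test_functions" for f g :: "real^'n \<Rightarrow> real" and i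
  proof -
    have "integral\<^sup>L lborel (\<lambda>x. partial i (partial i g) x * f x) = - integral\<^sup>L lborel (\<lambda>x. partial i g x * partial i f x)"
      by (rule cs_integral_by_parts[where e = "axis i 1"])
        (intro cs partial_test that partial_has_real_derivative test_differentiable)+
    then show ?thesis by (simp add: mult.commute)
  qed
  \<comment> \<open>The right side is symmetric in f and g, so the Laplacian may be moved from one
    factor to the other.\<close>
  have expand: "(LINT x|lebesgue. f x * laplacian g x) = - (\<Sum>i\<in>UNIV. integral\<^sup>L lborel (\<lambda>x. partial i g x * partial i f x))"
    if f: "f \<in> test_functions" and g: "g \<in> test_functions" for f g :: "real^'n \<Rightarrow> real"
  proof -
    have "(LINT x|lebesgue. f x * laplacian g x) = integral\<^sup>L lborel (\<lambda>x. f x * laplacian g x)"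
      by (intro integral_lebesgue_continuous continuous_on_mult cs(2) f laplacian_test(1) g)
    also have "\<dots> = integral\<^sup>L lborel (\<lambda>x. \<Sum>i\<in>UNIV. f x * partial i (partial i g) x)"
      by (simp add: laplacian_def sum_distrib_left)
    also have "\<dots> = (\<Sum>i\<in>UNIV. integral\<^sup>L lborel (\<lambda>x. f x * partial i (partial i g) x))"
      by (intro Bochner_Integration.integral_sum cs_integrable cs_mult_left cs f g partial_test)
    finally show ?thesis by (simp add: sym[OF f g] sum_negf)
  qed
  have "(LINT x|lebesgue. \<phi> k x * laplacian \<psi> x) = (LINT x|lebesgue. laplacian (\<phi> k) x * \<psi> x)" for k
    using expand[OF \<phi> \<psi>, of k] expand[OF \<psi> \<phi>, of k] by (simp add: mult.commute)
  then have "(\<lambda>k. LINT x|lebesgue. laplacian (\<phi> k) x * \<psi> x) \<longlonglongrightarrow> (LINT x|lebesgue. u x * laplacian \<psi> x)"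
    using tendsto_integral_mult_square_integrable[OF test_square_integrable[OF \<phi>] u laplacian_test(2)[OF \<psi>]] by simp
  moreover have "(\<lambda>k. LINT x|lebesgue. laplacian (\<phi> k) x * \<psi> x) \<longlonglongrightarrow> (LINT x|lebesgue. L x * \<psi> x)"
    by (intro tendsto_integral_mult_square_integrable test_square_integrable laplacian_test \<phi> \<psi> L)
  ultimately show "(LINT x|lebesgue. u x * laplacian \<psi> x) = (LINT x|lebesgue. L x * \<psi> x)"
    by (rule LIMSEQ_unique)
qed

lemma grad_gauss:
  fixes x :: "real^'n"
  shows "grad (\<lambda>x. c * gauss b x) x = - (c * b * gauss b x) *\<^sub>R x"
proof -
  have "((\<lambda>x. c * gauss b x) has_derivative (\<lambda>v. c * (- b * (x \<bullet> v) * gauss b x))) (at x)"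
    by (intro has_derivative_mult_right gauss_has_derivative)
  from partial_eqI[OF this] show ?thesis
    by (simp add: vec_eq_iff grad_def inner_axis)
qed

text \<open>Replaces the chosen weak gradient by the limit G inside an integral whose integrand is a
  sum of squares, and separates the summands.\<close>

lemma integral_weak_grad_sum_power2:
  fixes u :: "real^'n \<Rightarrow> real" and h :: "'i \<Rightarrow> real^'n \<Rightarrow> real^'n \<Rightarrow> real"
  assumes G: "has_weak_grad u G"
    and F: "\<And>x v. F x v = (\<Sum>i\<in>I. (h i x v)\<^sup>2)" and g: "\<And>i x. h i x (G x) = g i x"
    and g_int: "\<And>i. i \<in> I \<Longrightarrow> square_integrable lebesgue (g i)"
    and h_meas: "\<And>i. i \<in> I \<Longrightarrow> (\<lambda>x. h i x (weak_grad u x)) \<in> borel_measurable lebesgue"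
  shows "(LINT x|lebesgue. F x (weak_grad u x)) = (\<Sum>i\<in>I. LINT x|lebesgue. (g i x)\<^sup>2)"
proof -
  have "(LINT x|lebesgue. F x (weak_grad u x)) = (LINT x|lebesgue. (\<Sum>i\<in>I. (g i x)\<^sup>2))"
  proof (rule integral_cong_AE)
    show "(\<lambda>x. F x (weak_grad u x)) \<in> borel_measurable lebesgue"
      unfolding F using h_meas by (intro borel_measurable_sum borel_measurable_power)
    show "(\<lambda>x. \<Sum>i\<in>I. (g i x)\<^sup>2) \<in> borel_measurable lebesgue"
      using g_int by (intro borel_measurable_sum borel_measurable_power) (simp add: square_integrable_def)
    show "AE x in lebesgue. F x (weak_grad u x) = (\<Sum>i\<in>I. (g i x)\<^sup>2)"
      using weak_grad_AE(1)[OF G] by eventually_elim (simp add: F g)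
  qed
  also have "\<dots> = (\<Sum>i\<in>I. LINT x|lebesgue. (g i x)\<^sup>2)"
    using g_int by (intro Bochner_Integration.integral_sum) (simp add: square_integrable_def)
  finally show ?thesis .
qed

theorem theorem1p5:
  fixes u :: "real^'n \<Rightarrow> real"
  assumes "CARD('n) \<ge> 2"
    and "u \<in> H2_0m2"
    and "\<not> (AE x in lebesgue. u x = 0)"
  shows "deficit u \<ge> 1 / (384 * (real CARD('n) + 2)) *
    Inf {(LINT x|lebesgue. (norm (weak_grad u x - grad \<phi> x))\<^sup>2) /
         (LINT x|lebesgue. (norm (weak_grad u x))\<^sup>2) | \<phi>.
         \<phi> \<in> Gaussians \<and>
         (LINT x|lebesgue. (norm (weak_grad u x))\<^sup>2) = (LINT x|lebesgue. (norm (grad \<phi> x))\<^sup>2)}"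
proof -
  obtain \<phi> :: "nat \<Rightarrow> real^'n \<Rightarrow> real" and L :: "real^'n \<Rightarrow> real" and G :: "real^'n \<Rightarrow> real^'n"
    where \<phi>: "\<And>k. \<phi> k \<in> test_functions"
    and u: "square_integrable lebesgue u" "(\<lambda>k. LINT x|lebesgue. (\<phi> k x - u x)\<^sup>2) \<longlonglongrightarrow> 0"
    and L: "square_integrable lebesgue L" "(\<lambda>k. LINT x|lebesgue. (laplacian (\<phi> k) x - L x)\<^sup>2) \<longlonglongrightarrow> 0"
    and G: "\<And>i. square_integrable lebesgue (\<lambda>x. G x $ i)"
      "\<And>i. (\<lambda>k. LINT x|lebesgue. (partial i (\<phi> k) x - G x $ i)\<^sup>2) \<longlonglongrightarrow> 0"
    and xG: "\<And>i j. square_integrable lebesgue (\<lambda>x. x $ j * G x $ i)"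
      "\<And>i j. (\<lambda>k. LINT x|lebesgue. (x $ j * partial i (\<phi> k) x - x $ j * G x $ i)\<^sup>2) \<longlonglongrightarrow> 0"
    by (rule H2_0m2_limits[OF assms(2)]) blast
  have wG: "has_weak_grad u G" by (rule has_weak_grad_limit[OF \<phi> u G])
  have wL: "has_weak_laplacian u L" by (rule has_weak_laplacian_limit[OF \<phi> u L])
  define n where "n = real CARD('n)"
  have n: "n > 0" by (simp add: n_def)
  define P where "P = (LINT x|lebesgue. (L x)\<^sup>2)"
  define W where "W = (\<Sum>j\<in>UNIV. \<Sum>k\<in>UNIV. LINT x|lebesgue. (x $ k * G x $ j)\<^sup>2)"
  define N where "N = (\<Sum>j\<in>UNIV. LINT x|lebesgue. (G x $ j)\<^sup>2)"
  define T where "T b = (\<Sum>j\<in>UNIV. LINT x|lebesgue. G x $ j * (x $ j * gauss b x))" for b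
  define Z where "Z b = gauss_mass TYPE(real^'n) b" for b
  define E where "E b = P + b\<^sup>2 * W - (n + 2) * b * N" for b
  have Z: "Z b > 0" if "b > 0" for b unfolding Z_def by (rule gauss_mass_pos[OF that])
  have P0: "P \<ge> 0" and W0: "W \<ge> 0" and N0: "N \<ge> 0"
    by (simp_all add: P_def W_def N_def sum_nonneg)

  have cs: "compactly_supported (partial j (\<phi> k))" "continuous_on UNIV (partial j (\<phi> k))"
    "square_integrable lebesgue (partial j (\<phi> k))" for j k
    by (intro cs_continuous test_cs test_square_integrable partial_test \<phi>)+
  have limN: "(\<lambda>k. LBINT x. (partial j (\<phi> k) x)\<^sup>2) \<longlonglongrightarrow> (LINT x|lebesgue. (G x $ j)\<^sup>2)" for j
    using tendsto_integral_power2[OF cs(3) G]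
    by (simp add: integral_lebesgue_continuous continuous_on_power cs(2))
  have limW: "(\<lambda>k. LBINT x. (x $ i)\<^sup>2 * (partial j (\<phi> k) x)\<^sup>2) \<longlonglongrightarrow> (LINT x|lebesgue. (x $ i * G x $ j)\<^sup>2)" for i j
  proof -
    have "square_integrable lebesgue (\<lambda>x. x $ i * partial j (\<phi> k) x)" for k
      by (intro square_integrable_completion cs_square_integrable cs_mult_right cs continuous_intros)
    from tendsto_integral_power2[OF this xG] show ?thesis
      by (subst (asm) integral_lebesgue_continuous)
        (auto intro!: continuous_intros cs(2) simp: power_mult_distrib)
  qed
  have limP: "(\<lambda>k. LBINT x. (\<Sum>j\<in>UNIV. partial j (partial j (\<phi> k)) x)\<^sup>2) \<longlonglongrightarrow> P"
    using tendsto_integral_power2[OF laplacian_test(2)[OF \<phi>] L] unfolding P_def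
    by (simp add: integral_lebesgue_continuous continuous_on_power laplacian_test(1)[OF \<phi>])
      (simp add: laplacian_def)
  have limU: "(\<lambda>k. LBINT x. (\<phi> k x)\<^sup>2) \<longlonglongrightarrow> (LINT x|lebesgue. (u x)\<^sup>2)"
    using tendsto_integral_power2[OF test_square_integrable[OF \<phi>] u]
    by (simp add: integral_lebesgue_continuous continuous_on_power cs_continuous[OF test_cs[OF \<phi>]])
  have limT: "(\<lambda>k. gradient_moment (\<phi> k) b j j) \<longlonglongrightarrow> (LINT x|lebesgue. G x $ j * (x $ j * gauss b x))"
    if b: "b > 0" for b j
  proof -
    have "(\<lambda>k. LINT x|lebesgue. partial j (\<phi> k) x * (x $ j * gauss b x)) \<longlonglongrightarrow> (LINT x|lebesgue. G x $ j * (x $ j * gauss b x))"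
      by (intro tendsto_integral_mult_square_integrable cs(3) G square_integrable_completion gauss_coord(1) b)
    moreover have "(LINT x|lebesgue. partial j (\<phi> k) x * (x $ j * gauss b x)) = gradient_moment (\<phi> k) b j j" for k
      unfolding gradient_moment_def[OF \<phi> b] by (intro integral_lebesgue_continuous continuous_intros cs(2))
    ultimately show ?thesis by simp
  qed
  have limE: "(\<lambda>k. (LBINT x. (\<Sum>j\<in>UNIV. partial j (partial j (\<phi> k)) x)\<^sup>2)
      + b\<^sup>2 * (\<Sum>j\<in>UNIV. \<Sum>i\<in>UNIV. LBINT x. (x $ i)\<^sup>2 * (partial j (\<phi> k) x)\<^sup>2)
      - (real CARD('n) + 2) * b * (\<Sum>j\<in>UNIV. LBINT x. (partial j (\<phi> k) x)\<^sup>2)) \<longlonglongrightarrow> E b" for b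
    unfolding E_def n_def N_def W_def by (intro tendsto_intros limP limW limN)
  \<comment> \<open>The limit is taken for each fixed b; only afterwards is b adapted to u.\<close>
  have core: "b * (N - 2 * b * (T b)\<^sup>2 / (n * Z b)) \<le> 9 * E b" if b: "b > 0" for b
  proof (rule LIMSEQ_le)
    show "(\<lambda>k. b * ((\<Sum>j\<in>UNIV. LBINT x. (partial j (\<phi> k) x)\<^sup>2)
        - 2 * b * (\<Sum>j\<in>UNIV. gradient_moment (\<phi> k) b j j)\<^sup>2 / (real CARD('n) * gauss_mass TYPE(real^'n) b)))
      \<longlonglongrightarrow> b * (N - 2 * b * (T b)\<^sup>2 / (n * Z b))"
      unfolding N_def T_def n_def Z_def
      by (intro tendsto_intros limN limT b) (use gauss_mass_pos[OF b, where 'a = "real^'n"] in simp)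
    show "(\<lambda>k. 9 * ((LBINT x. (\<Sum>j\<in>UNIV. partial j (partial j (\<phi> k)) x)\<^sup>2)
      + b\<^sup>2 * (\<Sum>j\<in>UNIV. \<Sum>i\<in>UNIV. LBINT x. (x $ i)\<^sup>2 * (partial j (\<phi> k) x)\<^sup>2)
      - (real CARD('n) + 2) * b * (\<Sum>j\<in>UNIV. LBINT x. (partial j (\<phi> k) x)\<^sup>2))) \<longlonglongrightarrow> 9 * E b"
      by (intro tendsto_mult_left limE)
  qed (use energy_spectral_gap[OF \<phi> b assms(1)] in blast)
  have E_nonneg: "E b \<ge> 0" if b: "b > 0" for b
    by (rule LIMSEQ_le_const[OF limE]) (use energy_nonneg[OF \<phi> b] in blast)
  have hardy: "(LINT x|lebesgue. (u x)\<^sup>2) \<le> 4 * W"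
  proof (rule LIMSEQ_le[OF limU])
    show "(\<lambda>k. 4 * (\<Sum>j\<in>UNIV. \<Sum>i\<in>UNIV. LBINT x. (x $ i)\<^sup>2 * (partial j (\<phi> k) x)\<^sup>2)) \<longlonglongrightarrow> 4 * W"
      unfolding W_def by (intro tendsto_intros limW)
  qed (use weighted_hardy[OF \<phi>, of 1] in auto)

  \<comment> \<open>Otherwise G vanishes almost everywhere, so W = 0, and the Hardy bound forces u =
    0.\<close>
  have N: "N > 0"
  proof (rule ccontr)
    assume "\<not> N > 0"
    with N0 have "N = 0" by linarith
    then have "(LINT x|lebesgue. (G x $ j)\<^sup>2) = 0" for j
      unfolding N_def by (subst (asm) sum_nonneg_eq_0_iff) auto
    then have G0: "AE x in lebesgue. (G x $ j)\<^sup>2 = 0" for j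
      using integral_nonneg_eq_0_iff_AE[of lebesgue "\<lambda>x. (G x $ j)\<^sup>2"] G(1)[of j] by (simp add: square_integrable_def)
    have "(LINT x|lebesgue. (x $ k * G x $ j)\<^sup>2) = 0" for j k
      using G0[of j] by (intro integral_eq_zero_AE) (auto elim: eventually_mono)
    then have "(LINT x|lebesgue. (u x)\<^sup>2) = 0"
      using hardy by (intro antisym) (simp_all add: W_def)
    then have "AE x in lebesgue. (u x)\<^sup>2 = 0"
      using integral_nonneg_eq_0_iff_AE[of lebesgue "\<lambda>x. (u x)\<^sup>2"] u(1) by (simp add: square_integrable_def)
    with assms(3) show False by simp
  qed
  have W: "W > 0"
  proof (rule ccontr)
    assume "\<not> W > 0"
    with W0 have "W = 0" by linarith
    \<comment> \<open>At this b the energy with W = 0 would be -1.\<close>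
    moreover have "0 < (P + 1) / ((n + 2) * N)" using P0 n N by simp
    ultimately show False using E_nonneg[of "(P + 1) / ((n + 2) * N)"] n N by (simp add: E_def)
  qed
  have P: "P > 0"
  proof (rule ccontr)
    assume "\<not> P > 0"
    with P0 have "P = 0" by linarith
    \<comment> \<open>The minimiser of the energy when P = 0; its value there is negative.\<close>
    define b where "b = (n + 2) * N / (2 * W)"
    have b: "b > 0" using n N W by (simp add: b_def)
    have bW: "b * W = (n + 2) * N / 2" using W by (simp add: b_def)
    have "E b = b * (b * W) - b * ((n + 2) * N)"
      by (simp add: E_def \<open>P = 0\<close> power2_eq_square mult_ac)
    also have "\<dots> = - (b * ((n + 2) * N / 2))"
      unfolding bW by (simp add: field_simps)
    finally have "E b = - (b * ((n + 2) * N / 2))" .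
    moreover have "b * ((n + 2) * N / 2) > 0" using b n N by simp
    ultimately show False using E_nonneg[OF b] by linarith
  qed
  \<comment> \<open>The minimiser of E b / b = P / b + b W - (n + 2) N. There the first two terms
    are equal, and their sum is twice the product in the numerator of the deficit.\<close>
  define b where "b = sqrt P / sqrt W"
  have b: "b > 0" using P W by (simp add: b_def)
  have Zb: "Z b > 0" by (rule Z[OF b])
  have E_eq: "E b = 2 * b * (sqrt P * sqrt W) - (n + 2) * b * N"
  proof -
    have "b\<^sup>2 * W = P" using P W by (simp add: b_def power_divide)
    moreover have "b * (sqrt P * sqrt W) = P" using P W by (simp add: b_def)
    ultimately show ?thesis by (simp add: E_def)
  qed

  have weak_P: "(LINT x|lebesgue. (weak_laplacian u x)\<^sup>2) = P"
    unfolding P_def using weak_laplacian_AE[OF wL] L(1)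
    by (intro integral_cong_AE) (auto simp: square_integrable_def elim: eventually_mono)
  note wgm = weak_grad_AE(2)[OF wG]
  have weak_N: "(LINT x|lebesgue. (norm (weak_grad u x))\<^sup>2) = N"
    unfolding N_def
    by (rule integral_weak_grad_sum_power2[OF wG, where F = "\<lambda>x v. (norm v)\<^sup>2" and h = "\<lambda>i x v. v $ i"]) (auto simp: norm_power2_vec G(1) wgm)
  have weak_W: "(LINT x|lebesgue. (norm x)\<^sup>2 * (norm (weak_grad u x))\<^sup>2) = W"
  proof -
    have "(LINT x|lebesgue. (norm x)\<^sup>2 * (norm (weak_grad u x))\<^sup>2)
        = (\<Sum>(j, k)\<in>UNIV \<times> UNIV. LINT x|lebesgue. (x $ k * G x $ j)\<^sup>2)"
    proof -
      have "(norm x)\<^sup>2 * (norm v)\<^sup>2 = (\<Sum>p\<in>UNIV \<times> UNIV. (x $ snd p * v $ fst p)\<^sup>2)" for x v :: "real^'n"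
      proof -
        have "(norm x)\<^sup>2 * (norm v)\<^sup>2 = (norm v)\<^sup>2 * (norm x)\<^sup>2" by (rule mult.commute)
        also have "\<dots> = (\<Sum>j\<in>UNIV. \<Sum>k\<in>UNIV. (x $ k * v $ j)\<^sup>2)"
          unfolding norm_power2_vec sum_product by (simp add: power_mult_distrib mult.commute)
        finally show ?thesis by (simp add: sum.cartesian_product case_prod_unfold)
      qed
      moreover have xm: "(\<lambda>x::real^'n. x $ j) \<in> borel_measurable lebesgue" for j
        by (intro measurable_lebesgue_continuous continuous_intros)
      ultimately have "(LINT x|lebesgue. (norm x)\<^sup>2 * (norm (weak_grad u x))\<^sup>2)
        = (\<Sum>p\<in>UNIV \<times> UNIV. LINT x|lebesgue. (x $ snd p * G x $ fst p)\<^sup>2)"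
        by (intro integral_weak_grad_sum_power2[OF wG, where F = "\<lambda>x v. (norm x)\<^sup>2 * (norm v)\<^sup>2" and h = "\<lambda>p x v. x $ snd p * v $ fst p"])
          (auto intro!: borel_measurable_times xm wgm simp: xG(1))
      then show ?thesis by (simp add: case_prod_unfold)
    qed
    then show ?thesis by (simp add: W_def sum.cartesian_product)
  qed

  \<comment> \<open>The modulus makes the gradient norm of the competitor equal to that of u, as the
    infimum demands. The sign of c is opposite to that of T b because grad gauss = - b x gauss, so
    the inner product with the gradient of u is nonnegative.\<close>
  define c0 where "c0 = sqrt (2 * N / (b * n * Z b))"
  define c where "c = (if T b \<ge> 0 then - c0 else c0)"
  have c0: "c0 \<ge> 0" using b n Zb N by (simp add: c0_def)
  have c2: "c\<^sup>2 * b\<^sup>2 * (n * (Z b / (2 * b))) = N"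
  proof -
    have "c\<^sup>2 = 2 * N / (b * n * Z b)" using b n Zb N by (simp add: c_def c0_def)
    then show ?thesis using b n Zb by (simp add: power2_eq_square)
  qed
  define \<Phi> where "\<Phi> x = c * gauss b x" for x :: "real^'n"
  have \<Phi>: "\<Phi> \<in> Gaussians"
  proof -
    have "\<Phi> = (\<lambda>x. c * exp (- (b / 2) * (norm x)\<^sup>2))" by (auto simp: \<Phi>_def gauss_def)
    moreover have "b / 2 > 0" using b by simp
    ultimately show ?thesis unfolding Gaussians_def by blast
  qed
  have grad_\<Phi>: "grad \<Phi> x = - (c * b * gauss b x) *\<^sub>R x" for x
    unfolding \<Phi>_def by (rule grad_gauss)
  have sg: "square_integrable lebesgue (\<lambda>x::real^'n. x $ i * gauss b x)" for i
    by (intro square_integrable_completion gauss_coord(1) b)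
  have Ig: "(LINT x|lebesgue. (x $ i * gauss b x)\<^sup>2) = Z b / (2 * b)" for i :: 'n
  proof -
    have "(LINT x|lebesgue. (x $ i * gauss b x)\<^sup>2) = (LBINT x. (x $ i * gauss b x)\<^sup>2)"
      by (intro integral_lebesgue_continuous continuous_intros)
    then show ?thesis by (simp only: gauss_coord(2)[OF b] Z_def)
  qed
  have norm_\<Phi>: "(LINT x|lebesgue. (norm (grad \<Phi> x))\<^sup>2) = N"
  proof -
    have "(LINT x|lebesgue. (norm (grad \<Phi> x))\<^sup>2) = (LINT x|lebesgue. (\<Sum>i\<in>(UNIV::'n set). (c * b)\<^sup>2 * (x $ i * gauss b x)\<^sup>2))"
      unfolding norm_power2_vec grad_\<Phi> by (simp add: power_mult_distrib mult_ac)
    also have "\<dots> = (\<Sum>i\<in>(UNIV::'n set). (c * b)\<^sup>2 * (Z b / (2 * b)))"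
      using sg by (subst Bochner_Integration.integral_sum) (auto simp: square_integrable_def Ig)
    also have "\<dots> = N" using c2 by (simp add: n_def power_mult_distrib mult_ac)
    finally show ?thesis .
  qed
  have diff_\<Phi>: "(LINT x|lebesgue. (norm (weak_grad u x - grad \<Phi> x))\<^sup>2) = 2 * N - 2 * (c0 * b * \<bar>T b\<bar>)"
  proof -
    have "(LINT x|lebesgue. (norm (weak_grad u x - grad \<Phi> x))\<^sup>2)
        = (\<Sum>i\<in>UNIV. LINT x|lebesgue. (G x $ i + c * b * (x $ i * gauss b x))\<^sup>2)"
    proof (rule integral_weak_grad_sum_power2[OF wG, where F = "\<lambda>x v. (norm (v - grad \<Phi> x))\<^sup>2" and h = "\<lambda>i x v. v $ i + c * b * (x $ i * gauss b x)"])
      show "(norm (v - grad \<Phi> x))\<^sup>2 = (\<Sum>i\<in>UNIV. (v $ i + c * b * (x $ i * gauss b x))\<^sup>2)" for x v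
        unfolding norm_power2_vec grad_\<Phi> by (simp add: mult_ac)
      show "(\<lambda>x. weak_grad u x $ i + c * b * (x $ i * gauss b x)) \<in> borel_measurable lebesgue" for i
        by (intro borel_measurable_add wgm square_integrable_measurable square_integrable_mult_left sg)
    qed (auto intro!: square_integrable_add G(1) square_integrable_mult_left sg)
    also have "\<dots> = (\<Sum>i\<in>UNIV. (LINT x|lebesgue. (G x $ i)\<^sup>2) + 2 * (c * b) * (LINT x|lebesgue. G x $ i * (x $ i * gauss b x))
        + (c * b)\<^sup>2 * (Z b / (2 * b)))"
      using integral_add_power2[OF G(1) square_integrable_mult_left[OF sg]]
      by (intro sum.cong refl) (simp add: power_mult_distrib[of "c * b"] mult.left_commute[of _ "c * b"] Ig)
    also have "\<dots> = N + 2 * (c * b) * T b + c\<^sup>2 * b\<^sup>2 * (n * (Z b / (2 * b)))"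
      by (simp add: sum.distrib sum_distrib_left[symmetric] N_def T_def n_def power_mult_distrib)
    also have "\<dots> = 2 * N - 2 * (c0 * b * \<bar>T b\<bar>)"
      unfolding c2 by (simp add: c_def)
    finally show ?thesis .
  qed
  \<comment> \<open>The squared norm of the projection of the gradient onto the Gaussian line. The
    inner product with the competitor is sqrt (N R), which is at least R as R <= N; so 2 N - 2 sqrt
    (N R) <= 2 (N - R), twice the squared distance to the line.\<close>
  define R where "R = 2 * b * (T b)\<^sup>2 / (n * Z b)"
  have R0: "R \<ge> 0" using b n Zb by (simp add: R_def)
  have cT: "(c0 * b * \<bar>T b\<bar>)\<^sup>2 = N * R"
  proof -
    have c02: "c0\<^sup>2 = 2 * N / (b * n * Z b)" using b n Zb N by (simp add: c0_def)
    have "(c0 * b * \<bar>T b\<bar>)\<^sup>2 = c0\<^sup>2 * b\<^sup>2 * (T b)\<^sup>2" by (simp add: power_mult_distrib)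
    also have "\<dots> = N * R"
      unfolding c02 R_def using b n Zb by (simp add: field_simps power2_eq_square)
    finally show ?thesis .
  qed
  \<comment> \<open>Nonnegativity of the squared distance just computed bounds the inner product by
    N, which yields R <= N.\<close>
  have "0 \<le> 2 * N - 2 * (c0 * b * \<bar>T b\<bar>)"
    unfolding diff_\<Phi>[symmetric] by simp
  then have "(c0 * b * \<bar>T b\<bar>)\<^sup>2 \<le> N\<^sup>2" using c0 b by (intro power_mono) auto
  then have "N * R \<le> N * N" unfolding cT by (simp only: power2_eq_square)
  then have "R \<le> N" using N by simp
  then have "R\<^sup>2 \<le> (c0 * b * \<bar>T b\<bar>)\<^sup>2"
    unfolding cT unfolding power2_eq_square by (rule mult_right_mono[OF _ R0])
  then have R_le: "R \<le> c0 * b * \<bar>T b\<bar>"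
    by (rule power2_le_imp_le) (intro mult_nonneg_nonneg c0 less_imp_le[OF b] abs_ge_zero)
  let ?S = "{(LINT x|lebesgue. (norm (weak_grad u x - grad \<phi> x))\<^sup>2) /
         (LINT x|lebesgue. (norm (weak_grad u x))\<^sup>2) | \<phi>.
         \<phi> \<in> Gaussians \<and>
         (LINT x|lebesgue. (norm (weak_grad u x))\<^sup>2) = (LINT x|lebesgue. (norm (grad \<phi> x))\<^sup>2)}"
  have "Inf ?S \<le> (2 * N - 2 * (c0 * b * \<bar>T b\<bar>)) / N"
  proof (rule cInf_lower)
    show "(2 * N - 2 * (c0 * b * \<bar>T b\<bar>)) / N \<in> ?S"
      by (intro CollectI exI[of _ \<Phi>] conjI \<Phi>) (simp_all only: diff_\<Phi> weak_N norm_\<Phi>)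
    show "bdd_below ?S" by (rule bdd_belowI[of _ 0]) auto
  qed
  also have "\<dots> \<le> 2 * (N - R) / N"
    using R_le N by (intro divide_right_mono) auto
  also have "\<dots> \<le> 18 * E b / (b * N)"
  proof -
    have "b * (N - R) \<le> 9 * E b" using core[OF b] by (simp add: R_def)
    then have "2 * (N - R) \<le> 18 * E b / b" using b by (simp add: field_simps)
    then have "2 * (N - R) / N \<le> 18 * E b / b / N" using N by (intro divide_right_mono) auto
    then show ?thesis by simp
  qed
  finally have "1 / (384 * (n + 2)) * Inf ?S \<le> 1 / (384 * (n + 2)) * (18 * E b / (b * N))"
    using n by (intro mult_left_mono) auto
  \<comment> \<open>The 18 is 2 times 9, from the sphere and from the spectral gap; E b / (b (n + 2)
    N) is the deficit, so the stated constant follows from 18 <= 384.\<close>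
  also have "\<dots> = 18 / 384 * (E b / (b * (n + 2) * N))"
    by (simp only: times_divide_times_eq mult_1_left mult_ac)
  also have "\<dots> \<le> 1 * (E b / (b * (n + 2) * N))"
    using E_nonneg[OF b] n b N by (intro mult_right_mono) auto
  also have "\<dots> = deficit u"
  proof -
    define K where "K = (n + 2) * N"
    have K: "K \<noteq> 0" using n N by (simp add: K_def)
    have "E b = b * (2 * (sqrt P * sqrt W) - K)" by (simp add: E_eq K_def algebra_simps)
    then have "E b / (b * (n + 2) * N) = 2 * (sqrt P * sqrt W) / K - 1"
      using b K by (simp add: K_def[symmetric] mult.assoc diff_divide_distrib)
    moreover have "(n + 2) / 2 * N = K / 2" by (simp add: K_def)
    ultimately show ?thesis
      unfolding deficit_def weak_P weak_W weak_N n_def[symmetric] by simp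
  qed
  finally show ?thesis by (simp add: n_def)
qed

end
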